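(* Let $X$ be a separable Banach space and let $f:X\to\mathbb{R}$ be quasiconvex and densely continuous. Then $f$ is continuous and essentially Gâteaux differentiable on a dense subset of $X$. If $X$ is reflexive, $f$ is continuous and essentially Gâteaux differentiable on $X$ except at the points of a Haar null set.
   Context: Banach spaces are real. A function $f:X\to\mathbb{R}$ is quasiconvex if $f(\lambda x+(1-\lambda)y)\le\max\{f(x),f(y)\}$ for all $x,y\in X$ and $\lambda\in[0,1]$. It is densely continuous if it is continuous at the points of a dense subset of $X$. Let $S_X$ denote the unit sphere of $X$. The function $f$ is essentially Gâteaux differentiable at $x$ if there are $l_x\in X^*$ and a residual subset $\Omega$ of $S_X$ (i.e., $S_X\setminus\Omega$ is a countable union of nowhere dense subsets of $S_X$) such that $l_x(h)=\lim_{t\to0}\frac{f(x+th)-f(x)}{t}$ for every $h\in\Omega$. "Continuous and essentially Gâteaux differentiable on a set" means that both properties hold at each point of that set, as a function on $X$. A Borel set $E\subset X$ is Haar null if there is a Borel probability measure $\mu$ on $X$ with $\mu(x+E)=0$ for every $x\in X$. "A property holds on $X$ except at the points of a Haar null set" means that there is a Haar null set $N$ such that the property holds at every point of $X\setminus N$. *)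

theory Defs
  imports "HOL-Probability.Probability"
begin

definition quasiconvex :: "('a::real_vector \<Rightarrow> real) \<Rightarrow> bool" where
  "quasiconvex f \<longleftrightarrow>
     (\<forall>x y. \<forall>c\<in>{0..1::real}. f (c *\<^sub>R x + (1 - c) *\<^sub>R y) \<le> max (f x) (f y))"

definition densely_continuous :: "('a::t2_space \<Rightarrow> 'b::topological_space) \<Rightarrow> bool" where
  "densely_continuous f \<longleftrightarrow> closure {x. isCont f x} = UNIV"

definition nowhere_dense_in :: "'a topology \<Rightarrow> 'a set \<Rightarrow> bool" where
  "nowhere_dense_in T A \<longleftrightarrow> A \<subseteq> topspace T \<and> T interior_of (T closure_of A) = {}"

definition residual_in :: "'a topology \<Rightarrow> 'a set \<Rightarrow> bool" where
  "residual_in T \<Omega> \<longleftrightarrow> \<Omega> \<subseteq> topspace T \<and>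
     (\<exists>\<F>. countable \<F> \<and> (\<forall>A\<in>\<F>. nowhere_dense_in T A) \<and> topspace T - \<Omega> = \<Union>\<F>)"

definition essentially_Gateaux_differentiable_at ::
    "('a::real_normed_vector \<Rightarrow> real) \<Rightarrow> 'a \<Rightarrow> bool" where
  "essentially_Gateaux_differentiable_at f x \<longleftrightarrow>
     (\<exists>(l :: 'a \<Rightarrow>\<^sub>L real) \<Omega>. residual_in (top_of_set (sphere 0 1)) \<Omega> \<and>
        (\<forall>h\<in>\<Omega>. ((\<lambda>t. (f (x + t *\<^sub>R h) - f x) / t) \<longlongrightarrow> blinfun_apply l h) (at 0)))"

definition Haar_null :: "'a::real_normed_vector set \<Rightarrow> bool" where
  "Haar_null E \<longleftrightarrow> E \<in> sets borel \<and>
     (\<exists>\<mu> :: 'a measure. prob_space \<mu> \<and> sets \<mu> = sets borel \<and>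
        (\<forall>x. emeasure \<mu> ((\<lambda>e. x + e) ` E) = 0))"

(* Surjectivity of the canonical embedding of X into its bidual, the type argument naming X. *)
definition reflexive_space :: "'a::real_normed_vector itself \<Rightarrow> bool" where
  "reflexive_space _ \<longleftrightarrow>
     (\<forall>\<phi> :: ('a \<Rightarrow>\<^sub>L real) \<Rightarrow>\<^sub>L real. \<exists>x::'a. \<forall>l. blinfun_apply \<phi> l = blinfun_apply l x)"

end

theory Submission
  imports Defs
begin

text \<open>The proof splits the space along one closed convex set. Call a level \<open>a\<close> high when \<open>{f < a}\<close> has interior,
let \<open>F\<close> be the intersection of the closures of the high sublevel sets, and let \<open>G\<close> be the interior of \<open>F\<close>.

Outside \<open>F\<close>, a point \<open>x\<close> has a neighbourhood on which \<open>f\<close> exceeds its values on some ball \<open>B\<close>. Quasiconvexity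
on segments ending in \<open>B\<close> then makes \<open>f\<close> increasing, near \<open>x\<close>, along the open convex cone generated by \<open>x - B\<close>
(\<open>quasiconvex_cone_monotone\<close>). A function that is monotone for an open cone is continuous and Gateaux
differentiable off a null set (\<open>Gateaux_differentiable_off_sigma_avoidable\<close>). In a cone direction \<open>f\<close> is a monotone
function of one variable, so the classical covering arguments give Lipschitz points and directional derivatives
for almost all parameters on each line. Additivity of the derivative in the direction fails only on sets that are
porous in a fixed direction (\<open>good_set_nonporous\<close>), and such sets meet every parallel line in a null set.
Finally, order sandwiches extend the derivative from a countable dense group of directions to all of them.

If \<open>G\<close> is nonempty, then \<open>f \<le> m\<close> on \<open>G\<close> for some \<open>m\<close>, while the closures of the sets \<open>{f < a}\<close> with \<open>a < m\<close> have empty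
interior. At a point of \<open>G\<close> outside all of these closures \<open>f\<close> is continuous, and along all directions outside a
meagre set it is constant near that point, so the essential derivative is 0 (\<open>plateau_essentially_Gateaux\<close>).
Every continuity point of \<open>f\<close> in \<open>G\<close> is of this kind. Together with the null set outside \<open>F\<close> this proves density.

For the second claim, what remains of \<open>F\<close> has to be null. The frontier of a convex set with interior is null,
because its indicator is cone-monotone around every point (\<open>frontier_convex_sigma_avoidable\<close>). Closed convex sets
with empty interior are null in reflexive spaces (\<open>reflexive_convex_sigma_avoidable\<close>); this is the only use of
reflexivity. A set in a proper closed affine subspace meets the lines in some direction at most once. For the other
sets, functionals that almost attain their supremum over the set at one point tend weakly to 0, and Mazur's lemma turns
them into finitely supported measures, with support as close to 0 as desired, that give little mass to every translate.

All exceptional sets are treated through one notion: a Borel set is avoidable if measures concentrated near 0 give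
arbitrarily little mass to all of its translates. A convolution of countably many such measures shows that
countable unions of avoidable sets are Haar null (\<open>sigma_avoidable_imp_Haar_null\<close>).\<close>

section \<open>Sets avoided by small random translations\<close>

lemma separable_countable_dense:
  assumes "separable_space (euclidean :: 'a::metric_space topology)"
  obtains D :: "'a::metric_space set" where "countable D" "closure D = UNIV"
  using assms unfolding separable_space_def by auto

lemma dense_ball:
  fixes x :: "'a::metric_space"
  assumes "closure D = UNIV" "0 < e"
  obtains d where "d \<in> D" "dist d x < e"
  using assms by (metis UNIV_I closure_approachable)

lemma separable_subset_dense:
  fixes K :: "'a::metric_space set"
  assumes sep: "separable_space (euclidean :: 'a topology)"
  obtains D where "countable D" "D \<subseteq> K" "K \<subseteq> closure D"
proof -
  obtain D :: "'a set" where D: "countable D" "closure D = UNIV"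
    using separable_countable_dense[OF sep] .
  define P where "P = {(d, n). d \<in> D \<and> (\<exists>z\<in>K. dist d z < 1 / real (Suc n))}"
  define q where "q = (\<lambda>(d, n). SOME z. z \<in> K \<and> dist d z < 1 / real (Suc n))"
  have q: "q (d, n) \<in> K \<and> dist d (q (d, n)) < 1 / real (Suc n)" if "(d, n) \<in> P" for d n
  proof -
    have "\<exists>z. z \<in> K \<and> dist d z < 1 / real (Suc n)" using that by (auto simp: P_def)
    from someI_ex[OF this] show ?thesis by (simp add: q_def)
  qed
  show ?thesis
  proof (rule that[of "q ` P"])
    have "P \<subseteq> D \<times> UNIV" by (auto simp: P_def)
    then have "countable P" using D(1) by (meson countable_SIGMA countable_subset countableI_type)
    then show "countable (q ` P)" by simp
    show "q ` P \<subseteq> K" using q by force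
    show "K \<subseteq> closure (q ` P)"
    proof
      fix z assume z: "z \<in> K"
      show "z \<in> closure (q ` P)"
        unfolding closure_approachable
      proof (intro allI impI)
        fix e :: real assume "0 < e"
        then obtain n where n: "1 / real (Suc n) < e / 2" using nat_approx_posE[of "e / 2"] by auto
        obtain d where d: "d \<in> D" "dist d z < 1 / real (Suc n)"
          using dense_ball[OF D(2), of "1 / real (Suc n)" z] by auto
        then have P: "(d, n) \<in> P" using z by (auto simp: P_def)
        have "dist (q (d, n)) z < e"
          using dist_triangle[of "q (d, n)" z d] q[OF P] d n by (simp add: dist_commute)
        then show "\<exists>y\<in>q ` P. dist y z < e" using P by blast
      qed
    qed
  qed
qed

text \<open>Separability is a hypothesis on the topology here, not a type class, so the product structure of the Borel sets
and the measurability of sums have to be derived from a countable dense set.\<close>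

lemma separable_open_in_sets_pair:
  fixes U :: "('a::metric_space \<times> 'a) set"
  assumes sep: "separable_space (euclidean :: 'a topology)" and U: "open U"
  shows "U \<in> sets (borel \<Otimes>\<^sub>M borel)"
proof -
  obtain D :: "'a set" where D: "countable D" "closure D = UNIV"
    using separable_countable_dense[OF sep] .
  let ?B = "\<lambda>(d, d', n). ball d (1 / real (Suc n)) \<times> ball d' (1 / real (Suc n))"
  define I where "I = {p \<in> D \<times> D \<times> UNIV. ?B p \<subseteq> U}"
  have "countable (D \<times> D \<times> (UNIV :: nat set))" using D by auto
  then have I: "countable I" by (rule countable_subset[rotated]) (auto simp: I_def)
  have "U = (\<Union>p\<in>I. ?B p)"
  proof
    show "U \<subseteq> (\<Union>p\<in>I. ?B p)"
    proof
      fix z assume z: "z \<in> U"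
      obtain x y where xy: "z = (x, y)" by (cases z)
      obtain A B where AB: "open A" "open B" "z \<in> A \<times> B" "A \<times> B \<subseteq> U"
        by (rule open_prod_elim[OF U z])
      then have "x \<in> A" "y \<in> B" by (simp_all add: xy)
      obtain e1 where e1: "e1 > 0" "ball x e1 \<subseteq> A" using AB \<open>x \<in> A\<close> \<open>y \<in> B\<close> by (meson openE)
      obtain e2 where e2: "e2 > 0" "ball y e2 \<subseteq> B" using AB \<open>x \<in> A\<close> \<open>y \<in> B\<close> by (meson openE)
      obtain n where n: "1 / real (Suc n) < min e1 e2 / 2"
        using nat_approx_posE[of "min e1 e2 / 2"] e1 e2 by auto
      obtain d where d: "d \<in> D" "dist d x < 1 / real (Suc n)"
        using dense_ball[OF D(2)] by (metis of_nat_0_less_iff zero_less_Suc zero_less_divide_1_iff)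
      obtain d' where d': "d' \<in> D" "dist d' y < 1 / real (Suc n)"
        using dense_ball[OF D(2)] by (metis of_nat_0_less_iff zero_less_Suc zero_less_divide_1_iff)
      have "ball d (1 / real (Suc n)) \<subseteq> A"
      proof
        fix w assume "w \<in> ball d (1 / real (Suc n))"
        then have "dist x w < e1" using dist_triangle[of x w d] d n by (simp add: dist_commute)
        then show "w \<in> A" using e1 by auto
      qed
      moreover have "ball d' (1 / real (Suc n)) \<subseteq> B"
      proof
        fix w assume "w \<in> ball d' (1 / real (Suc n))"
        then have "dist y w < e2" using dist_triangle[of y w d'] d' n by (simp add: dist_commute)
        then show "w \<in> B" using e2 by auto
      qed
      ultimately have "(d, d', n) \<in> I" using AB d d' by (auto simp: I_def)
      moreover have "z \<in> ?B (d, d', n)" using d d' xy by simp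
      ultimately show "z \<in> (\<Union>p\<in>I. ?B p)" by blast
    qed
  qed (auto simp: I_def)
  also have "\<dots> \<in> sets (borel \<Otimes>\<^sub>M borel)"
    using I by (intro sets.countable_UN') auto
  finally show ?thesis .
qed

lemma separable_borel_measurable_add:
  fixes f g :: "'b \<Rightarrow> 'a::real_normed_vector"
  assumes sep: "separable_space (euclidean :: 'a topology)"
    and f: "f \<in> borel_measurable M" and g: "g \<in> borel_measurable M"
  shows "(\<lambda>x. f x + g x) \<in> borel_measurable M"
proof (rule borel_measurableI)
  fix S :: "'a set" assume S: "open S"
  define U where "U = (\<lambda>p::'a \<times> 'a. fst p + snd p) -` S"
  have "open U" unfolding U_def using S by (intro open_vimage continuous_intros)
  then have U: "U \<in> sets (borel \<Otimes>\<^sub>M borel)" by (rule separable_open_in_sets_pair[OF sep])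
  have "(\<lambda>x. (f x, g x)) \<in> measurable M (borel \<Otimes>\<^sub>M borel)" using f g by simp
  from measurable_sets[OF this U]
  show "(\<lambda>x. f x + g x) -` S \<inter> space M \<in> sets M" by (simp add: U_def vimage_def)
qed

lemma translate_sets_borel:
  fixes E :: "'a::real_normed_vector set"
  assumes "E \<in> sets borel"
  shows "{y. x + y \<in> E} \<in> sets borel"
proof -
  have "(\<lambda>y. x + y) \<in> borel_measurable borel"
    by (intro borel_measurable_continuous_onI continuous_intros)
  from measurable_sets[OF this assms] show ?thesis by (simp add: vimage_def)
qed

text \<open>Concentration near 0 is what makes this notion, in contrast to Haar nullity itself, stable under the convolution
of infinitely many measures without any preparation.\<close>

definition avoidable :: "'a::real_normed_vector set \<Rightarrow> bool" where
  "avoidable E \<longleftrightarrow> E \<in> sets borel \<and>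
     (\<forall>\<epsilon>>0. \<exists>\<mu>. prob_space \<mu> \<and> sets \<mu> = sets borel \<and> (AE y in \<mu>. norm y < \<epsilon>) \<and>
        (\<forall>x. measure \<mu> {y. x + y \<in> E} \<le> \<epsilon>))"

definition sigma_avoidable :: "'a::real_normed_vector set \<Rightarrow> bool" where
  "sigma_avoidable E \<longleftrightarrow> (\<exists>A :: nat \<Rightarrow> 'a set. (\<forall>n. avoidable (A n)) \<and> E \<subseteq> (\<Union>n. A n))"

lemma avoidable_empty: "avoidable {}"
  unfolding avoidable_def
proof (intro conjI allI impI)
  fix \<epsilon> :: real assume "0 < \<epsilon>"
  then show "\<exists>\<mu>. prob_space \<mu> \<and> sets \<mu> = sets borel \<and> (AE y in \<mu>. norm y < \<epsilon>) \<and>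
        (\<forall>x::'a. measure \<mu> {y. x + y \<in> {}} \<le> \<epsilon>)"
    by (intro exI[of _ "return borel 0"]) (auto simp: prob_space_return AE_return)
qed auto

lemma sigma_avoidable_subset: "sigma_avoidable B \<Longrightarrow> A \<subseteq> B \<Longrightarrow> sigma_avoidable A"
  unfolding sigma_avoidable_def by (meson subset_trans)

lemma avoidable_imp_sigma_avoidable: "avoidable E \<Longrightarrow> sigma_avoidable E"
  unfolding sigma_avoidable_def by (intro exI[of _ "\<lambda>_. E"]) auto

lemma sigma_avoidable_UN:
  assumes I: "countable I" and A: "\<And>i. i \<in> I \<Longrightarrow> sigma_avoidable (A i)"
  shows "sigma_avoidable (\<Union>i\<in>I. A i)"
proof (cases "I = {}")
  case True
  then show ?thesis using avoidable_imp_sigma_avoidable[OF avoidable_empty] by simp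
next
  case False
  have "\<forall>i\<in>I. \<exists>B. (\<forall>n::nat. avoidable (B n)) \<and> A i \<subseteq> (\<Union>n. B n)"
    using A by (simp add: sigma_avoidable_def)
  then obtain B where B: "\<And>i n. i \<in> I \<Longrightarrow> avoidable (B i (n::nat))"
      "\<And>i. i \<in> I \<Longrightarrow> A i \<subseteq> (\<Union>n. B i n)" by metis
  define C where "C = (\<lambda>k. B (from_nat_into I (fst (prod_decode k))) (snd (prod_decode k)))"
  have "avoidable (C k)" for k using B False by (simp add: C_def from_nat_into)
  moreover have "(\<Union>i\<in>I. A i) \<subseteq> (\<Union>k. C k)"
  proof
    fix x assume "x \<in> (\<Union>i\<in>I. A i)"
    then obtain i n where i: "i \<in> I" "x \<in> B i n" using B by blast
    obtain j where "from_nat_into I j = i" using i(1) I from_nat_into_surj by metis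
    then have "x \<in> C (prod_encode (j, n))" using i by (simp add: C_def)
    then show "x \<in> (\<Union>k. C k)" by blast
  qed
  ultimately show ?thesis unfolding sigma_avoidable_def by blast
qed

lemma sigma_avoidable_Un: "sigma_avoidable A \<Longrightarrow> sigma_avoidable B \<Longrightarrow> sigma_avoidable (A \<union> B)"
  using sigma_avoidable_UN[of "{A, B}" id] by auto

text \<open>The measure is the law of a sum of independent variables with laws \<open>M k\<close>. Conditioning on all summands except the
\<open>k\<close>-th, the sum is a translate of that summand, and the bound for \<open>M k\<close> applies to each translate.\<close>

lemma convolution_avoids:
  fixes A :: "nat \<Rightarrow> 'a::banach set"
  assumes sep: "separable_space (euclidean :: 'a topology)"
    and A: "\<And>k. A k \<in> sets borel"
    and M: "\<And>k. prob_space (M k)" "\<And>k. sets (M k) = sets (borel :: 'a measure)"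
    and supp: "\<And>k. AE y in M k. norm y < (1/2) ^ k"
    and le: "\<And>k x. measure (M k) {y. x + y \<in> A k} \<le> (1/2) ^ k"
  obtains \<mu> where "prob_space \<mu>" "sets \<mu> = sets borel" "\<And>k x. measure \<mu> {y. x + y \<in> A k} \<le> (1/2) ^ k"
proof -
  \<comment> \<open>Truncation changes each summand only on a null set and makes the series converge everywhere.\<close>
  define \<tau> where "\<tau> = (\<lambda>k (y::'a). if norm y < (1/2) ^ k then y else 0)"
  define S where "S = (\<lambda>\<omega>. \<Sum>k. \<tau> k (\<omega> k))"
  define P where "P = Pi\<^sub>M (UNIV :: nat set) M"
  interpret P: prob_space P unfolding P_def by (rule prob_space_PiM) (rule M)
  have norm\<tau>: "norm (\<tau> k y) \<le> (1/2) ^ k" for k y by (simp add: \<tau>_def)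
  have summ: "summable (\<lambda>k. \<tau> k (\<omega> k))" for \<omega>
    using norm\<tau> by (intro summable_comparison_test'[OF summable_geometric[of "1/2"]]) auto
  have \<tau>m: "\<tau> k \<in> borel_measurable borel" for k
    unfolding \<tau>_def by measurable
  have comp: "(\<lambda>\<omega>. \<tau> k (\<omega> k)) \<in> borel_measurable P" for k
  proof -
    have "(\<lambda>\<omega>. \<omega> k) \<in> measurable P (M k)" unfolding P_def by simp
    moreover have "\<tau> k \<in> borel_measurable (M k)" using \<tau>m measurable_cong_sets[OF M(2) refl] by blast
    ultimately show ?thesis by (rule measurable_compose)
  qed
  have part: "(\<lambda>\<omega>. \<Sum>k<n. \<tau> k (\<omega> k)) \<in> borel_measurable P" for n
    by (induction n) (auto intro!: separable_borel_measurable_add[OF sep] comp)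
  have Sm: "S \<in> borel_measurable P"
    unfolding S_def
    by (rule borel_measurable_LIMSEQ_metric[OF part]) (use summ in \<open>auto intro: summable_LIMSEQ\<close>)
  have split: "S (w(k := y)) = \<tau> k y + S (w(k := 0))" for w k y
  proof -
    have "(\<lambda>n. if n = k then \<tau> k y else 0) sums \<tau> k y"
      using sums_single[of k "\<lambda>_. \<tau> k y"] by simp
    moreover have "(\<lambda>n. \<tau> n ((w(k := 0)) n)) sums S (w(k := 0))"
      unfolding S_def by (rule summable_sums[OF summ])
    ultimately have "(\<lambda>n. (if n = k then \<tau> k y else 0) + \<tau> n ((w(k := 0)) n)) sums (\<tau> k y + S (w(k := 0)))"
      by (rule sums_add)
    moreover have "(\<lambda>n. (if n = k then \<tau> k y else 0) + \<tau> n ((w(k := 0)) n)) = (\<lambda>n. \<tau> n ((w(k := y)) n))"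
      by (auto simp: \<tau>_def)
    ultimately show ?thesis unfolding S_def by (metis sums_unique)
  qed
  have bound: "emeasure P {\<omega> \<in> space P. x + S \<omega> \<in> A k} \<le> ennreal ((1/2) ^ k)" for k x
  proof -
    let ?B = "{\<omega> \<in> space P. x + S \<omega> \<in> A k}"
    define Q where "Q = Pi\<^sub>M (UNIV - {k}) M"
    interpret Mk: prob_space "M k" by (rule M)
    interpret Q: prob_space Q unfolding Q_def by (rule prob_space_PiM) (rule M)
    interpret pair_sigma_finite "M k" Q ..
    let ?u = "\<lambda>(y, X). X(k := y)"
    have Peq: "P = distr (M k \<Otimes>\<^sub>M Q) P ?u"
      using distr_pair_PiM_eq_PiM[of "UNIV - {k}" M k] M(1)
      by (simp add: P_def Q_def insert_UNIV)
    have um: "?u \<in> measurable (M k \<Otimes>\<^sub>M Q) P"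
    proof -
      have "insert k (UNIV - {k}) = UNIV" by auto
      then show ?thesis unfolding P_def Q_def
        using measurable_fun_upd[of UNIV "UNIV - {k}" k snd "M k \<Otimes>\<^sub>M Q" M fst]
        by (simp add: case_prod_beta Q_def)
    qed
    have Bs: "?B \<in> sets P"
      using measurable_sets[OF Sm translate_sets_borel[OF A, of x]]
      by (simp add: vimage_def Collect_conj_eq Int_commute)
    have "emeasure P ?B = emeasure (M k \<Otimes>\<^sub>M Q) (?u -` ?B \<inter> space (M k \<Otimes>\<^sub>M Q))"
      by (subst Peq) (rule emeasure_distr[OF um Bs])
    also have "\<dots> = (\<integral>\<^sup>+ X. emeasure (M k) ((\<lambda>y. (y, X)) -` (?u -` ?B \<inter> space (M k \<Otimes>\<^sub>M Q))) \<partial>Q)"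
      by (rule emeasure_pair_measure_alt2[OF measurable_sets[OF um Bs]])
    also have "\<dots> \<le> (\<integral>\<^sup>+ X. ennreal ((1/2) ^ k) \<partial>Q)"
    proof (rule nn_integral_mono)
      fix X assume X: "X \<in> space Q"
      let ?s = "x + S (X(k := 0))"
      have "emeasure (M k) ((\<lambda>y. (y, X)) -` (?u -` ?B \<inter> space (M k \<Otimes>\<^sub>M Q))) \<le> emeasure (M k) {y. ?s + y \<in> A k}"
      proof (rule emeasure_mono_AE)
        show "AE y in M k. y \<in> (\<lambda>y. (y, X)) -` (?u -` ?B \<inter> space (M k \<Otimes>\<^sub>M Q)) \<longrightarrow> y \<in> {y. ?s + y \<in> A k}"
          using supp[of k]
        proof eventually_elim
          case (elim y)
          then have "\<tau> k y = y" by (simp add: \<tau>_def)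
          then show ?case using split[of X k y] by (auto simp: algebra_simps)
        qed
        show "{y. ?s + y \<in> A k} \<in> sets (M k)" using translate_sets_borel[OF A] M(2) by blast
      qed
      also have "\<dots> \<le> ennreal ((1/2) ^ k)"
        unfolding Mk.emeasure_eq_measure using le by (rule ennreal_leI)
      finally show "emeasure (M k) ((\<lambda>y. (y, X)) -` (?u -` ?B \<inter> space (M k \<Otimes>\<^sub>M Q))) \<le> ennreal ((1/2) ^ k)" .
    qed
    also have "\<dots> = ennreal ((1/2) ^ k)" by (simp add: Q.emeasure_space_1)
    finally show ?thesis .
  qed
  show ?thesis
  proof (rule that[of "distr P borel S"])
    show "prob_space (distr P borel S)" by (rule P.prob_space_distr[OF Sm])
    show "measure (distr P borel S) {y. x + y \<in> A k} \<le> (1/2) ^ k" for k x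
    proof -
      have "measure (distr P borel S) {y. x + y \<in> A k} = measure P {\<omega> \<in> space P. x + S \<omega> \<in> A k}"
        by (subst measure_distr[OF Sm translate_sets_borel[OF A]]) (simp add: vimage_def Collect_conj_eq Int_commute)
      also have "\<dots> \<le> (1/2) ^ k"
        using bound[of x k] unfolding P.emeasure_eq_measure by (simp add: ennreal_le_iff)
      finally show ?thesis .
    qed
  qed simp
qed

text \<open>Each of the countably many sets is served by infinitely many of the convolved measures, so its translates have
measure at most \<open>(1/2)^j\<close> for all \<open>j\<close>.\<close>

lemma sigma_avoidable_imp_Haar_null:
  fixes E :: "'a::banach set"
  assumes sep: "separable_space (euclidean :: 'a topology)" and E: "sigma_avoidable E"
  obtains N where "Haar_null N" "E \<subseteq> N"
proof -
  obtain A where A: "\<And>n::nat. avoidable (A n)" "E \<subseteq> (\<Union>n. A n)"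
    using E by (auto simp: sigma_avoidable_def)
  have As: "A n \<in> sets borel" for n using A(1) by (simp add: avoidable_def)
  define i where "i = (\<lambda>k. fst (prod_decode k))"
  have "\<forall>k. \<exists>\<mu>. prob_space \<mu> \<and> sets \<mu> = sets (borel :: 'a measure) \<and> (AE y in \<mu>. norm y < (1/2) ^ k) \<and>
        (\<forall>x. measure \<mu> {y. x + y \<in> A (i k)} \<le> (1/2) ^ k)"
    using A(1) unfolding avoidable_def by simp
  then obtain M where M: "\<And>k. prob_space (M k)" "\<And>k. sets (M k) = sets (borel :: 'a measure)"
      "\<And>k. AE y in M k. norm y < (1/2) ^ k"
      "\<And>k x. measure (M k) {y. x + y \<in> A (i k)} \<le> (1/2) ^ k"
    by metis
  obtain \<mu> where \<mu>: "prob_space \<mu>" "sets \<mu> = sets (borel :: 'a measure)"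
      "\<And>k x. measure \<mu> {y. x + y \<in> A (i k)} \<le> (1/2) ^ k"
    using convolution_avoids[OF sep, of "\<lambda>k. A (i k)" M] As M by blast
  interpret prob_space \<mu> by (rule \<mu>)
  have zero: "measure \<mu> {y. x + y \<in> A n} = 0" for n x
  proof -
    have "measure \<mu> {y. x + y \<in> A n} \<le> (1/2) ^ j" for j
    proof -
      have "measure \<mu> {y. x + y \<in> A n} \<le> (1/2) ^ (prod_encode (n, j))"
        using \<mu>(3)[of x "prod_encode (n, j)"] by (simp add: i_def)
      also have "\<dots> \<le> (1/2) ^ j" by (rule power_decreasing) (auto simp: le_prod_encode_2)
      finally show ?thesis .
    qed
    moreover have "(\<lambda>j. (1/2::real) ^ j) \<longlonglongrightarrow> 0" by (rule LIMSEQ_power_zero) simp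
    ultimately have "measure \<mu> {y. x + y \<in> A n} \<le> 0"
      by (intro LIMSEQ_le_const) auto
    then show ?thesis using measure_nonneg[of \<mu>] by (simp add: order_antisym)
  qed
  have "Haar_null (\<Union>n. A n)"
    unfolding Haar_null_def
  proof (intro conjI exI[of _ \<mu>] allI)
    show "(\<Union>n. A n) \<in> sets borel" using As by auto
    fix x :: 'a
    have "(\<lambda>e. x + e) ` (\<Union>n. A n) = (\<Union>n. {y. - x + y \<in> A n})"
    proof -
      have "(\<lambda>e. x + e) ` B = {y. - x + y \<in> B}" for B
        by (force simp: image_iff intro: bexI[of _ "- x + _"])
      then show ?thesis by auto
    qed
    also have "emeasure \<mu> \<dots> = 0"
    proof (rule emeasure_UN_eq_0)
      show "emeasure \<mu> {y. - x + y \<in> A n} = 0" for n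
        unfolding emeasure_eq_measure zero by simp
      show "range (\<lambda>n. {y. - x + y \<in> A n}) \<subseteq> sets \<mu>"
        using translate_sets_borel[OF As] \<mu>(2) by blast
    qed
    finally show "emeasure \<mu> ((\<lambda>e. x + e) ` (\<Union>n. A n)) = 0" .
  qed (use \<mu> in auto)
  with A(2) that show ?thesis by blast
qed

text \<open>Countably many translates of a ball cover a separable space.\<close>

lemma Haar_null_no_interior:
  fixes N :: "'a::real_normed_vector set"
  assumes sep: "separable_space (euclidean :: 'a topology)" and N: "Haar_null N"
  shows "interior N = {}"
proof (rule ccontr)
  assume "interior N \<noteq> {}"
  then obtain c r where r: "0 < r" "ball c r \<subseteq> N" by (meson all_not_in_conv mem_interior)
  obtain \<mu> :: "'a measure" where \<mu>: "prob_space \<mu>" "sets \<mu> = sets borel"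
    "\<And>x. emeasure \<mu> ((\<lambda>e. x + e) ` N) = 0" and Nb: "N \<in> sets borel"
    using N by (auto simp: Haar_null_def)
  interpret prob_space \<mu> by (rule \<mu>)
  obtain D :: "'a set" where D: "countable D" "closure D = UNIV"
    using separable_countable_dense[OF sep] .
  have im: "(\<lambda>e. x + e) ` N = {y. - x + y \<in> N}" for x
    by (force simp: image_iff intro: bexI[of _ "- x + _"])
  have "emeasure \<mu> (\<Union>d\<in>D. {y. - (d - c) + y \<in> N}) = 0"
  proof -
    have "(\<Union>d\<in>D. {y. - (d - c) + y \<in> N}) \<in> null_sets \<mu>"
      using D(1)
    proof (rule null_sets_UN')
      fix d
      show "{y. - (d - c) + y \<in> N} \<in> null_sets \<mu>"
        using \<mu>(3)[of "d - c"] translate_sets_borel[OF Nb, of "- (d - c)"] \<mu>(2)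
        unfolding im by (intro null_setsI) auto
    qed
    then show ?thesis by auto
  qed
  moreover have "(\<Union>d\<in>D. {y. - (d - c) + y \<in> N}) = UNIV"
  proof -
    have "\<exists>d\<in>D. - (d - c) + y \<in> N" for y
    proof -
      obtain d where d: "d \<in> D" "dist d y < r" using dense_ball[OF D(2) r(1)] by blast
      then have "- (d - c) + y \<in> ball c r" by (simp add: dist_norm algebra_simps)
      then show ?thesis using r d by blast
    qed
    then show ?thesis by blast
  qed
  moreover have "space \<mu> = UNIV" using sets_eq_imp_space_eq[OF \<mu>(2)] by simp
  ultimately show False using emeasure_space_1 by simp
qed

text \<open>The witnesses are uniform distributions on short segments in direction \<open>v\<close>. The case \<open>v = 0\<close> is consistent: the
hypothesis then says that \<open>E\<close> is empty.\<close>

lemma avoidable_line: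
  fixes E :: "'a::real_normed_vector set"
  assumes E: "E \<in> sets borel" and null: "\<And>x. {t::real. x + t *\<^sub>R v \<in> E} \<in> null_sets lborel"
  shows "avoidable E"
  unfolding avoidable_def
proof (intro conjI allI impI)
  fix \<epsilon> :: real assume \<epsilon>: "0 < \<epsilon>"
  define \<delta> where "\<delta> = \<epsilon> / (2 * (norm v + 1))"
  have \<delta>: "0 < \<delta>" "\<delta> * norm v < \<epsilon>"
  proof -
    show "0 < \<delta>" using \<epsilon> by (simp add: \<delta>_def add_nonneg_pos)
    have "\<delta> * norm v \<le> \<delta> * (norm v + 1)" using \<open>0 < \<delta>\<close> by simp
    also have "\<dots> = \<epsilon> / 2"
    proof -
      have "norm v + 1 \<noteq> 0" by (metis add_nonneg_pos norm_ge_zero less_irrefl zero_less_one)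
      moreover have "e / (2 * s) * s = e / 2" if "s \<noteq> 0" for e s :: real using that by simp
      ultimately show ?thesis unfolding \<delta>_def by blast
    qed
    finally show "\<delta> * norm v < \<epsilon>" using \<epsilon> by simp
  qed
  define U where "U = uniform_measure lborel {0..\<delta>}"
  interpret U: prob_space U unfolding U_def using \<delta> by (intro prob_space_uniform_measure) auto
  have m: "(\<lambda>t. t *\<^sub>R v) \<in> borel_measurable U"
  proof -
    have "(\<lambda>t. t *\<^sub>R v) \<in> borel_measurable borel"
      by (intro borel_measurable_continuous_onI continuous_intros)
    moreover have "sets U = sets borel" by (simp add: U_def)
    ultimately show ?thesis using measurable_cong_sets[of U borel borel borel] by blast
  qed
  have spU: "space U = UNIV" by (simp add: U_def)
  let ?\<mu> = "distr U borel (\<lambda>t. t *\<^sub>R v)"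
  have "measure ?\<mu> {y. x + y \<in> E} \<le> \<epsilon>" for x
  proof -
    have "measure ?\<mu> {y. x + y \<in> E} = measure U {t. x + t *\<^sub>R v \<in> E}"
      by (subst measure_distr[OF m translate_sets_borel[OF E]]) (simp add: vimage_def spU)
    also have "\<dots> = 0"
    proof -
      have "emeasure lborel ({0..\<delta>} \<inter> {t. x + t *\<^sub>R v \<in> E}) = 0"
        using null[of x] by (metis emeasure_mono inf_le2 le_zero_eq null_setsD1 null_setsD2)
      then show ?thesis unfolding U_def measure_def
        using null_setsD2[OF null[of x]] by simp
    qed
    finally show ?thesis using \<epsilon> by simp
  qed
  moreover have "AE y in ?\<mu>. norm y < \<epsilon>"
  proof (subst AE_distr_iff[OF m])
    show "{x \<in> space borel. norm x < \<epsilon>} \<in> sets borel" by simp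
    have "AE t in U. t \<in> {0..\<delta>}" unfolding U_def by (rule AE_uniform_measureI) auto
    then show "AE t in U. norm (t *\<^sub>R v) < \<epsilon>"
    proof eventually_elim
      case (elim t)
      then have "norm (t *\<^sub>R v) \<le> \<delta> * norm v" by (auto intro: mult_right_mono)
      then show ?case using \<delta> by simp
    qed
  qed
  ultimately show "\<exists>\<mu>. prob_space \<mu> \<and> sets \<mu> = sets borel \<and> (AE y in \<mu>. norm y < \<epsilon>) \<and>
        (\<forall>x. measure \<mu> {y. x + y \<in> E} \<le> \<epsilon>)"
    using U.prob_space_distr[OF m] by (intro exI[of _ ?\<mu>]) auto
qed (rule E)

section \<open>Monotone functions and porous sets on the line\<close>

text \<open>Vitali's covering theorem in the form used below: open intervals containing the points, and finitely many of them
up to an error \<open>\<eta>\<close> in measure.\<close>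

lemma Vitali_finite_intervals:
  fixes E G :: "real set" and K :: "(real \<times> real) set"
  assumes E: "E \<in> lmeasurable" and G: "open G" "E \<subseteq> G"
    and fine: "\<And>x \<eta>. x \<in> E \<Longrightarrow> 0 < \<eta> \<Longrightarrow> \<exists>c d. (c, d) \<in> K \<and> c < x \<and> x < d \<and> d - c < \<eta>"
    and \<eta>: "0 < \<eta>"
  obtains C where "finite C" "C \<subseteq> K" "\<And>c d. (c, d) \<in> C \<Longrightarrow> c < d"
    "\<And>c d. (c, d) \<in> C \<Longrightarrow> {c..d} \<subseteq> G"
    "disjoint_family_on (\<lambda>(c, d). {c<..<d}) C"
    "measure lebesgue E - \<eta> < measure lebesgue (E \<inter> (\<Union>(c, d)\<in>C. {c<..<d}))"
proof -
  define K' where "K' = {p \<in> K. fst p < snd p \<and> {fst p..snd p} \<subseteq> G}"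
  define J where "J = (\<lambda>p::real \<times> real. {fst p<..<snd p})"
  let ?m = "\<lambda>p::real \<times> real. (fst p + snd p) / 2" and ?r = "\<lambda>p::real \<times> real. (snd p - fst p) / 2"
  have ball: "ball (?m p) (?r p) = J p" for p
    by (auto simp: J_def ball_def dist_real_def abs_real_def field_simps)
  have "\<exists>p. p \<in> K' \<and> x \<in> ball (?m p) (?r p) \<and> ?r p < d" if x: "x \<in> E" "0 < d" for x d
  proof -
    obtain e where e: "e > 0" "ball x e \<subseteq> G"
      using G x by (meson openE subsetD)
    obtain c c' where c: "(c, c') \<in> K" "c < x" "x < c'" "c' - c < min d e"
      using fine[OF x(1), of "min d e"] x e by auto
    have "{c..c'} \<subseteq> ball x e"
      using c by (auto simp: ball_def dist_real_def)
    with e c have "(c, c') \<in> K'" by (auto simp: K'_def)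
    moreover have "x \<in> ball (?m (c, c')) (?r (c, c'))" unfolding ball using c by (simp add: J_def)
    ultimately show ?thesis using c by (intro exI[of _ "(c, c')"]) auto
  qed
  then obtain C where C: "countable C" "C \<subseteq> K'"
    and pw: "pairwise (\<lambda>i j. disjnt (ball (?m i) (?r i)) (ball (?m j) (?r j))) C"
    and neg: "negligible (E - (\<Union>i\<in>C. ball (?m i) (?r i)))"
    by (rule Vitali_covering_theorem_balls[of E K' ?m ?r]) blast
  have mJ: "J p \<in> sets lebesgue" for p by (simp add: J_def)
  define A where "A = (\<lambda>D. E \<inter> (\<Union>p\<in>D. J p))"
  have mA: "A D \<in> lmeasurable" if "finite D" for D
    unfolding A_def using E mJ that by (intro fmeasurable_Int_fmeasurable sets.finite_UN) auto
  have mE: "measure lebesgue E = measure lebesgue (A C)"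
  proof -
    have "A C \<in> sets lebesgue"
      unfolding A_def using E mJ C by (intro sets.Int sets.countable_UN') auto
    moreover have "negligible (sym_diff E (A C))"
      by (rule negligible_subset[OF neg]) (auto simp: A_def ball)
    ultimately show ?thesis using E
      by (metis fmeasurableD measure_negligible_symdiff)
  qed
  have "\<exists>D. finite D \<and> D \<subseteq> C \<and> measure lebesgue E - \<eta> < measure lebesgue (A D)"
  proof (cases "C = {}")
    case True
    then show ?thesis using mE \<eta> by (intro exI[of _ "{}"]) auto
  next
    case False
    define D where "D = (\<lambda>n. from_nat_into C ` {..n::nat})"
    have "(\<lambda>n. measure lebesgue (A (D n))) \<longlonglongrightarrow> measure lebesgue (\<Union>n. A (D n))"
    proof (rule Lim_measure_incseq)
      show "range (\<lambda>n. A (D n)) \<subseteq> sets lebesgue" using mA by (auto simp: D_def)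
      show "incseq (\<lambda>n. A (D n))" by (force simp: incseq_def A_def D_def)
      have "emeasure lebesgue (\<Union>n. A (D n)) \<le> emeasure lebesgue E"
        using E by (intro emeasure_mono) (auto simp: A_def)
      also have "\<dots> < \<infinity>" using fmeasurableD2[OF E] by (simp add: top.not_eq_extremum)
      finally show "emeasure lebesgue (\<Union>n. A (D n)) \<noteq> \<infinity>" by simp
    qed
    moreover have "(\<Union>n. A (D n)) = A C"
    proof -
      have "(\<Union>n. D n) = C"
        unfolding D_def image_UN[symmetric] using range_from_nat_into[OF False C(1)] by (simp add: UN_atMost_UNIV)
      then show ?thesis by (auto simp: A_def)
    qed
    ultimately have "(\<lambda>n. measure lebesgue (A (D n))) \<longlonglongrightarrow> measure lebesgue E"
      using mE by simp
    then have "eventually (\<lambda>n. measure lebesgue E - \<eta> < measure lebesgue (A (D n))) sequentially"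
      using \<eta> by (intro order_tendstoD) auto
    then obtain n where "measure lebesgue E - \<eta> < measure lebesgue (A (D n))"
      by (auto simp: eventually_sequentially)
    moreover have "D n \<subseteq> C" unfolding D_def using from_nat_into[OF False] by blast
    ultimately show ?thesis by (intro exI[of _ "D n"]) (auto simp: D_def)
  qed
  then obtain D where D: "finite D" "D \<subseteq> C" "measure lebesgue E - \<eta> < measure lebesgue (A D)"
    by blast
  show ?thesis
  proof (rule that[of D])
    show "disjoint_family_on (\<lambda>(c, d). {c<..<d}) D"
    proof -
      have "(\<lambda>(c, d). {c<..<d}) = J" by (simp add: J_def fun_eq_iff case_prod_beta)
      then show ?thesis
        using pairwise_subset[OF pw D(2)] unfolding ball disjoint_family_on_def pairwise_def disjnt_def
        by simp
    qed
    show "measure lebesgue E - \<eta> < measure lebesgue (E \<inter> (\<Union>(c, d)\<in>D. {c<..<d}))"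
      using D(3) by (simp add: A_def J_def case_prod_beta)
    show "c < d" "{c..d} \<subseteq> G" if "(c, d) \<in> D" for c d
      using subsetD[OF subset_trans[OF D(2) C(2)] that] by (simp_all add: K'_def)
    show "D \<subseteq> K" using D(2) C(2) unfolding K'_def by blast
  qed (rule D(1))
qed

lemma measure_disjoint_intervals:
  assumes "finite C" "disjoint_family_on (\<lambda>(c, d). {c<..<d::real}) C" "\<And>c d. (c, d) \<in> C \<Longrightarrow> c \<le> d"
  shows "measure lebesgue (\<Union>(c, d)\<in>C. {c<..<d}) = (\<Sum>(c, d)\<in>C. d - c)"
proof -
  have "measure lebesgue (\<Union>(c, d)\<in>C. {c<..<d}) = (\<Sum>p\<in>C. measure lebesgue (case p of (c, d) \<Rightarrow> {c<..<d}))"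
    using assms by (intro measure_finite_Union) auto
  also have "\<dots> = (\<Sum>(c, d)\<in>C. d - c)"
    using assms(3) by (intro sum.cong) auto
  finally show ?thesis .
qed

lemma mono_images_disjoint:
  fixes \<phi> :: "real \<Rightarrow> real"
  assumes mono: "mono_on S \<phi>" and dis: "disjoint_family_on (\<lambda>(c, d). {c<..<d}) C"
    and C: "\<And>c d. (c, d) \<in> C \<Longrightarrow> c < d \<and> c \<in> S \<and> d \<in> S"
  shows "disjoint_family_on (\<lambda>(c, d). {\<phi> c<..<\<phi> d}) C"
  unfolding disjoint_family_on_def
proof (intro ballI impI)
  fix p q assume "p \<in> C" "q \<in> C" "p \<noteq> q"
  moreover obtain c d c' d' where pq: "p = (c, d)" "q = (c', d')" by (cases p, cases q) blast
  ultimately have p: "(c, d) \<in> C" "(c', d') \<in> C" "(c, d) \<noteq> (c', d')" by auto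
  have *: "{c<..<d} \<inter> {c'<..<d'} = {}"
    using dis p unfolding disjoint_family_on_def by force
  have "d \<le> c' \<or> d' \<le> c"
  proof (rule ccontr)
    assume "\<not> ?thesis"
    then have "max c c' < min d d'" using C p by auto
    then obtain z where "max c c' < z" "z < min d d'" using dense by blast
    then have "z \<in> {c<..<d} \<inter> {c'<..<d'}" by auto
    with * show False by blast
  qed
  then have "\<phi> d \<le> \<phi> c' \<or> \<phi> d' \<le> \<phi> c"
    using mono C p by (auto simp: mono_on_def)
  then have "{\<phi> c<..<\<phi> d} \<inter> {\<phi> c'<..<\<phi> d'} = {}" by auto
  then show "(case p of (c, d) \<Rightarrow> {\<phi> c<..<\<phi> d}) \<inter> (case q of (c, d) \<Rightarrow> {\<phi> c<..<\<phi> d}) = {}"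
    by (simp add: pq)
qed

text \<open>A monotone function maps disjoint intervals to disjoint intervals, so sums of increments are Lebesgue measures of
unions in the range.\<close>

lemma mono_sum_increments_le:
  fixes \<phi> :: "real \<Rightarrow> real"
  assumes mono: "mono_on S \<phi>" and dis: "disjoint_family_on (\<lambda>(c, d). {c<..<d}) C"
    and C: "finite C" "\<And>c d. (c, d) \<in> C \<Longrightarrow> c < d \<and> c \<in> S \<and> d \<in> S"
    and D: "finite D" "\<And>c d. (c, d) \<in> D \<Longrightarrow> c < d \<and> c \<in> S \<and> d \<in> S"
    and nest: "\<And>c d. (c, d) \<in> C \<Longrightarrow> \<exists>c' d'. (c', d') \<in> D \<and> c' \<le> c \<and> d \<le> d'"
  shows "(\<Sum>(c, d)\<in>C. \<phi> d - \<phi> c) \<le> (\<Sum>(c, d)\<in>D. \<phi> d - \<phi> c)"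
proof -
  define f where "f = (\<lambda>(c, d). (\<phi> c, \<phi> d))"
  have le: "\<phi> c \<le> \<phi> d" if "(c, d) \<in> C \<union> D" for c d
  proof -
    have "c < d \<and> c \<in> S \<and> d \<in> S" using that C(2)[of c d] D(2)[of c d] by blast
    then show ?thesis using mono_onD[OF mono, of c d] by auto
  qed
  have "(\<Sum>(c, d)\<in>C. \<phi> d - \<phi> c) = (\<Sum>p\<in>C. measure lebesgue (case p of (c, d) \<Rightarrow> {\<phi> c<..<\<phi> d}))"
    using le by (intro sum.cong) auto
  also have "\<dots> = measure lebesgue (\<Union>(c, d)\<in>C. {\<phi> c<..<\<phi> d})"
  proof (rule measure_finite_Union[symmetric, OF C(1) _ mono_images_disjoint[OF mono dis C(2)]])
    show "emeasure lebesgue (case p of (c, d) \<Rightarrow> {\<phi> c<..<\<phi> d}) \<noteq> \<infinity>" if "p \<in> C" for p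
      using le[of "fst p" "snd p"] that by (cases p) auto
  qed auto
  also have "\<dots> \<le> measure lebesgue (\<Union>(c, d)\<in>D. {\<phi> c<..<\<phi> d})"
  proof (rule measure_mono_fmeasurable)
    show "(\<Union>(c, d)\<in>C. {\<phi> c<..<\<phi> d}) \<subseteq> (\<Union>(c, d)\<in>D. {\<phi> c<..<\<phi> d})"
    proof clarify
      fix z c d assume z: "(c, d) \<in> C" "z \<in> {\<phi> c<..<\<phi> d}"
      obtain c' d' where n: "(c', d') \<in> D" "c' \<le> c" "d \<le> d'" using nest z(1) by blast
      then have "\<phi> c' \<le> \<phi> c" "\<phi> d \<le> \<phi> d'"
        using C(2)[OF z(1)] D(2)[OF n(1)] mono_onD[OF mono, of c' c] mono_onD[OF mono, of d d'] by auto
      then show "z \<in> (\<Union>(c, d)\<in>D. {\<phi> c<..<\<phi> d})"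
        using z n(1) by (intro UN_I[of "(c', d')"]) auto
    qed
    show "(\<Union>(c, d)\<in>C. {\<phi> c<..<\<phi> d}) \<in> sets lebesgue" using C by (intro sets.finite_UN) auto
    show "(\<Union>(c, d)\<in>D. {\<phi> c<..<\<phi> d}) \<in> lmeasurable" using D by (intro fmeasurable.finite_UN) auto
  qed
  also have "\<dots> \<le> (\<Sum>p\<in>D. measure lebesgue (case p of (c, d) \<Rightarrow> {\<phi> c<..<\<phi> d}))"
    using D by (intro measure_UNION_le) auto
  also have "\<dots> = (\<Sum>(c, d)\<in>D. \<phi> d - \<phi> c)"
    using le by (intro sum.cong) auto
  finally show ?thesis .
qed

lemma lmeasurable_outer_open:
  fixes E :: "real set"
  assumes E: "E \<in> lmeasurable" and \<eta>: "0 < \<eta>"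
  obtains G where "open G" "E \<subseteq> G" "G \<in> lmeasurable" "measure lebesgue G \<le> measure lebesgue E + \<eta>"
proof -
  obtain G where G: "open G" "E \<subseteq> G" "G - E \<in> lmeasurable" "emeasure lebesgue (G - E) < ennreal \<eta>"
    using sets_lebesgue_outer_open[OF fmeasurableD[OF E] \<eta>] by blast
  have Gm: "G \<in> lmeasurable"
    using G E by (metis Diff_partition fmeasurable.Un)
  have "measure lebesgue G \<le> measure lebesgue (E \<union> (G - E))"
    using G E Gm by (intro measure_mono_fmeasurable) auto
  also have "\<dots> \<le> measure lebesgue E + measure lebesgue (G - E)"
    using E G by (intro measure_Un_le) auto
  also have "measure lebesgue (G - E) \<le> \<eta>"
    using G(4) \<eta> by (simp add: measure_def) (metis enn2real_leI less_imp_le)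
  finally show ?thesis using that G Gm by simp
qed

text \<open>Disjoint intervals of slope above \<open>b\<close> that cover \<open>E\<close> have total increment at least \<open>b\<close> times the measure of \<open>E\<close>, but the
total increment is bounded.\<close>

lemma negligible_mono_infinite_slope:
  fixes \<phi> :: "real \<Rightarrow> real"
  assumes E: "E \<in> lmeasurable" "E \<subseteq> {\<alpha><..<\<beta>}" and mono: "mono_on {\<alpha>..\<beta>} \<phi>"
    and steep: "\<And>x b \<eta>. x \<in> E \<Longrightarrow> 0 < \<eta> \<Longrightarrow>
      \<exists>c d. c < x \<and> x < d \<and> d - c < \<eta> \<and> \<phi> d - \<phi> c > b * (d - c)"
  shows "negligible E"
proof (cases "E = {}")
  case False
  then have ab: "\<alpha> < \<beta>" using E by fastforce
  have key: "b * (measure lebesgue E - \<eta>) \<le> \<phi> \<beta> - \<phi> \<alpha>" if b: "0 < b" and \<eta>: "0 < \<eta>" for b \<eta>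
  proof -
    define K where "K = {(c, d). c < d \<and> \<phi> d - \<phi> c > b * (d - c)}"
    obtain C where C: "finite C" "C \<subseteq> K" "\<And>c d. (c, d) \<in> C \<Longrightarrow> c < d"
      "\<And>c d. (c, d) \<in> C \<Longrightarrow> {c..d} \<subseteq> {\<alpha><..<\<beta>}"
      "disjoint_family_on (\<lambda>(c, d). {c<..<d}) C"
      "measure lebesgue E - \<eta> < measure lebesgue (E \<inter> (\<Union>(c, d)\<in>C. {c<..<d}))"
    proof (rule Vitali_finite_intervals[OF E(1) _ E(2), of K \<eta>])
      show "\<exists>c d. (c, d) \<in> K \<and> c < x \<and> x < d \<and> d - c < \<eta>" if x: "x \<in> E" "0 < \<eta>" for x \<eta>
      proof -
        obtain c d where "c < x" "x < d" "d - c < \<eta>" "\<phi> d - \<phi> c > b * (d - c)"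
          using steep[OF x, of b] by blast
        then show ?thesis by (intro exI[of _ c] exI[of _ d]) (auto simp: K_def)
      qed
    qed (use \<eta> in auto)
    have "measure lebesgue (E \<inter> (\<Union>(c, d)\<in>C. {c<..<d})) \<le> measure lebesgue (\<Union>(c, d)\<in>C. {c<..<d})"
      using E C(1) by (intro measure_mono_fmeasurable fmeasurable.finite_UN) (auto intro!: sets.Int sets.finite_UN)
    also have "\<dots> = (\<Sum>(c, d)\<in>C. d - c)"
      using C by (intro measure_disjoint_intervals) (auto intro: less_imp_le)
    finally have "b * (measure lebesgue E - \<eta>) \<le> b * (\<Sum>(c, d)\<in>C. d - c)"
      using C(6) b by (intro mult_left_mono) auto
    also have "\<dots> \<le> (\<Sum>(c, d)\<in>C. \<phi> d - \<phi> c)"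
      unfolding sum_distrib_left using C(2) by (intro sum_mono) (auto simp: K_def dest!: subsetD)
    also have "\<dots> \<le> (\<Sum>(c, d)\<in>{(\<alpha>, \<beta>)}. \<phi> d - \<phi> c)"
    proof (rule mono_sum_increments_le[OF mono C(5) C(1)])
      show *: "c < d \<and> c \<in> {\<alpha>..\<beta>} \<and> d \<in> {\<alpha>..\<beta>}" if "(c, d) \<in> C" for c d
        using C(3)[OF that] subsetD[OF C(4)[OF that], of c] subsetD[OF C(4)[OF that], of d] by auto
      show "\<exists>c' d'. (c', d') \<in> {(\<alpha>, \<beta>)} \<and> c' \<le> c \<and> d \<le> d'" if "(c, d) \<in> C" for c d
        using *[OF that] by auto
    qed (use ab in auto)
    finally show ?thesis by simp
  qed
  have "measure lebesgue E \<le> 0"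
  proof (rule ccontr)
    assume "\<not> ?thesis"
    then have m: "measure lebesgue E > 0" by simp
    define b where "b = 2 * (\<bar>\<phi> \<beta> - \<phi> \<alpha>\<bar> + 1) / measure lebesgue E"
    have "b > 0" unfolding b_def using m
      by (intro divide_pos_pos mult_pos_pos add_nonneg_pos) auto
    from key[OF this, of "measure lebesgue E / 2"] m have "\<bar>\<phi> \<beta> - \<phi> \<alpha>\<bar> + 1 \<le> \<phi> \<beta> - \<phi> \<alpha>"
      by (simp add: b_def)
    then show False by simp
  qed
  then show ?thesis
    using E(1) by (metis measure_nonneg order_antisym negligible_iff_measure)
qed auto

text \<open>Cover \<open>E\<close> first by intervals of slope below \<open>a\<close>, then, inside these, by intervals of slope above \<open>b\<close>. Comparing the
increments gives \<open>b\<close> times the measure of \<open>E\<close> at most \<open>a\<close> times the same measure.\<close>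

lemma negligible_mono_oscillating_slope:
  fixes \<phi> :: "real \<Rightarrow> real"
  assumes E: "E \<in> lmeasurable" "E \<subseteq> {\<alpha><..<\<beta>}" and mono: "mono_on {\<alpha>..\<beta>} \<phi>" and ab: "a < b"
    and steep: "\<And>x \<eta>. x \<in> E \<Longrightarrow> 0 < \<eta> \<Longrightarrow>
      \<exists>c d. c < x \<and> x < d \<and> d - c < \<eta> \<and> \<phi> d - \<phi> c > b * (d - c)"
    and flat: "\<And>x \<eta>. x \<in> E \<Longrightarrow> 0 < \<eta> \<Longrightarrow>
      \<exists>c d. c < x \<and> x < d \<and> d - c < \<eta> \<and> \<phi> d - \<phi> c < a * (d - c)"
  shows "negligible E"
proof (cases "E = {}")
  case False
  have a: "0 < a"
  proof -
    obtain x where x: "x \<in> E" using False by blast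
    then have "\<alpha> < x" "x < \<beta>" using E by auto
    then obtain c d where cd: "c < x" "x < d" "d - c < min (x - \<alpha>) (\<beta> - x)" "\<phi> d - \<phi> c < a * (d - c)"
      using flat[OF x, of "min (x - \<alpha>) (\<beta> - x)"] by auto
    then have "\<phi> c \<le> \<phi> d" using mono by (auto simp: mono_on_def)
    then have "0 < a * (d - c)" using cd by linarith
    then show ?thesis using cd by (simp add: zero_less_mult_iff)
  qed
  have key: "b * (measure lebesgue E - 2 * \<eta>) \<le> a * (measure lebesgue E + \<eta>)" if \<eta>: "0 < \<eta>" for \<eta>
  proof -
    obtain G0 where G0: "open G0" "E \<subseteq> G0" "G0 \<in> lmeasurable" "measure lebesgue G0 \<le> measure lebesgue E + \<eta>"
      using lmeasurable_outer_open[OF E(1) \<eta>] .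
    define G where "G = G0 \<inter> {\<alpha><..<\<beta>}"
    have G: "open G" "E \<subseteq> G" "G \<subseteq> {\<alpha><..<\<beta>}" "G \<in> lmeasurable"
      using G0 E by (auto simp: G_def intro: fmeasurable.Int)
    have "measure lebesgue G \<le> measure lebesgue G0"
      using G G0 by (intro measure_mono_fmeasurable) (auto simp: G_def)
    then have mG: "measure lebesgue G \<le> measure lebesgue E + \<eta>" using G0(4) by simp
    define K where "K = {(c, d). c < d \<and> \<phi> d - \<phi> c < a * (d - c)}"
    obtain C where C: "finite C" "C \<subseteq> K" "\<And>c d. (c, d) \<in> C \<Longrightarrow> c < d"
      "\<And>c d. (c, d) \<in> C \<Longrightarrow> {c..d} \<subseteq> G"
      "disjoint_family_on (\<lambda>(c, d). {c<..<d}) C"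
      "measure lebesgue E - \<eta> < measure lebesgue (E \<inter> (\<Union>(c, d)\<in>C. {c<..<d}))"
    proof (rule Vitali_finite_intervals[OF E(1) G(1) G(2), of K \<eta>])
      show "\<exists>c d. (c, d) \<in> K \<and> c < x \<and> x < d \<and> d - c < \<eta>" if x: "x \<in> E" "0 < \<eta>" for x \<eta>
      proof -
        obtain c d where "c < x" "x < d" "d - c < \<eta>" "\<phi> d - \<phi> c < a * (d - c)"
          using flat[OF x] by blast
        then show ?thesis by (intro exI[of _ c] exI[of _ d]) (auto simp: K_def)
      qed
    qed (use \<eta> in auto)
    define G' where "G' = (\<Union>(c, d)\<in>C. {c<..<d})"
    have G': "open G'" "G' \<in> lmeasurable"
      unfolding G'_def using C(1) by (auto intro!: fmeasurable.finite_UN)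
    define E' where "E' = E \<inter> G'"
    have E': "E' \<in> lmeasurable" "E' \<subseteq> G'" using E G' by (auto simp: E'_def)
    \<comment> \<open>Recording the enclosing interval of the first family is what makes the increments comparable.\<close>
  define K' where "K' = {(c, d). c < d \<and> \<phi> d - \<phi> c > b * (d - c) \<and> (\<exists>c' d'. (c', d') \<in> C \<and> c' \<le> c \<and> d \<le> d')}"
    obtain D where D: "finite D" "D \<subseteq> K'" "\<And>c d. (c, d) \<in> D \<Longrightarrow> c < d"
      "\<And>c d. (c, d) \<in> D \<Longrightarrow> {c..d} \<subseteq> G'"
      "disjoint_family_on (\<lambda>(c, d). {c<..<d}) D"
      "measure lebesgue E' - \<eta> < measure lebesgue (E' \<inter> (\<Union>(c, d)\<in>D. {c<..<d}))"
    proof (rule Vitali_finite_intervals[OF E'(1) G'(1) E'(2), of K' \<eta>])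
      show "\<exists>c d. (c, d) \<in> K' \<and> c < x \<and> x < d \<and> d - c < \<eta>" if x: "x \<in> E'" "0 < \<eta>" for x \<eta>
      proof -
        obtain c' d' where c': "(c', d') \<in> C" "c' < x" "x < d'" using x by (auto simp: E'_def G'_def)
        have "x \<in> E" using x by (simp add: E'_def)
        then obtain c d where "c < x" "x < d" "d - c < min \<eta> (min (x - c') (d' - x))" "\<phi> d - \<phi> c > b * (d - c)"
          using steep[of x "min \<eta> (min (x - c') (d' - x))"] x c' by auto
        moreover from this have "\<exists>c' d'. (c', d') \<in> C \<and> c' \<le> c \<and> d \<le> d'"
          using c' by (intro exI[of _ c'] exI[of _ d']) auto
        ultimately show ?thesis by (intro exI[of _ c] exI[of _ d]) (auto simp: K'_def)
      qed
    qed (use \<eta> in auto)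
    have CS: "c < d \<and> c \<in> {\<alpha>..\<beta>} \<and> d \<in> {\<alpha>..\<beta>}" if "(c, d) \<in> C" for c d
      using C(3)[OF that] subsetD[OF subset_trans[OF C(4)[OF that] G(3)], of c]
        subsetD[OF subset_trans[OF C(4)[OF that] G(3)], of d] by auto
    have DS: "c < d \<and> c \<in> {\<alpha>..\<beta>} \<and> d \<in> {\<alpha>..\<beta>}" if "(c, d) \<in> D" for c d
    proof -
      have "(c, d) \<in> K'" using D(2) that by blast
      then obtain c' d' where "(c', d') \<in> C" "c' \<le> c" "d \<le> d'" "c < d" by (auto simp: K'_def)
      then show ?thesis using CS[of c' d'] by auto
    qed
    have "measure lebesgue E - 2 * \<eta> \<le> measure lebesgue (E' \<inter> (\<Union>(c, d)\<in>D. {c<..<d}))"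
      using C(6) D(6) by (simp add: E'_def G'_def)
    also have "\<dots> \<le> measure lebesgue (\<Union>(c, d)\<in>D. {c<..<d})"
      using E' D(1) by (intro measure_mono_fmeasurable fmeasurable.finite_UN) (auto intro!: sets.Int sets.finite_UN)
    also have "\<dots> = (\<Sum>(c, d)\<in>D. d - c)"
      using D by (intro measure_disjoint_intervals) (auto intro: less_imp_le)
    finally have "b * (measure lebesgue E - 2 * \<eta>) \<le> b * (\<Sum>(c, d)\<in>D. d - c)"
      using a ab by (intro mult_left_mono) auto
    also have "\<dots> \<le> (\<Sum>(c, d)\<in>D. \<phi> d - \<phi> c)"
      unfolding sum_distrib_left using D(2) by (intro sum_mono) (auto simp: K'_def dest!: subsetD)
    also have "\<dots> \<le> (\<Sum>(c, d)\<in>C. \<phi> d - \<phi> c)"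
      by (rule mono_sum_increments_le[OF mono D(5) D(1) DS C(1) CS]) (use D(2) in \<open>auto simp: K'_def\<close>)
    also have "\<dots> \<le> a * (\<Sum>(c, d)\<in>C. d - c)"
      unfolding sum_distrib_left using C(2) by (intro sum_mono) (auto simp: K_def dest!: subsetD)
    also have "(\<Sum>(c, d)\<in>C. d - c) = measure lebesgue G'"
      unfolding G'_def using C by (intro measure_disjoint_intervals[symmetric]) (auto intro: less_imp_le)
    also have "\<dots> \<le> measure lebesgue G"
      using G G' C(4) by (intro measure_mono_fmeasurable) (force simp: G'_def)+
    finally show ?thesis using mG a by (smt (verit) mult_left_mono)
  qed
  have "measure lebesgue E \<le> 0"
  proof (rule ccontr)
    assume "\<not> ?thesis"
    then have m: "(b - a) * measure lebesgue E > 0" using ab by simp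
    define \<eta> where "\<eta> = (b - a) * measure lebesgue E / (2 * (2 * b + a))"
    have "\<eta> > 0" unfolding \<eta>_def using m a ab by (intro divide_pos_pos) auto
    from key[OF this] have "(b - a) * measure lebesgue E \<le> (2 * b + a) * \<eta>" by (simp add: algebra_simps)
    also have "\<dots> = (b - a) * measure lebesgue E / 2"
    proof -
      have "2 * b + a \<noteq> 0" using a ab by linarith
      moreover have "s * (z / (2 * s)) = z / 2" if "s \<noteq> 0" for s z :: real using that by simp
      ultimately show ?thesis unfolding \<eta>_def by blast
    qed
    finally show False using m by simp
  qed
  then show ?thesis
    using E(1) by (metis measure_nonneg order_antisym negligible_iff_measure)
qed auto

text \<open>Around each point there are arbitrarily short intervals of which \<open>E\<close> misses a fixed proportion; a Vitali covering by
them shows that \<open>E\<close> has no more than a proper fraction of its own measure.\<close>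

lemma negligible_porous:
  fixes E :: "real set"
  assumes E: "E \<in> lmeasurable" and c: "0 < c"
    and porous: "\<And>x \<eta>. x \<in> E \<Longrightarrow> 0 < \<eta> \<Longrightarrow>
      \<exists>t. 0 < \<bar>t\<bar> \<and> \<bar>t\<bar> < \<eta> \<and> ball (x + t) (c * \<bar>t\<bar>) \<inter> E = {}"
  shows "negligible E"
proof -
  define \<theta> where "\<theta> = c / (1 + c)"
  have \<theta>: "0 < \<theta>" "\<theta> < 1" using c by (auto simp: \<theta>_def)
  define K where "K = {(l, r). l < r \<and> measure lebesgue (E \<inter> {l<..<r}) \<le> (1 - \<theta>) * (r - l)}"
  have fine: "\<exists>l r. (l, r) \<in> K \<and> l < x \<and> x < r \<and> r - l < \<eta>" if x: "x \<in> E" "0 < \<eta>" for x \<eta>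
  proof -
    obtain t where t: "0 < \<bar>t\<bar>" "\<bar>t\<bar> < \<eta> / (2 * (1 + c))" "ball (x + t) (c * \<bar>t\<bar>) \<inter> E = {}"
      using porous[OF x(1), of "\<eta> / (2 * (1 + c))"] x c by auto
    define h where "h = (1 + c) * \<bar>t\<bar>"
    have h: "0 < h" using t c by (simp add: h_def)
    have h2: "2 * h < \<eta>" using t(2) c by (simp add: h_def field_simps)
    have sub: "ball (x + t) (c * \<bar>t\<bar>) \<subseteq> {x - h<..<x + h}"
    proof
      fix y assume "y \<in> ball (x + t) (c * \<bar>t\<bar>)"
      then have "\<bar>x + t - y\<bar> < c * \<bar>t\<bar>" by (simp add: dist_real_def)
      moreover have "h = \<bar>t\<bar> + c * \<bar>t\<bar>" by (simp add: h_def algebra_simps)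
      ultimately show "y \<in> {x - h<..<x + h}" by auto
    qed
    have "measure lebesgue (E \<inter> {x - h<..<x + h}) \<le> measure lebesgue ({x - h<..<x + h} - ball (x + t) (c * \<bar>t\<bar>))"
      using E t(3) by (intro measure_mono_fmeasurable fmeasurable.Diff) (auto intro: fmeasurableD)
    also have "\<dots> = measure lebesgue {x - h<..<x + h} - measure lebesgue (ball (x + t) (c * \<bar>t\<bar>))"
      using sub by (intro measurable_measure_Diff) auto
    also have "\<dots> = 2 * h - 2 * (c * \<bar>t\<bar>)"
      using h t c by (simp add: ball_eq_greaterThanLessThan)
    also have "\<dots> = (1 - \<theta>) * (x + h - (x - h))"
      using c by (simp add: h_def \<theta>_def field_simps)
    finally show ?thesis using h h2 by (intro exI[of _ "x - h"] exI[of _ "x + h"]) (auto simp: K_def)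
  qed
  have key: "measure lebesgue E - \<eta> \<le> (1 - \<theta>) * (measure lebesgue E + \<eta>)" if \<eta>: "0 < \<eta>" for \<eta>
  proof -
    obtain G where G: "open G" "E \<subseteq> G" "G \<in> lmeasurable" and mG: "measure lebesgue G \<le> measure lebesgue E + \<eta>"
      using lmeasurable_outer_open[OF E \<eta>] .
    obtain C where C: "finite C" "C \<subseteq> K" "\<And>c d. (c, d) \<in> C \<Longrightarrow> c < d"
      "\<And>c d. (c, d) \<in> C \<Longrightarrow> {c..d} \<subseteq> G"
      "disjoint_family_on (\<lambda>(c, d). {c<..<d}) C"
      "measure lebesgue E - \<eta> < measure lebesgue (E \<inter> (\<Union>(c, d)\<in>C. {c<..<d}))"
      using Vitali_finite_intervals[OF E G(1,2) fine \<eta>] by blast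
    have "measure lebesgue E - \<eta> \<le> measure lebesgue (\<Union>p\<in>C. E \<inter> (case p of (c, d) \<Rightarrow> {c<..<d}))"
    proof -
      have "E \<inter> (\<Union>(c, d)\<in>C. {c<..<d}) = (\<Union>p\<in>C. E \<inter> (case p of (c, d) \<Rightarrow> {c<..<d}))" by blast
      then show ?thesis using C(6) by (simp only: less_imp_le)
    qed
    also have "\<dots> \<le> (\<Sum>p\<in>C. measure lebesgue (E \<inter> (case p of (c, d) \<Rightarrow> {c<..<d})))"
      using C E by (intro measure_UNION_le) (auto intro: fmeasurableD)
    also have "\<dots> \<le> (\<Sum>(l, r)\<in>C. (1 - \<theta>) * (r - l))"
      using C(2) by (intro sum_mono) (auto simp: K_def dest!: subsetD)
    also have "\<dots> = (1 - \<theta>) * (\<Sum>(l, r)\<in>C. r - l)" by (simp add: sum_distrib_left case_prod_beta)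
    also have "(\<Sum>(l, r)\<in>C. r - l) = measure lebesgue (\<Union>(c, d)\<in>C. {c<..<d})"
      using C by (intro measure_disjoint_intervals[symmetric]) (auto intro: less_imp_le)
    also have "\<dots> \<le> measure lebesgue G"
      using G(3) C by (intro measure_mono_fmeasurable) (force intro!: sets.finite_UN)+
    finally show ?thesis using mG \<theta> by (smt (verit) mult_left_mono)
  qed
  have "measure lebesgue E \<le> 0"
  proof (rule ccontr)
    assume "\<not> ?thesis"
    then have m: "\<theta> * measure lebesgue E > 0" using \<theta> by simp
    define \<eta> where "\<eta> = \<theta> * measure lebesgue E / 4"
    have "\<eta> > 0" unfolding \<eta>_def using m by auto
    from key[OF this] have "\<theta> * measure lebesgue E \<le> (2 - \<theta>) * \<eta>" by (simp add: algebra_simps)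
    also have "\<dots> \<le> 2 * \<eta>" using \<theta> \<open>\<eta> > 0\<close> by (intro mult_right_mono) auto
    finally show False using m by (simp add: \<eta>_def)
  qed
  then show ?thesis
    using E(1) by (metis measure_nonneg order_antisym negligible_iff_measure)
qed

section \<open>Hahn-Banach separation\<close>

definition sublinear :: "('a::real_vector \<Rightarrow> real) \<Rightarrow> bool" where
  "sublinear p \<longleftrightarrow> (\<forall>x y. p (x + y) \<le> p x + p y) \<and> (\<forall>t x. 0 < t \<longrightarrow> p (t *\<^sub>R x) = t * p x)"

lemma sublinear_add: "sublinear p \<Longrightarrow> p (x + y) \<le> p x + p y"
  and sublinear_scale: "sublinear p \<Longrightarrow> 0 < t \<Longrightarrow> p (t *\<^sub>R x) = t * p x"
  by (auto simp: sublinear_def)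

lemma sublinear_0: "sublinear p \<Longrightarrow> p 0 = 0"
  using sublinear_scale[of p 2 0] by simp

lemma sublinear_neg: "sublinear p \<Longrightarrow> - p (- x) \<le> p x"
  using sublinear_add[of p x "- x"] sublinear_0[of p] by simp

lemma sublinear_Inf_chain:
  fixes C :: "('a::real_vector \<Rightarrow> real) set" and b :: "'a \<Rightarrow> real"
  assumes C: "C \<noteq> {}" "\<And>q. q \<in> C \<Longrightarrow> sublinear q"
    and chain: "\<And>q q'. q \<in> C \<Longrightarrow> q' \<in> C \<Longrightarrow> q \<le> q' \<or> q' \<le> q"
    and bd: "\<And>q x. q \<in> C \<Longrightarrow> b x \<le> q x"
  shows "sublinear (\<lambda>x. INF q\<in>C. q x)"
  unfolding sublinear_def
proof (intro conjI allI impI)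
  have bdd: "bdd_below ((\<lambda>q. q x) ` C)" for x
    by (rule bdd_belowI2[of C "b x"]) (rule bd)
  show "(INF q\<in>C. q (x + y)) \<le> (INF q\<in>C. q x) + (INF q\<in>C. q y)" for x y
  proof -
    have 0: "(INF q\<in>C. q (x + y)) \<le> q x + q' y" if q: "q \<in> C" "q' \<in> C" for q q'
    proof -
      obtain r where r: "r \<in> C" "r \<le> q" "r \<le> q'" using chain[OF q] q by blast
      have "(INF q\<in>C. q (x + y)) \<le> r (x + y)" by (rule cINF_lower[OF bdd r(1)])
      also have "\<dots> \<le> r x + r y" using C(2)[OF r(1)] by (rule sublinear_add)
      also have "\<dots> \<le> q x + q' y" using r by (intro add_mono) (auto simp: le_fun_def)
      finally show ?thesis .
    qed
    have *: "(INF q\<in>C. q (x + y)) - q x \<le> q' y" if "q \<in> C" "q' \<in> C" for q q'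
      using 0[OF that] by linarith
    have **: "(INF q\<in>C. q (x + y)) - q x \<le> (INF q\<in>C. q y)" if "q \<in> C" for q
      by (rule cINF_greatest[OF C(1)]) (rule *[OF that])
    have "(INF q\<in>C. q (x + y)) - (INF q\<in>C. q y) \<le> q x" if "q \<in> C" for q
      using **[OF that] by linarith
    then have "(INF q\<in>C. q (x + y)) - (INF q\<in>C. q y) \<le> (INF q\<in>C. q x)"
      by (rule cINF_greatest[OF C(1)])
    then show ?thesis by simp
  qed
  show "(INF q\<in>C. q (t *\<^sub>R x)) = t * (INF q\<in>C. q x)" if t: "0 < t" for t x
  proof (rule order_antisym)
    have "(INF q\<in>C. q (t *\<^sub>R x)) / t \<le> (INF q\<in>C. q x)"
    proof (rule cINF_greatest[OF C(1)])
      fix q assume q: "q \<in> C"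
      have "(INF q\<in>C. q (t *\<^sub>R x)) \<le> t * q x"
        using cINF_lower[OF bdd q, of "t *\<^sub>R x"] sublinear_scale[OF C(2)[OF q] t] by simp
      then show "(INF q\<in>C. q (t *\<^sub>R x)) / t \<le> q x" using t by (simp add: field_simps)
    qed
    then show "(INF q\<in>C. q (t *\<^sub>R x)) \<le> t * (INF q\<in>C. q x)" using t by (simp add: field_simps)
    show "t * (INF q\<in>C. q x) \<le> (INF q\<in>C. q (t *\<^sub>R x))"
    proof (rule cINF_greatest[OF C(1)])
      fix q assume q: "q \<in> C"
      show "t * (INF q\<in>C. q x) \<le> q (t *\<^sub>R x)"
        using cINF_lower[OF bdd q, of x] sublinear_scale[OF C(2)[OF q] t] t by simp
    qed
  qed
qed

text \<open>The step towards linearity: \<open>r\<close> is a sublinear minorant of \<open>q\<close> that agrees with a linear function along \<open>y\<close>. Hence a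
minimal sublinear function equals its own reduction for every \<open>y\<close> and is additive.\<close>

lemma sublinear_reduce:
  fixes q :: "'a::real_vector \<Rightarrow> real" and y :: 'a
  assumes q: "sublinear q"
  defines "r \<equiv> \<lambda>x. INF t\<in>{0..}. q (x + t *\<^sub>R y) - t * q y"
  shows "sublinear r" "r \<le> q" "r (- y) \<le> - q y" "\<And>x. r x \<le> q (x + y) - q y"
proof -
  have lb: "- q (- x) \<le> q (x + t *\<^sub>R y) - t * q y" if "0 \<le> t" for x t
  proof -
    have "q (t *\<^sub>R y) \<le> q (x + t *\<^sub>R y) + q (- x)"
      using sublinear_add[OF q, of "x + t *\<^sub>R y" "- x"] by simp
    moreover have "q (t *\<^sub>R y) = t * q y"
      using that sublinear_scale[OF q, of t y] sublinear_0[OF q] by (cases "t = 0") auto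
    ultimately show ?thesis by simp
  qed
  have bdd: "bdd_below ((\<lambda>t. q (x + t *\<^sub>R y) - t * q y) ` {0..})" for x
    using lb by (auto intro!: bdd_belowI2)
  have lower: "r x \<le> q (x + t *\<^sub>R y) - t * q y" if "0 \<le> t" for x t
    unfolding r_def using that by (intro cINF_lower[OF bdd]) auto
  have great: "c \<le> r x" if "\<And>t. 0 \<le> t \<Longrightarrow> c \<le> q (x + t *\<^sub>R y) - t * q y" for c x
    unfolding r_def using that by (intro cINF_greatest) auto
  show "sublinear r"
    unfolding sublinear_def
  proof (intro conjI allI impI)
    fix x z
    have *: "r (x + z) \<le> (q (x + t *\<^sub>R y) - t * q y) + (q (z + s *\<^sub>R y) - s * q y)" if "0 \<le> t" "0 \<le> s" for s t
    proof -
      have "r (x + z) \<le> q ((x + z) + (t + s) *\<^sub>R y) - (t + s) * q y" using that by (intro lower) auto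
      also have "(x + z) + (t + s) *\<^sub>R y = (x + t *\<^sub>R y) + (z + s *\<^sub>R y)" by (simp add: algebra_simps)
      also have "q \<dots> \<le> q (x + t *\<^sub>R y) + q (z + s *\<^sub>R y)" by (rule sublinear_add[OF q])
      finally show ?thesis by (simp add: algebra_simps)
    qed
    have **: "r (x + z) - (q (x + t *\<^sub>R y) - t * q y) \<le> r z" if "0 \<le> t" for t
    proof (rule great)
      fix s :: real assume "0 \<le> s"
      then show "r (x + z) - (q (x + t *\<^sub>R y) - t * q y) \<le> q (z + s *\<^sub>R y) - s * q y"
        using *[OF that, of s] by linarith
    qed
    have "r (x + z) - r z \<le> r x"
    proof (rule great)
      fix t :: real assume "0 \<le> t"
      then show "r (x + z) - r z \<le> q (x + t *\<^sub>R y) - t * q y"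
        using **[of t] by linarith
    qed
    then show "r (x + z) \<le> r x + r z" by simp
  next
    fix s :: real and x assume s: "0 < s"
    have eq: "q (s *\<^sub>R x + (s * t) *\<^sub>R y) - (s * t) * q y = s * (q (x + t *\<^sub>R y) - t * q y)" for t
      using sublinear_scale[OF q s, of "x + t *\<^sub>R y"] by (simp add: algebra_simps)
    show "r (s *\<^sub>R x) = s * r x"
    proof (rule order_antisym)
      have "r (s *\<^sub>R x) / s \<le> r x"
      proof (rule great)
        fix t :: real assume "0 \<le> t"
        then have "r (s *\<^sub>R x) \<le> s * (q (x + t *\<^sub>R y) - t * q y)"
          using lower[of "s * t" "s *\<^sub>R x"] s unfolding eq by simp
        then show "r (s *\<^sub>R x) / s \<le> q (x + t *\<^sub>R y) - t * q y" using s by (simp add: field_simps)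
      qed
      then show "r (s *\<^sub>R x) \<le> s * r x" using s by (simp add: field_simps)
      show "s * r x \<le> r (s *\<^sub>R x)"
      proof (rule great)
        fix t :: real assume t: "0 \<le> t"
        have "s * r x \<le> s * (q (x + (t / s) *\<^sub>R y) - (t / s) * q y)"
          using lower[of "t / s" x] s t by (intro mult_left_mono) auto
        also have "\<dots> = q (s *\<^sub>R x + t *\<^sub>R y) - t * q y"
          using eq[of "t / s"] s by simp
        finally show "s * r x \<le> q (s *\<^sub>R x + t *\<^sub>R y) - t * q y" .
      qed
    qed
  qed
  show "r \<le> q" unfolding le_fun_def using lower[of 0] by simp
  show "r (- y) \<le> - q y" using lower[of 1 "- y"] sublinear_0[OF q] by simp
  show "r x \<le> q (x + y) - q y" for x using lower[of 1 x] by simp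
qed

text \<open>The Hahn-Banach theorem. Zorn's lemma provides a minimal sublinear function below the reduction of \<open>p\<close> along \<open>y\<close>;
this avoids extending functionals from subspaces.\<close>

lemma sublinear_dominates_linear:
  fixes p :: "'a::real_vector \<Rightarrow> real"
  assumes p: "sublinear p"
  obtains l where "linear l" "l \<le> p" "l y = p y"
proof -
  obtain p' where p': "sublinear p'" "p' \<le> p" "p' (- y) \<le> - p y"
    using sublinear_reduce[OF p, of y] by blast
  define S where "S = {q. sublinear q \<and> q \<le> p'}"
  have "\<exists>m\<in>S. \<forall>q\<in>S. q \<le> m \<longrightarrow> q = m"
  proof -
    define r where "r = {(q, q'). q \<in> S \<and> q' \<in> S \<and> q' \<le> q}"
    have "Partial_order r"
      by (auto simp: r_def partial_order_on_def preorder_on_def refl_on_def trans_def antisym_def Field_def)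
    moreover have F: "Field r = S" by (auto simp: r_def Field_def)
    moreover have "\<exists>u\<in>Field r. \<forall>a\<in>C. (a, u) \<in> r" if "C \<in> Chains r" for C
    proof (cases "C = {}")
      case True
      then show ?thesis using p' F by (auto simp: S_def)
    next
      case False
      have CS: "C \<subseteq> S" using that by (auto simp: Chains_def r_def)
      have ch: "q \<le> q' \<or> q' \<le> q" if "q \<in> C" "q' \<in> C" for q q'
        using \<open>C \<in> Chains r\<close> that by (auto simp: Chains_def r_def)
      let ?u = "\<lambda>x. INF q\<in>C. q x"
      have bd: "- p' (- x) \<le> q x" if "q \<in> C" for q x
      proof -
        have "sublinear q" "q (- x) \<le> p' (- x)" using CS that by (auto simp: S_def le_fun_def)
        then show ?thesis using sublinear_neg[of q x] by linarith
      qed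
      have "sublinear ?u"
      proof (rule sublinear_Inf_chain[of C "\<lambda>x. - p' (- x)"])
        show "sublinear q" if "q \<in> C" for q using CS that by (auto simp: S_def)
        show "q \<le> q' \<or> q' \<le> q" if "q \<in> C" "q' \<in> C" for q q' using ch[OF that] .
        show "- p' (- x) \<le> q x" if "q \<in> C" for q x using bd[OF that] .
      qed (rule False)
      moreover have u: "?u \<le> q" if "q \<in> C" for q
        unfolding le_fun_def
      proof
        fix x
        have "bdd_below ((\<lambda>q. q x) ` C)" by (rule bdd_belowI2[of C "- p' (- x)"]) (rule bd)
        then show "?u x \<le> q x" using that by (rule cINF_lower)
      qed
      moreover have "?u \<le> p'"
      proof -
        obtain q where "q \<in> C" using False by blast
        then show ?thesis using u[of q] CS by (auto simp: S_def intro: order_trans)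
      qed
      ultimately have "?u \<in> S" by (simp add: S_def)
      then show ?thesis using u CS F by (intro bexI[of _ ?u]) (auto simp: r_def)
    qed
    ultimately have "\<exists>m\<in>Field r. \<forall>a\<in>Field r. (m, a) \<in> r \<longrightarrow> a = m"
      by (intro Zorns_po_lemma) auto
    then show ?thesis unfolding F by (auto simp: r_def)
  qed
  then obtain l where lS: "l \<in> S" and minS: "\<And>q. q \<in> S \<Longrightarrow> q \<le> l \<Longrightarrow> q = l" by blast
  have l: "sublinear l" "l \<le> p'" using lS by (auto simp: S_def)
  have min: "q = l" if "sublinear q" "q \<le> l" for q
    using minS[of q] that order_trans[OF that(2) l(2)] by (simp add: S_def)
  have add: "l (x + z) = l x + l z" for x z
  proof -
    let ?r = "\<lambda>x. INF t\<in>{0..}. l (x + t *\<^sub>R z) - t * l z"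
    have "?r = l" by (rule min[OF sublinear_reduce(1,2)[OF l(1)]])
    then have "?r x = l x" by (rule fun_cong)
    moreover have "?r x \<le> l (x + z) - l z" by (rule sublinear_reduce(4)[OF l(1)])
    ultimately have "l x \<le> l (x + z) - l z" by linarith
    then show ?thesis using sublinear_add[OF l(1), of x z] by linarith
  qed
  have neg: "l (- x) = - l x" for x using add[of x "- x"] sublinear_0[OF l(1)] by simp
  have "linear l"
  proof (rule linearI[OF add])
    show "l (t *\<^sub>R x) = t *\<^sub>R l x" for t x
    proof (cases "t = 0")
      case False
      then consider "0 < t" | "0 < - t" by linarith
      then show ?thesis
      proof cases
        case 2
        then show ?thesis using sublinear_scale[OF l(1) 2, of x] neg[of "t *\<^sub>R x"] by simp
      qed (use sublinear_scale[OF l(1)] in auto)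
    qed (use sublinear_0[OF l(1)] in auto)
  qed
  moreover have "l \<le> p" using l(2) p'(2) by (rule order_trans)
  moreover have "l y = p y"
  proof (rule order_antisym)
    show "l y \<le> p y" using \<open>l \<le> p\<close> by (simp add: le_fun_def)
    have "l (- y) \<le> - p y" using l(2) p'(3) by (metis le_funD order_trans)
    then show "p y \<le> l y" using neg by simp
  qed
  ultimately show ?thesis using that by blast
qed

lemma sublinear_gauge:
  fixes C :: "'a::real_normed_vector set"
  assumes C: "convex C" and r: "0 < r" "ball 0 r \<subseteq> C"
  defines "p \<equiv> \<lambda>x. Inf {s. 0 < s \<and> x /\<^sub>R s \<in> C}"
  shows "sublinear p" "\<And>x. x \<in> C \<Longrightarrow> p x \<le> 1" "\<And>x. x \<notin> C \<Longrightarrow> 1 \<le> p x"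
proof -
  let ?S = "\<lambda>x. {s. 0 < s \<and> x /\<^sub>R s \<in> C}"
  have bdd: "bdd_below (?S x)" for x by (rule bdd_belowI[of _ 0]) auto
  have ne: "?S x \<noteq> {}" for x
  proof -
    have "x /\<^sub>R (2 * norm x / r + 1) \<in> ball 0 r"
    proof -
      have pos: "2 * norm x / r + 1 > 0" using r by (simp add: add_nonneg_pos)
      have "r * (2 * norm x / r + 1) = 2 * norm x + r" using r by (simp add: field_simps)
      then have "norm x < r * (2 * norm x / r + 1)" using r norm_ge_zero[of x] by linarith
      then have "norm x / (2 * norm x / r + 1) < r" using pos by (simp only: pos_divide_less_eq)
      moreover have "norm (x /\<^sub>R (2 * norm x / r + 1)) = norm x / (2 * norm x / r + 1)"
        using pos by (simp only: norm_scaleR abs_inverse abs_of_pos divide_inverse mult.commute)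
      ultimately show ?thesis by simp
    qed
    moreover have "2 * norm x / r + 1 > 0" using r by (simp add: add_nonneg_pos)
    ultimately have "2 * norm x / r + 1 \<in> ?S x" using r by auto
    then show ?thesis by blast
  qed
  have lower: "p x \<le> s" if "0 < s" "x /\<^sub>R s \<in> C" for x s
    unfolding p_def using that by (intro cInf_lower[OF _ bdd]) auto
  have great: "c \<le> p x" if "\<And>s. 0 < s \<Longrightarrow> x /\<^sub>R s \<in> C \<Longrightarrow> c \<le> s" for c x
    unfolding p_def using that by (intro cInf_greatest[OF ne]) auto
  show "sublinear p"
    unfolding sublinear_def
  proof (intro conjI allI impI)
    fix x y
    have 0: "p (x + y) \<le> s + t" if s: "0 < s" "x /\<^sub>R s \<in> C" "0 < t" "y /\<^sub>R t \<in> C" for s t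
    proof (rule lower)
      have "(s / (s + t)) *\<^sub>R (x /\<^sub>R s) + (t / (s + t)) *\<^sub>R (y /\<^sub>R t) \<in> C"
        using s by (intro convexD[OF C]) (auto simp: add_divide_distrib[symmetric])
      moreover have "(s / (s + t)) *\<^sub>R (x /\<^sub>R s) + (t / (s + t)) *\<^sub>R (y /\<^sub>R t) = (x + y) /\<^sub>R (s + t)"
      proof -
        have "s / (s + t) * inverse s = inverse (s + t)" "t / (s + t) * inverse t = inverse (s + t)"
          using s by (simp_all add: field_simps)
        then show ?thesis by (simp only: scaleR_scaleR scaleR_add_right)
      qed
      ultimately show "(x + y) /\<^sub>R (s + t) \<in> C" by simp
    qed (use s in auto)
    have *: "p (x + y) - s \<le> t" if "0 < s" "x /\<^sub>R s \<in> C" "0 < t" "y /\<^sub>R t \<in> C" for s t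
      using 0[OF that] by linarith
    have **: "p (x + y) - s \<le> p y" if "0 < s" "x /\<^sub>R s \<in> C" for s
      by (rule great) (rule *[OF that])
    have "p (x + y) - p y \<le> s" if "0 < s" "x /\<^sub>R s \<in> C" for s
      using **[OF that] by linarith
    then have "p (x + y) - p y \<le> p x" by (rule great)
    then show "p (x + y) \<le> p x + p y" by simp
  next
    have le: "p (t *\<^sub>R x) \<le> t * p x" if t: "0 < t" for t x
    proof -
      have "p (t *\<^sub>R x) / t \<le> p x"
      proof (rule great)
        fix s assume s: "0 < s" "x /\<^sub>R s \<in> C"
        have "(t *\<^sub>R x) /\<^sub>R (t * s) = x /\<^sub>R s" using t by (simp add: field_simps)
        then have "p (t *\<^sub>R x) \<le> t * s" using s t by (intro lower) (simp_all only: mult_pos_pos)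
        then show "p (t *\<^sub>R x) / t \<le> s" using t by (simp add: field_simps)
      qed
      then show ?thesis using t by (simp add: field_simps)
    qed
    fix t :: real and x assume t: "0 < t"
    have "p ((1 / t) *\<^sub>R (t *\<^sub>R x)) \<le> (1 / t) * p (t *\<^sub>R x)" using t by (intro le) auto
    then have "t * p x \<le> p (t *\<^sub>R x)" using t by (simp add: field_simps)
    then show "p (t *\<^sub>R x) = t * p x" using le[OF t] by (simp add: order_antisym)
  qed
  show "p x \<le> 1" if "x \<in> C" for x using lower[of 1 x] that by simp
  show "1 \<le> p x" if x: "x \<notin> C" for x
  proof (rule great, rule ccontr)
    fix s assume s: "0 < s" "x /\<^sub>R s \<in> C" "\<not> 1 \<le> s"
    have "0 \<in> C" using r by auto
    then have "s *\<^sub>R (x /\<^sub>R s) + (1 - s) *\<^sub>R 0 \<in> C"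
      using s by (intro convexD[OF C]) auto
    then show False using s x by simp
  qed
qed

text \<open>The functional is dominated by the gauge of the translated set \<open>C - c\<close>, thickened by a ball that still misses \<open>z - c\<close>.\<close>

lemma separate_closed_convex_point:
  fixes C :: "'a::real_normed_vector set"
  assumes C: "convex C" "closed C" "c \<in> C" and z: "z \<notin> C"
  obtains l :: "'a \<Rightarrow>\<^sub>L real" and \<beta> where "norm l = 1" "\<And>x. x \<in> C \<Longrightarrow> l x \<le> \<beta>" "\<beta> < l z"
proof -
  obtain r where r: "0 < r" "ball z r \<inter> C = {}"
  proof -
    have "open (- C)" "z \<in> - C" using C(2) z by auto
    then obtain r where "0 < r" "ball z r \<subseteq> - C" by (rule openE)
    then show ?thesis using that by blast
  qed
  define C' where "C' = {x. \<exists>y\<in>C. norm (x - (y - c)) < r / 2}"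
  have C'c: "convex C'"
  proof (rule convexI)
    fix x x' and u v :: real assume x: "x \<in> C'" "x' \<in> C'" and uv: "0 \<le> u" "0 \<le> v" "u + v = 1"
    obtain y y' where y: "y \<in> C" "norm (x - (y - c)) < r / 2" "y' \<in> C" "norm (x' - (y' - c)) < r / 2"
      using x by (auto simp: C'_def)
    have "u *\<^sub>R (x - (y - c)) + v *\<^sub>R (x' - (y' - c)) \<in> ball 0 (r / 2)"
      using y uv by (intro convexD[OF convex_ball]) auto
    moreover have "u *\<^sub>R (x - (y - c)) + v *\<^sub>R (x' - (y' - c)) = u *\<^sub>R x + v *\<^sub>R x' - (u *\<^sub>R y + v *\<^sub>R y' - (u + v) *\<^sub>R c)"
      by (simp add: algebra_simps)
    ultimately have "norm (u *\<^sub>R x + v *\<^sub>R x' - (u *\<^sub>R y + v *\<^sub>R y' - c)) < r / 2"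
      using uv by simp
    moreover have "u *\<^sub>R y + v *\<^sub>R y' \<in> C" using y uv by (intro convexD[OF C(1)]) auto
    ultimately show "u *\<^sub>R x + v *\<^sub>R x' \<in> C'" unfolding C'_def by blast
  qed
  have C'b: "ball 0 (r / 2) \<subseteq> C'" unfolding C'_def using C(3) by (auto intro!: bexI[of _ c])
  have zC': "z - c \<notin> C'"
  proof
    assume "z - c \<in> C'"
    then obtain y where "y \<in> C" "norm (z - y) < r / 2" by (auto simp: C'_def)
    moreover from this have "dist z y < r" using r norm_ge_zero[of "z - y"] unfolding dist_norm by linarith
    ultimately have "y \<in> ball z r \<inter> C" by simp
    then show False using r by blast
  qed
  define p where "p = (\<lambda>x. Inf {s. 0 < s \<and> x /\<^sub>R s \<in> C'})"
  have p: "sublinear p" "\<And>x. x \<in> C' \<Longrightarrow> p x \<le> 1" "\<And>x. x \<notin> C' \<Longrightarrow> 1 \<le> p x"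
    unfolding p_def using sublinear_gauge[OF C'c _ C'b] r by auto
  obtain l0 where l0: "linear l0" "l0 \<le> p" "l0 (z - c) = p (z - c)"
    using sublinear_dominates_linear[OF p(1)] by blast
  have l0C': "l0 x \<le> 1" if "x \<in> C'" for x using l0(2) p(2)[OF that] by (metis le_funD order_trans)
  have bd: "l0 x \<le> norm x * (4 / r)" for x
  proof (cases "x = 0")
    case False
    let ?s = "r / (4 * norm x)"
    have "?s *\<^sub>R x \<in> C'" using C'b r False by (intro subsetD[OF C'b]) simp
    then have "?s * l0 x \<le> 1" using l0C'[of "?s *\<^sub>R x"] l0(1) by (simp add: linear_cmul)
    then show ?thesis using r False by (simp add: field_simps)
  qed (use l0(1) in \<open>simp add: linear_0\<close>)
  have "bounded_linear l0"
  proof (rule bounded_linear_intro[of _ "4 / r"])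
    show "norm (l0 x) \<le> norm x * (4 / r)" for x
      using bd[of x] bd[of "- x"] l0(1) by (simp add: linear_neg abs_le_iff)
  qed (use l0(1) in \<open>auto simp: linear_add linear_cmul\<close>)
  from bounded_linear_Blinfun_apply[OF this] obtain l1 :: "'a \<Rightarrow>\<^sub>L real" where l1: "\<And>x. l1 x = l0 x"
    by metis
  have lz: "l1 (z - c) \<ge> 1" using l1 l0(3) p(3)[OF zC'] by simp
  have n0: "norm l1 > 0" using lz by (cases "l1 = 0") auto
  \<comment> \<open>Moving by \<open>h\<close> stays in the thickened set, so \<open>l1\<close> is below 1 on the original set by the fixed margin \<open>l1 h\<close>.\<close>
  obtain h where h: "norm h < r / 2" "l1 h > 0"
  proof -
    let ?h = "(r / (4 * (norm (z - c) + 1))) *\<^sub>R (z - c)"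
    have p0: "0 < 4 * (norm (z - c) + 1)" by (simp add: add_nonneg_pos)
    have "norm ?h = r * norm (z - c) / (4 * (norm (z - c) + 1))"
      using r p0 by (simp only: norm_scaleR abs_of_pos divide_pos_pos times_divide_eq_left)
    also have "\<dots> < r / 2"
    proof -
      have "r * n < r * (2 * (n + 1))" if "0 \<le> n" for n
        using r that by (intro mult_strict_left_mono) auto
      then have "r * norm (z - c) < r * (2 * (norm (z - c) + 1))" using norm_ge_zero by blast
      also have "\<dots> = r / 2 * (4 * (norm (z - c) + 1))" by simp
      finally show ?thesis using p0 by (simp only: pos_divide_less_eq)
    qed
    finally have "norm ?h < r / 2" .
    moreover have "l1 ?h > 0"
      unfolding blinfun.scaleR_right using lz r p0 by simp
    ultimately show ?thesis using that by blast
  qed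
  have gain: "l1 y \<le> 1 - l1 h + l1 c" if "y \<in> C" for y
  proof -
    have "(y - c) + h \<in> C'" unfolding C'_def using that h by (auto intro!: bexI[of _ y])
    then have "l1 ((y - c) + h) \<le> 1" using l0C' l1 by simp
    then show ?thesis by (simp add: blinfun.add_right blinfun.diff_right)
  qed
  show ?thesis
  proof (rule that[of "l1 /\<^sub>R norm l1" "(1 - l1 h + l1 c) / norm l1"])
    show "norm (l1 /\<^sub>R norm l1) = 1" using n0 by simp
    show "(l1 /\<^sub>R norm l1) x \<le> (1 - l1 h + l1 c) / norm l1" if "x \<in> C" for x
      using gain[OF that] n0 by (simp add: blinfun.scaleR_left field_simps)
    have "1 - l1 h + l1 c < l1 z" using lz h by (simp add: blinfun.diff_right)
    then show "(1 - l1 h + l1 c) / norm l1 < (l1 /\<^sub>R norm l1) z"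
      using divide_strict_right_mono[OF _ n0, of "1 - l1 h + l1 c" "l1 z"]
      by (simp only: blinfun.scaleR_left real_scaleR_def divide_inverse mult.commute)
  qed
qed

section \<open>Convex sets with empty interior in reflexive spaces\<close>

lemma norming_vector:
  fixes y :: "'a::real_normed_vector \<Rightarrow>\<^sub>L real"
  assumes y: "norm y = 1" and e: "0 < e"
  obtains v where "norm v = e" "e / 2 \<le> y v"
proof -
  have "\<exists>v. \<bar>y v\<bar> > 1 / 2 * norm v"
  proof (rule ccontr)
    assume "\<not> ?thesis"
    then have "norm (y v) \<le> 1 / 2 * norm v" for v by (simp add: not_less)
    then have "norm y \<le> 1 / 2" by (intro norm_blinfun_bound) auto
    with y show False by simp
  qed
  then obtain u where u: "\<bar>y u\<bar> > 1 / 2 * norm u" by blast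
  then have nz: "norm u > 0" by (cases "u = 0") auto
  let ?v = "(sgn (y u) * e / norm u) *\<^sub>R u"
  show ?thesis
  proof (rule that[of ?v])
    have "y u \<noteq> 0" using u nz by auto
    then show "norm ?v = e" using nz e by (simp add: abs_mult abs_sgn_eq)
    have "y ?v = e / norm u * \<bar>y u\<bar>"
      by (simp add: blinfun.scaleR_right abs_sgn mult.commute mult.left_commute)
    also have "\<dots> \<ge> e / norm u * (1 / 2 * norm u)"
      using u e nz by (intro mult_left_mono) auto
    finally show "e / 2 \<le> y ?v" using nz by simp
  qed
qed

text \<open>Let \<open>p\<close> be the average of \<open>c 0, ..., c i\<close>. As \<open>p\<close> is no interior point, a point \<open>z\<close> outside \<open>C\<close> lies as close to it as desired,
and a functional separating \<open>z\<close> from \<open>C\<close> almost attains its supremum over \<open>C\<close> at \<open>p\<close>. Since none of the values at the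
\<open>c k\<close> exceeds the supremum, none of them can be far below the average either.\<close>

lemma almost_flat_functional:
  fixes C :: "'a::real_normed_vector set" and c :: "nat \<Rightarrow> 'a"
  assumes C: "convex C" "closed C" "interior C = {}" and c: "\<And>k. c k \<in> C"
  obtains l :: "'a \<Rightarrow>\<^sub>L real" where "norm l = 1"
    "\<And>x. x \<in> C \<Longrightarrow> l x \<le> l (c 0) + 1 / real (Suc i)"
    "\<And>k. k \<le> i \<Longrightarrow> \<bar>l (c k) - l (c 0)\<bar> \<le> 1 / real (Suc i)"
proof -
  define n where "n = real (Suc i)"
  have n: "n \<ge> 1" by (simp add: n_def)
  \<comment> \<open>With \<open>n\<close> points, a defect \<open>s\<close> at the average allows a defect of about \<open>n s\<close> at each point.\<close>
  define s where "s = 1 / (2 * n * n)"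
  have s: "0 < s" using n by (simp add: s_def)
  have ns: "2 * n * s = 1 / n" using n by (simp add: s_def)
  define p where "p = (\<Sum>k\<le>i. (1 / n) *\<^sub>R c k)"
  have "p \<in> C"
    unfolding p_def using c n by (intro convex_sum[OF _ C(1)]) (auto simp: n_def)
  have "\<not> ball p s \<subseteq> C"
    using C(3) s by (metis empty_iff mem_interior)
  then obtain z where z: "z \<notin> C" "dist p z < s"
    unfolding subset_iff mem_ball by blast
  obtain l :: "'a \<Rightarrow>\<^sub>L real" and \<beta> where l: "norm l = 1" "\<And>x. x \<in> C \<Longrightarrow> l x \<le> \<beta>" "\<beta> < l z"
    by (rule separate_closed_convex_point[OF C(1,2) \<open>p \<in> C\<close> z(1)]) blast
  have "l z \<le> l p + s"
  proof -
    have "l z - l p = l (z - p)" by (simp add: blinfun.diff_right)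
    also have "\<dots> \<le> norm (l (z - p))" by simp
    also have "\<dots> \<le> norm l * norm (z - p)" by (rule norm_blinfun)
    also have "\<dots> \<le> s" using z(2) l(1) by (simp add: dist_norm norm_minus_commute)
    finally show ?thesis by simp
  qed
  then have up: "l x \<le> l p + s" if "x \<in> C" for x using l(2)[OF that] l(3) by linarith
  have lp: "n * l p = (\<Sum>k\<le>i. l (c k))"
    using n by (simp add: p_def blinfun.sum_right blinfun.scaleR_right sum_divide_distrib[symmetric])
  have low: "l p - n * s \<le> l (c k)" if k: "k \<le> i" for k
  proof -
    have "n * l p = l (c k) + (\<Sum>j\<in>{..i} - {k}. l (c j))"
      unfolding lp using k by (intro sum.remove) auto
    also have "(\<Sum>j\<in>{..i} - {k}. l (c j)) \<le> (\<Sum>j\<in>{..i} - {k}. l p + s)"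
      using up c by (intro sum_mono) auto
    also have "\<dots> = (n - 1) * (l p + s)" using k by (simp add: n_def)
    finally show ?thesis using s by (simp add: algebra_simps)
  qed
  have ns1: "s + n * s \<le> 1 / n"
  proof -
    have "1 * s \<le> n * s" using s n by (intro mult_right_mono) auto
    moreover have "2 * n * s = n * s + n * s" by simp
    ultimately show ?thesis using ns by linarith
  qed
  show ?thesis
  proof (rule that[OF l(1)])
    show "l x \<le> l (c 0) + 1 / real (Suc i)" if "x \<in> C" for x
      using up[OF that] low[of 0] ns1 unfolding n_def[symmetric] by simp
    show "\<bar>l (c k) - l (c 0)\<bar> \<le> 1 / real (Suc i)" if "k \<le> i" for k
      using low[OF that] low[of 0] up[OF c[of k]] up[OF c[of 0]] ns1 unfolding n_def[symmetric] abs_le_iff by simp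
  qed
qed

lemma common_convergent_subsequence:
  fixes y :: "nat \<Rightarrow> 'a::real_normed_vector \<Rightarrow>\<^sub>L real"
  assumes "\<And>n. norm (v n) \<le> e"
  obtains r :: "nat \<Rightarrow> nat" where "strict_mono r" "\<And>i. convergent (\<lambda>n. y i (v (r n)))"
proof -
  interpret subseqs "\<lambda>i s. convergent (\<lambda>n. y i (v (s n)))"
  proof
    fix i and s :: "nat \<Rightarrow> nat" assume "strict_mono s"
    have "norm (y i (v (s n))) \<le> norm (y i) * e" for n
      using norm_blinfun[of "y i" "v (s n)"] assms[of "s n"] by (meson mult_left_mono norm_ge_zero order_trans)
    then have "bounded (range (\<lambda>n. y i (v (s n))))" by (intro boundedI) auto
    then obtain l r where "strict_mono r" "((\<lambda>n. y i (v (s n))) \<circ> r) \<longlonglongrightarrow> l"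
      using bounded_imp_convergent_subsequence by blast
    then show "\<exists>r'. strict_mono r' \<and> convergent (\<lambda>n. y i (v ((s \<circ> r') n)))"
      by (auto simp: o_def convergent_def)
  qed
  show ?thesis
  proof (rule that[OF subseq_diagseq])
    fix i
    have "convergent (\<lambda>n. y i (v ((diagseq \<circ> ((+) (Suc i))) n)))"
    proof (rule diagseq_holds)
      fix r s :: "nat \<Rightarrow> nat" and n assume "strict_mono r" "convergent (\<lambda>k. y n (v (s k)))"
      then show "convergent (\<lambda>k. y n (v ((s \<circ> r) k)))"
        using convergent_subseq_convergent[of "\<lambda>k. y n (v (s k))" r] by (simp add: o_def)
    qed
    then show "convergent (\<lambda>n. y i (v (diagseq n)))"
      using convergent_ignore_initial_segment[of "\<lambda>n. y i (v (diagseq n))" "Suc i"]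
      by (simp add: o_def add.commute)
  qed
qed

text \<open>Pass to a subsequence on which all limits of \<open>x i (v n)\<close> over \<open>n\<close> exist. Late vectors differ by something on which the
early functionals are small, and late functionals are small on early vectors, so differences of consecutive
members of a sparse subsequence are almost biorthogonal.\<close>

lemma almost_biorthogonal:
  fixes x :: "nat \<Rightarrow> 'a::real_normed_vector \<Rightarrow>\<^sub>L real"
  assumes x: "\<And>n. norm (x n) = 1" "\<And>v. (\<lambda>n. x n v) \<longlonglongrightarrow> 0" and pos: "0 < e" "0 < \<tau>"
  obtains b w where "strict_mono (b :: nat \<Rightarrow> nat)" "\<And>j. i0 \<le> b j" "\<And>j. norm (w j) \<le> 2 * e"
    "\<And>j. e / 2 - \<tau> \<le> x (b j) (w j)" "\<And>i j. i \<noteq> j \<Longrightarrow> \<bar>x (b i) (w j)\<bar> \<le> \<tau>"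
proof -
  have "\<forall>n. \<exists>v. norm v = e \<and> e / 2 \<le> x n v" using norming_vector[OF x(1) pos(1)] by metis
  then obtain v where v: "\<And>n. norm (v n) = e" "\<And>n. e / 2 \<le> x n (v n)" by metis
  obtain r :: "nat \<Rightarrow> nat" where r: "strict_mono r" "\<And>i. convergent (\<lambda>n. x i (v (r n)))"
    using common_convergent_subsequence[of v e x] v(1) by (metis order_refl)
  define X where "X = (\<lambda>n. x (r n))"
  define V where "V = (\<lambda>n. v (r n))"
  define L where "L = (\<lambda>i. lim (\<lambda>n. X i (V n)))"
  have Xe: "x (r n) = X n" for n by (simp add: X_def)
  have XV: "e / 2 \<le> X n (V n)" for n using v by (simp add: X_def V_def)
  have X0: "(\<lambda>n. X n u) \<longlonglongrightarrow> 0" for u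
    using LIMSEQ_subseq_LIMSEQ[OF x(2) r(1)] by (simp add: X_def o_def)
  have XL: "(\<lambda>n. X i (V n)) \<longlonglongrightarrow> L i" for i
    using r(2)[of "r i"] by (simp add: X_def V_def L_def convergent_LIMSEQ_iff)
  have "\<exists>N>k. \<forall>n\<ge>N. \<forall>i\<le>k. \<bar>X n (V i)\<bar> \<le> \<tau> / 2 \<and> \<bar>X i (V n) - L i\<bar> \<le> \<tau> / 2" for k
  proof -
    have "\<forall>i\<in>{..k}. eventually (\<lambda>n. \<bar>X n (V i)\<bar> \<le> \<tau> / 2 \<and> \<bar>X i (V n) - L i\<bar> \<le> \<tau> / 2) sequentially"
    proof
      fix i
      have "eventually (\<lambda>n. dist (X n (V i)) 0 < \<tau> / 2) sequentially"
        using X0[of "V i"] pos by (intro tendstoD) auto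
      moreover have "eventually (\<lambda>n. dist (X i (V n)) (L i) < \<tau> / 2) sequentially"
        using XL[of i] pos by (intro tendstoD) auto
      ultimately show "eventually (\<lambda>n. \<bar>X n (V i)\<bar> \<le> \<tau> / 2 \<and> \<bar>X i (V n) - L i\<bar> \<le> \<tau> / 2) sequentially"
        by eventually_elim (simp add: dist_real_def)
    qed
    then have "eventually (\<lambda>n. \<forall>i\<in>{..k}. \<bar>X n (V i)\<bar> \<le> \<tau> / 2 \<and> \<bar>X i (V n) - L i\<bar> \<le> \<tau> / 2) sequentially"
      by (intro eventually_ball_finite) auto
    then obtain N where "\<forall>n\<ge>N. \<forall>i\<in>{..k}. \<bar>X n (V i)\<bar> \<le> \<tau> / 2 \<and> \<bar>X i (V n) - L i\<bar> \<le> \<tau> / 2"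
      unfolding eventually_sequentially by blast
    then show ?thesis by (intro exI[of _ "max N (Suc k)"]) auto
  qed
  then obtain N where N: "\<And>k. N k > k"
      "\<And>k n i. N k \<le> n \<Longrightarrow> i \<le> k \<Longrightarrow> \<bar>X n (V i)\<bar> \<le> \<tau> / 2 \<and> \<bar>X i (V n) - L i\<bar> \<le> \<tau> / 2"
    by metis
  \<comment> \<open>The vector with index \<open>g (2 j)\<close> is subtracted from the one with index \<open>g (2 j + 1)\<close>; the functionals have odd indices.\<close>
  define g where "g = (\<lambda>k. (N ^^ k) i0)"
  have gS: "g (Suc k) = N (g k)" for k by (simp add: g_def)
  have g: "strict_mono g" by (simp add: strict_mono_Suc_iff gS N(1))
  have g0: "i0 \<le> g k" for k
    using strict_mono_less_eq[OF g, of 0 k] by (simp add: g_def)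
  have late: "\<bar>X (g k) (V (g m))\<bar> \<le> \<tau> / 2" "\<bar>X (g m) (V (g k)) - L (g m)\<bar> \<le> \<tau> / 2" if "m < k" for k m
  proof -
    have "k = Suc (k - 1)" "m \<le> k - 1" using that by auto
    then obtain k' where k': "k = Suc k'" "m \<le> k'" by blast
    then have "g m \<le> g k'" using g by (simp add: strict_mono_less_eq)
    then show "\<bar>X (g k) (V (g m))\<bar> \<le> \<tau> / 2" "\<bar>X (g m) (V (g k)) - L (g m)\<bar> \<le> \<tau> / 2"
      using N(2)[of "g k'" "g k" "g m"] by (auto simp: k' gS)
  qed
  show ?thesis
  proof (rule that[of "\<lambda>j. r (g (2 * j + 1))" "\<lambda>j. V (g (2 * j + 1)) - V (g (2 * j))"])
    show "strict_mono (\<lambda>j. r (g (2 * j + 1)))"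
      using g r(1) by (auto simp: strict_mono_def)
    show "i0 \<le> r (g (2 * j + 1))" for j
      using g0[of "2 * j + 1"] seq_suble[OF r(1), of "g (2 * j + 1)"] by simp
    show "norm (V (g (2 * j + 1)) - V (g (2 * j))) \<le> 2 * e" for j
      using norm_triangle_ineq4[of "V (g (2 * j + 1))" "V (g (2 * j))"] v(1) by (simp add: V_def)
    show "e / 2 - \<tau> \<le> x (r (g (2 * j + 1))) (V (g (2 * j + 1)) - V (g (2 * j)))" for j
      using XV[of "g (2 * j + 1)"] late(1)[of "2 * j" "2 * j + 1"] pos unfolding Xe blinfun.diff_right
      by (simp add: abs_le_iff)
    show "\<bar>x (r (g (2 * i + 1))) (V (g (2 * j + 1)) - V (g (2 * j)))\<bar> \<le> \<tau>" if "i \<noteq> j" for i j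
    proof (cases "i < j")
      case True
      then show ?thesis
        using late(2)[of "2 * i + 1" "2 * j"] late(2)[of "2 * i + 1" "2 * j + 1"]
        unfolding Xe blinfun.diff_right abs_le_iff by simp
    next
      case False
      with that have "j < i" by simp
      then show ?thesis
        using late(1)[of "2 * j" "2 * i + 1"] late(1)[of "2 * j + 1" "2 * i + 1"]
        unfolding Xe blinfun.diff_right abs_le_iff by simp
    qed
  qed
qed

text \<open>If 0 were not in the closed convex hull, an element of the bidual would separate it. By reflexivity this element is
the evaluation at a vector, where the sequence tends to 0.\<close>

lemma reflexive_Mazur:
  fixes y :: "nat \<Rightarrow> 'a::real_normed_vector \<Rightarrow>\<^sub>L real"
  assumes refl: "reflexive_space TYPE('a)" and y: "\<And>v. (\<lambda>n. y n v) \<longlonglongrightarrow> 0" and \<eta>: "0 < \<eta>"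
  obtains J m where "finite J" "\<And>j. j \<in> J \<Longrightarrow> 0 \<le> m j" "sum m J = 1" "norm (\<Sum>j\<in>J. m j *\<^sub>R y j) < \<eta>"
proof -
  let ?K = "closure (convex hull (range y))"
  have "0 \<in> ?K"
  proof (rule ccontr)
    assume n: "0 \<notin> ?K"
    have y0: "y 0 \<in> ?K" by (meson closure_subset hull_subset rangeI subset_iff)
    obtain \<phi> :: "('a \<Rightarrow>\<^sub>L real) \<Rightarrow>\<^sub>L real" and \<beta> where \<phi>: "\<And>l. l \<in> ?K \<Longrightarrow> \<phi> l \<le> \<beta>" "\<beta> < \<phi> 0"
      using separate_closed_convex_point[OF _ _ y0 n] convex_closure convex_convex_hull closed_closure by metis
    obtain x where x: "\<And>l. \<phi> l = blinfun_apply l x"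
      using refl unfolding reflexive_space_def by metis
    have "y n x \<le> \<beta>" for n
    proof -
      have "y n \<in> ?K" by (meson closure_subset hull_subset rangeI subset_iff)
      then show ?thesis using \<phi>(1) x by metis
    qed
    then have "0 \<le> \<beta>" using y[of x] by (intro LIMSEQ_le_const2[of _ 0 \<beta>]) auto
    then show False using \<phi>(2) by (simp add: blinfun.zero_right)
  qed
  then obtain h where h: "h \<in> convex hull (range y)" "norm h < \<eta>"
    using \<eta> closure_approachable by (metis dist_0_norm dist_commute)
  obtain S u where S: "finite S" "S \<subseteq> range y" "\<And>l. l \<in> S \<Longrightarrow> 0 \<le> u l" "sum u S = 1" "(\<Sum>l\<in>S. u l *\<^sub>R l) = h"
    using h(1) unfolding convex_hull_explicit by blast
  define i where "i = inv_into UNIV y"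
  have yi: "y (i l) = l" if "l \<in> S" for l
    using S(2) that by (auto simp: i_def f_inv_into_f)
  have inj: "inj_on i S" using yi by (metis inj_onI)
  show ?thesis
  proof (rule that[of "i ` S" "\<lambda>j. u (y j)"])
    show "0 \<le> u (y j)" if "j \<in> i ` S" for j using that S(3) yi by auto
    show "(\<Sum>j\<in>i ` S. u (y j)) = 1"
      using S(4) yi by (simp add: sum.reindex[OF inj])
    have "(\<Sum>j\<in>i ` S. u (y j) *\<^sub>R y j) = h"
      using S(5) yi by (simp add: sum.reindex[OF inj])
    then show "norm (\<Sum>j\<in>i ` S. u (y j) *\<^sub>R y j) < \<eta>" using h by simp
  qed (use S in simp)
qed

lemma finite_weights_measure:
  fixes w :: "nat \<Rightarrow> 'a::real_normed_vector"
  assumes J: "finite J" "\<And>j. j \<in> J \<Longrightarrow> 0 \<le> m j" "sum m J = 1" and w: "\<And>j. j \<in> J \<Longrightarrow> norm (w j) < \<epsilon>"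
    and E: "E \<in> sets borel" and le: "\<And>x. sum m {j \<in> J. x + w j \<in> E} \<le> \<epsilon>"
  obtains \<mu> where "prob_space \<mu>" "sets \<mu> = sets borel" "AE y in \<mu>. norm y < \<epsilon>"
    "\<And>x. measure \<mu> {y. x + y \<in> E} \<le> \<epsilon>"
proof -
  define U where "U = point_measure J (\<lambda>j. ennreal (m j))"
  have spU: "space U = J" by (simp add: U_def space_point_measure)
  interpret U: prob_space U
  proof
    show "emeasure U (space U) = 1"
      unfolding spU using J by (simp add: U_def emeasure_point_measure_finite sum_ennreal)
  qed
  have wm: "w \<in> measurable U borel" by (simp add: U_def)
  show ?thesis
  proof (rule that[of "distr U borel w"])
    show "prob_space (distr U borel w)" by (rule U.prob_space_distr[OF wm])
    show "AE y in distr U borel w. norm y < \<epsilon>"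
    proof (subst AE_distr_iff[OF wm])
      show "AE j in U. norm (w j) < \<epsilon>" using w spU by (auto intro!: AE_I2)
    qed simp
    show "measure (distr U borel w) {y. x + y \<in> E} \<le> \<epsilon>" for x
    proof -
      have "measure (distr U borel w) {y. x + y \<in> E} = measure U {j \<in> J. x + w j \<in> E}"
        by (subst measure_distr[OF wm translate_sets_borel[OF E]]) (simp add: vimage_def spU Collect_conj_eq Int_commute)
      also have "\<dots> = sum m {j \<in> J. x + w j \<in> E}"
      proof -
        have nn: "0 \<le> m j" if "j \<in> {j \<in> J. x + w j \<in> E}" for j using that J(2) by blast
        have "emeasure U {j \<in> J. x + w j \<in> E} = (\<Sum>j\<in>{j \<in> J. x + w j \<in> E}. ennreal (m j))"
          unfolding U_def using J(1) by (intro emeasure_point_measure_finite) auto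
        also have "\<dots> = ennreal (sum m {j \<in> J. x + w j \<in> E})" by (rule sum_ennreal) (rule nn)
        finally show ?thesis unfolding measure_def by (simp only: enn2real_ennreal sum_nonneg nn)
      qed
      finally show ?thesis using le by simp
    qed
  qed simp
qed

text \<open>Put masses \<open>m j\<close> on almost biorthogonal vectors \<open>w j\<close>, where the combination of the functionals with weights \<open>m j\<close> has small
norm. If \<open>z + w j\<close> is in \<open>C\<close>, then the functional \<open>x (b j)\<close> at \<open>z - c0\<close> is at most about \<open>- e / 2\<close>, because \<open>C\<close> lies almost on one
side of it; the other functionals are at most about 0. So a large mass of such \<open>j\<close> would make the combination very
negative at \<open>z - c0\<close>, which its small norm forbids.\<close>

lemma reflexive_bounded_convex_avoidable:
  fixes C :: "'a::real_normed_vector set" and x :: "nat \<Rightarrow> 'a \<Rightarrow>\<^sub>L real"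
  assumes refl: "reflexive_space TYPE('a)"
    and C: "closed C" "\<And>x. x \<in> C \<Longrightarrow> norm x \<le> R" and c0: "c0 \<in> C"
    and x: "\<And>n. norm (x n) = 1" "\<And>v. (\<lambda>n. x n v) \<longlonglongrightarrow> 0"
    and flat: "\<And>n z. z \<in> C \<Longrightarrow> x n z \<le> x n c0 + 1 / real (Suc n)"
  shows "avoidable C"
  unfolding avoidable_def
proof (intro conjI allI impI)
  show "C \<in> sets borel" using C(1) by simp
  fix \<epsilon> :: real assume \<epsilon>: "0 < \<epsilon>"
  define e where "e = \<epsilon> / 3"
  define \<tau> where "\<tau> = e * \<epsilon> / 8"
  define \<eta> where "\<eta> = e * \<epsilon> / (8 * (2 * R + 2 * e + 1))"
  have e: "0 < e" "2 * e < \<epsilon>" using \<epsilon> by (auto simp: e_def)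
  have \<tau>: "0 < \<tau>" using e \<epsilon> by (simp add: \<tau>_def)
  have R: "0 \<le> R" using C(2)[OF c0] norm_ge_zero order_trans by blast
  have \<eta>: "0 < \<eta>" unfolding \<eta>_def using R e \<epsilon> by (intro divide_pos_pos) auto
  obtain i0 where i0: "1 / real (Suc i0) < \<tau>" using nat_approx_posE[OF \<tau>] by blast
  obtain b w where b: "strict_mono (b :: nat \<Rightarrow> nat)" "\<And>j. i0 \<le> b j" and w: "\<And>j. norm (w j) \<le> 2 * e"
    "\<And>j. e / 2 - \<tau> \<le> x (b j) (w j)" "\<And>i j. i \<noteq> j \<Longrightarrow> \<bar>x (b i) (w j)\<bar> \<le> \<tau>"
    using almost_biorthogonal[OF x e(1) \<tau>, of i0] by metis
  have flat': "x (b j) z \<le> x (b j) c0 + \<tau>" if "z \<in> C" for j z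
  proof -
    have "1 / real (Suc (b j)) \<le> 1 / real (Suc i0)" using b(2)[of j] by (intro divide_left_mono) auto
    then show ?thesis using flat[OF that, of "b j"] i0 by linarith
  qed
  have "(\<lambda>n. x (b n) v) \<longlonglongrightarrow> 0" for v
    using LIMSEQ_subseq_LIMSEQ[OF x(2) b(1)] by (simp add: o_def)
  then obtain J m where J: "finite J" "\<And>j. j \<in> J \<Longrightarrow> 0 \<le> m j" "sum m J = 1" "norm (\<Sum>j\<in>J. m j *\<^sub>R x (b j)) < \<eta>"
    using reflexive_Mazur[OF refl _ \<eta>, of "\<lambda>n. x (b n)"] by blast
  have le: "sum m {j \<in> J. z + w j \<in> C} \<le> \<epsilon>" for z
  proof (cases "{j \<in> J. z + w j \<in> C} = {}")
    case True
    show ?thesis unfolding True using \<epsilon> by simp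
  next
    case False
    then obtain k where k: "k \<in> J" "z + w k \<in> C" by blast
    let ?I = "{j \<in> J. z + w j \<in> C}"
    have "norm (z - c0) \<le> 2 * R + 2 * e"
    proof -
      have "z - c0 = (z + w k) - c0 - w k" by simp
      then have "norm (z - c0) \<le> norm (z + w k) + norm c0 + norm (w k)"
        by (metis norm_triangle_ineq4 norm_triangle_le_diff add_mono order_refl)
      then show ?thesis using C(2)[OF k(2)] C(2)[OF c0] w(1)[of k] by linarith
    qed
    then have nz: "norm (z - c0) \<le> 2 * R + 2 * e + 1" by simp
    have "- (\<eta> * (2 * R + 2 * e + 1)) \<le> (\<Sum>j\<in>J. m j *\<^sub>R x (b j)) (z - c0)"
    proof -
      have "norm ((\<Sum>j\<in>J. m j *\<^sub>R x (b j)) (z - c0)) \<le> norm (\<Sum>j\<in>J. m j *\<^sub>R x (b j)) * norm (z - c0)"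
        by (rule norm_blinfun)
      also have "\<dots> \<le> \<eta> * (2 * R + 2 * e + 1)"
        using J(4) nz \<eta> by (intro mult_mono) auto
      finally show ?thesis by simp
    qed
    also have "(\<Sum>j\<in>J. m j *\<^sub>R x (b j)) (z - c0) = (\<Sum>j\<in>J. m j * x (b j) (z - c0))"
      by (simp add: blinfun.sum_left blinfun.scaleR_left)
    also have "\<dots> \<le> (\<Sum>j\<in>J. m j * (2 * \<tau> - (if j \<in> ?I then e / 2 else 0)))"
    proof (intro sum_mono mult_left_mono)
      fix j assume j: "j \<in> J"
      show "x (b j) (z - c0) \<le> 2 * \<tau> - (if j \<in> ?I then e / 2 else 0)"
      proof (cases "j \<in> ?I")
        case True
        then have "x (b j) (z + w j) \<le> x (b j) c0 + \<tau>" by (intro flat') auto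
        then show ?thesis using True w(2)[of j] by (simp add: blinfun.add_right blinfun.diff_right)
      next
        case False
        then have "j \<noteq> k" using k by blast
        moreover have "x (b j) (z + w k) \<le> x (b j) c0 + \<tau>" by (intro flat' k)
        ultimately show ?thesis unfolding if_not_P[OF False] using w(3)[of j k] by (simp add: blinfun.add_right blinfun.diff_right abs_le_iff)
      qed
    qed (use J in auto)
    also have "\<dots> = 2 * \<tau> - e / 2 * sum m ?I"
    proof -
      have "(\<Sum>j\<in>J. m j * (2 * \<tau> - (if j \<in> ?I then e / 2 else 0)))
          = (\<Sum>j\<in>J. m j) * (2 * \<tau>) - (\<Sum>j\<in>J. if j \<in> ?I then e / 2 * m j else 0)"
      proof -
        have "m j * (2 * \<tau> - (if j \<in> ?I then e / 2 else 0)) = m j * (2 * \<tau>) - (if j \<in> ?I then e / 2 * m j else 0)" for j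
          by (cases "j \<in> ?I") (simp_all only: if_True if_False right_diff_distrib mult.commute mult_zero_right)
        then show ?thesis by (simp only: sum_subtractf sum_distrib_right)
      qed
      also have "(\<Sum>j\<in>J. if j \<in> ?I then e / 2 * m j else 0) = (\<Sum>j\<in>?I. e / 2 * m j)"
        using J(1) by (subst sum.inter_restrict[symmetric]) (auto intro: sum.cong)
      finally show ?thesis using J(3) by (simp add: sum_distrib_left)
    qed
    finally have "e / 2 * sum m ?I \<le> 2 * \<tau> + \<eta> * (2 * R + 2 * e + 1)" by simp
    also have "\<eta> * (2 * R + 2 * e + 1) = \<tau>"
    proof -
      have "2 * R + 2 * e + 1 \<noteq> 0" using R e by linarith
      moreover have "q / (8 * s) * s = q / 8" if "s \<noteq> 0" for q s :: real using that by simp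
      ultimately show ?thesis unfolding \<eta>_def \<tau>_def by blast
    qed
    finally have "e / 2 * sum m ?I \<le> e / 2 * (3 / 4 * \<epsilon>)" by (simp add: \<tau>_def mult.commute mult.left_commute)
    then have "sum m ?I \<le> 3 / 4 * \<epsilon>" using e by simp
    then show ?thesis using \<epsilon> by simp
  qed
  have "norm (w j) < \<epsilon>" for j using w(1)[of j] e by simp
  then show "\<exists>\<mu>. prob_space \<mu> \<and> sets \<mu> = sets borel \<and> (AE y in \<mu>. norm y < \<epsilon>) \<and>
        (\<forall>x. measure \<mu> {y. x + y \<in> C} \<le> \<epsilon>)"
    using finite_weights_measure[of J m w \<epsilon> C] J(1-3) le C(1) by (metis borel_closed)
qed

text \<open>For a bounded set, the almost flat functionals tend to 0 on a closed subspace \<open>W\<close> that contains all differences of points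
of the set. If \<open>W\<close> is the whole space, the previous lemma applies. Otherwise lines in a direction outside \<open>W\<close> meet the set in
at most one point.\<close>

lemma reflexive_convex_sigma_avoidable:
  fixes C :: "'a::banach set"
  assumes sep: "separable_space (euclidean :: 'a topology)" and refl: "reflexive_space TYPE('a)"
    and C: "convex C" "closed C" "interior C = {}"
  shows "sigma_avoidable C"
proof -
  have bounded: "avoidable K" if K: "convex K" "closed K" "interior K = {}" "\<And>x. x \<in> K \<Longrightarrow> norm x \<le> R" for K :: "'a set" and R
  proof (cases "K = {}")
    case True
    then show ?thesis by (simp add: avoidable_empty)
  next
    case False
    obtain D where D: "countable D" "D \<subseteq> K" "K \<subseteq> closure D"
      using separable_subset_dense[OF sep] by blast
    have "D \<noteq> {}" using False D by auto
    define c where "c = from_nat_into D"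
    have c: "range c = D" using \<open>D \<noteq> {}\<close> D(1) by (simp add: c_def range_from_nat_into)
    have cK: "c k \<in> K" for k using c D(2) by blast
    have "\<forall>i. \<exists>l :: 'a \<Rightarrow>\<^sub>L real. norm l = 1 \<and> (\<forall>z\<in>K. blinfun_apply l z \<le> l (c 0) + 1 / real (Suc i)) \<and>
        (\<forall>k\<le>i. \<bar>blinfun_apply l (c k) - l (c 0)\<bar> \<le> 1 / real (Suc i))"
    proof
      fix i
      obtain l :: "'a \<Rightarrow>\<^sub>L real" where "norm l = 1" "\<And>z. z \<in> K \<Longrightarrow> l z \<le> l (c 0) + 1 / real (Suc i)"
        "\<And>k. k \<le> i \<Longrightarrow> \<bar>l (c k) - l (c 0)\<bar> \<le> 1 / real (Suc i)"
        by (rule almost_flat_functional[of K c i, OF K(1-3) cK]) blast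
      then show "\<exists>l :: 'a \<Rightarrow>\<^sub>L real. norm l = 1 \<and> (\<forall>z\<in>K. blinfun_apply l z \<le> l (c 0) + 1 / real (Suc i)) \<and>
        (\<forall>k\<le>i. \<bar>blinfun_apply l (c k) - l (c 0)\<bar> \<le> 1 / real (Suc i))" by blast
    qed
    then obtain x :: "nat \<Rightarrow> 'a \<Rightarrow>\<^sub>L real" where x: "\<And>i. norm (x i) = 1"
        "\<And>i z. z \<in> K \<Longrightarrow> x i z \<le> x i (c 0) + 1 / real (Suc i)"
        "\<And>i k. k \<le> i \<Longrightarrow> \<bar>x i (c k) - x i (c 0)\<bar> \<le> 1 / real (Suc i)"
      by metis
    define W where "W = {w. (\<lambda>n. x n w) \<longlonglongrightarrow> 0}"
    have W_add: "u + v \<in> W" if "u \<in> W" "v \<in> W" for u v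
      using tendsto_add[of "\<lambda>n. x n u" 0 sequentially "\<lambda>n. x n v" 0] that
      by (simp add: W_def blinfun.add_right)
    have W_scale: "t *\<^sub>R u \<in> W" if "u \<in> W" for u t
      using tendsto_mult_left[of "\<lambda>n. x n u" 0 sequentially t] that
      by (simp add: W_def blinfun.scaleR_right)
    have W_approx: "u \<in> W" if approx: "\<And>\<delta>. 0 < \<delta> \<Longrightarrow> \<exists>u'\<in>W. norm (u - u') < \<delta>" for u
      unfolding W_def mem_Collect_eq
    proof (rule tendstoI)
      fix \<delta> :: real assume \<delta>: "0 < \<delta>"
      obtain u' where u': "u' \<in> W" "norm (u - u') < \<delta> / 2" using approx[of "\<delta> / 2"] \<delta> by auto
      have "eventually (\<lambda>n. dist (x n u') 0 < \<delta> / 2) sequentially"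
        using u'(1) \<delta> unfolding W_def by (intro tendstoD) auto
      then show "eventually (\<lambda>n. dist (x n u) 0 < \<delta>) sequentially"
      proof eventually_elim
        case (elim n)
        have "\<bar>x n u - x n u'\<bar> \<le> norm (u - u')"
          using norm_blinfun[of "x n" "u - u'"] x(1)[of n] by (simp add: blinfun.diff_right)
        then show ?case using elim u'(2) by (simp add: dist_real_def)
      qed
    qed
    have cW: "c k - c 0 \<in> W" for k
    proof -
      have "(\<lambda>n. 1 / real (Suc n)) \<longlonglongrightarrow> 0" by (rule LIMSEQ_Suc[OF lim_1_over_n])
      moreover have "eventually (\<lambda>n. norm (x n (c k - c 0)) \<le> 1 / real (Suc n)) sequentially"
        using x(3)[of k] by (auto simp: eventually_sequentially blinfun.diff_right)
      ultimately show ?thesis unfolding W_def by (auto intro: Lim_null_comparison)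
    qed
    have KW: "z - c 0 \<in> W" if z: "z \<in> K" for z
    proof (rule W_approx)
      fix \<delta> :: real assume "0 < \<delta>"
      then obtain d where d: "d \<in> D" "dist d z < \<delta>"
        using subsetD[OF D(3) z] unfolding closure_approachable by blast
      then obtain k where "d = c k" using c by blast
      then have "norm ((z - c 0) - (c k - c 0)) < \<delta>" using d by (simp add: dist_norm norm_minus_commute)
      then show "\<exists>u'\<in>W. norm (z - c 0 - u') < \<delta>" using cW by blast
    qed
    show ?thesis
    proof (cases "W = UNIV")
      case True
      then have "(\<lambda>n. x n v) \<longlonglongrightarrow> 0" for v unfolding W_def by blast
      then show ?thesis
        using reflexive_bounded_convex_avoidable[OF refl K(2,4) cK[of 0] x(1) _ x(2)] by blast
    next
      case False
      then obtain v where v: "v \<notin> W" by blast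
      show ?thesis
      proof (rule avoidable_line[where v = v])
        fix a
        have unique: "t = s" if "a + t *\<^sub>R v \<in> K" "a + s *\<^sub>R v \<in> K" for t s
        proof (rule ccontr)
          assume ne: "t \<noteq> s"
          have "(a + t *\<^sub>R v - c 0) + (-1) *\<^sub>R (a + s *\<^sub>R v - c 0) \<in> W"
            using that by (intro W_add W_scale KW)
          then have "(1 / (t - s)) *\<^sub>R ((a + t *\<^sub>R v - c 0) + (-1) *\<^sub>R (a + s *\<^sub>R v - c 0)) \<in> W"
            by (rule W_scale)
          also have "(a + t *\<^sub>R v - c 0) + (-1) *\<^sub>R (a + s *\<^sub>R v - c 0) = (t - s) *\<^sub>R v"
            by (simp add: algebra_simps)
          finally show False using v ne by simp
        qed
        have "finite {t. a + t *\<^sub>R v \<in> K}"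
        proof (cases "{t. a + t *\<^sub>R v \<in> K} = {}")
          case False
          then obtain s where "a + s *\<^sub>R v \<in> K" by blast
          then have "{t. a + t *\<^sub>R v \<in> K} \<subseteq> {s}" using unique by blast
          then show ?thesis by (rule finite_subset) simp
        qed (simp only: finite.emptyI)
        then show "{t. a + t *\<^sub>R v \<in> K} \<in> null_sets lborel" by (rule finite_imp_null_set_lborel)
      qed (use K in simp)
    qed
  qed
  have "avoidable (C \<inter> cball 0 (real n))" for n
  proof (rule bounded[of _ "real n"])
    show "interior (C \<inter> cball 0 (real n)) = {}" using C(3) by (simp add: interior_Int)
  qed (use C in \<open>auto intro: convex_Int\<close>)
  moreover have "C \<subseteq> (\<Union>n. C \<inter> cball 0 (real n))" using real_arch_simple by auto
  ultimately show ?thesis unfolding sigma_avoidable_def by (intro exI[of _ "\<lambda>n. C \<inter> cball 0 (real n)"]) simp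
qed

section \<open>Directional derivatives and directional porosity\<close>

definition dir_deriv :: "('a::real_vector \<Rightarrow> real) \<Rightarrow> 'a \<Rightarrow> 'a \<Rightarrow> real \<Rightarrow> bool" where
  "dir_deriv f x h p \<longleftrightarrow> ((\<lambda>t. (f (x + t *\<^sub>R h) - f x) / t) \<longlongrightarrow> p) (at 0)"

lemma dir_deriv_unique: "dir_deriv f x h p \<Longrightarrow> dir_deriv f x h q \<Longrightarrow> p = q"
  unfolding dir_deriv_def by (rule tendsto_unique[OF at_neq_bot])

lemma dir_deriv_scale:
  assumes "dir_deriv f x h p"
  shows "dir_deriv f x (s *\<^sub>R h) (s * p)"
proof (cases "s = 0")
  case True
  then show ?thesis by (simp add: dir_deriv_def)
next
  case False
  have "filterlim (\<lambda>t. t * s) (at 0) (at (0::real))"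
    unfolding filterlim_at
    using False by (auto intro!: tendsto_eq_intros simp: eventually_at_filter)
  from filterlim_compose[OF assms[unfolded dir_deriv_def] this]
  have "((\<lambda>t. s * ((f (x + (t * s) *\<^sub>R h) - f x) / (t * s))) \<longlongrightarrow> s * p) (at 0)"
    by (intro tendsto_mult_left)
  then show ?thesis unfolding dir_deriv_def using False by simp
qed

text \<open>The limit is the infimum of the eventual upper bounds; restricting the gaps to rational ones keeps the number of
exceptional sets countable.\<close>

lemma convergent_if_no_gap:
  fixes q :: "'b \<Rightarrow> real"
  assumes F: "F \<noteq> bot" and bd: "eventually (\<lambda>t. \<bar>q t\<bar> \<le> B) F"
    and gap: "\<And>a b. a \<in> \<rat> \<Longrightarrow> b \<in> \<rat> \<Longrightarrow> a < b \<Longrightarrow> eventually (\<lambda>t. q t \<le> b) F \<or> eventually (\<lambda>t. a \<le> q t) F"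
  obtains p where "(q \<longlongrightarrow> p) F"
proof -
  define S where "S = {b. eventually (\<lambda>t. q t \<le> b) F}"
  define p where "p = Inf S"
  have lb: "- B \<le> b" if "b \<in> S" for b
  proof -
    have "eventually (\<lambda>t. - B \<le> b) F"
      using bd that[unfolded S_def mem_Collect_eq] by eventually_elim auto
    then show ?thesis using F by simp
  qed
  have "B \<in> S" unfolding S_def mem_Collect_eq using bd by eventually_elim auto
  then have ne: "S \<noteq> {}" by auto
  have bdd: "bdd_below S" using lb by (rule bdd_belowI)
  have "(q \<longlongrightarrow> p) F"
  proof (rule tendstoI)
    fix e :: real assume e: "0 < e"
    have "Inf S < p + e" using e by (simp add: p_def)
    then obtain b where "b \<in> S" "b < p + e" using cInf_lessD[OF ne] by blast
    then have up: "eventually (\<lambda>t. q t < p + e) F"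
      unfolding S_def mem_Collect_eq by (auto elim: eventually_mono)
    obtain a where a: "a \<in> \<rat>" "p - e < a" "a < p" using Rats_dense_in_real[of "p - e" p] e by auto
    obtain b' where b': "b' \<in> \<rat>" "a < b'" "b' < p" using Rats_dense_in_real[of a p] a by auto
    have "b' \<notin> S" using cInf_lower[OF _ bdd, of b'] b' by (auto simp: p_def)
    then have "eventually (\<lambda>t. a \<le> q t) F" using gap[OF a(1) b'(1,2)] by (auto simp: S_def)
    then show "eventually (\<lambda>t. dist (q t) p < e) F"
      using up by eventually_elim (use a in \<open>auto simp: dist_real_def\<close>)
  qed
  then show ?thesis by (rule that)
qed

text \<open>Continuity at 0 reduces quotients with endpoint 0 to slopes over intervals that contain 0 in the interior. The
latter are preferable because the corresponding conditions define open sets.\<close>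

lemma straddling_slope_bound:
  fixes \<phi> :: "real \<Rightarrow> real"
  assumes cont: "(\<phi> \<longlongrightarrow> \<phi> 0) (at 0)" and \<eta>: "0 < \<eta>"
    and slope: "\<And>c d. c < 0 \<Longrightarrow> 0 < d \<Longrightarrow> d - c < \<eta> \<Longrightarrow> \<phi> d - \<phi> c \<le> b * (d - c)"
  shows "eventually (\<lambda>t. (\<phi> t - \<phi> 0) / t \<le> b) (at 0)"
proof -
  have "(\<phi> t - \<phi> 0) / t \<le> b" if t: "t \<noteq> 0" "\<bar>t\<bar> < \<eta> / 2" for t
  proof (cases "0 < t")
    case True
    have "\<phi> t - \<phi> 0 \<le> b * (t - 0)"
    proof (rule tendsto_le[of "at_left 0" "\<lambda>c. b * (t - c)" _ "\<lambda>c. \<phi> t - \<phi> c"])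
      have "(\<phi> \<longlongrightarrow> \<phi> 0) (at_left 0)" using cont filterlim_at_split by blast
      then show "((\<lambda>c. \<phi> t - \<phi> c) \<longlongrightarrow> \<phi> t - \<phi> 0) (at_left 0)" by (intro tendsto_intros)
      show "((\<lambda>c. b * (t - c)) \<longlongrightarrow> b * (t - 0)) (at_left 0)" by (intro tendsto_intros)
      have "eventually (\<lambda>c. c \<in> {- (\<eta> / 2)<..<0}) (at_left (0::real))"
        using \<eta> by (intro eventually_at_left_real) auto
      then show "eventually (\<lambda>c. \<phi> t - \<phi> c \<le> b * (t - c)) (at_left 0)"
        by eventually_elim (use slope True t in auto)
    qed simp
    then show ?thesis using True by (simp add: field_simps)
  next
    case False
    then have t0: "t < 0" using t by simp
    have "\<phi> 0 - \<phi> t \<le> b * (0 - t)"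
    proof (rule tendsto_le[of "at_right 0" "\<lambda>d. b * (d - t)" _ "\<lambda>d. \<phi> d - \<phi> t"])
      have "(\<phi> \<longlongrightarrow> \<phi> 0) (at_right 0)" using cont filterlim_at_split by blast
      then show "((\<lambda>d. \<phi> d - \<phi> t) \<longlongrightarrow> \<phi> 0 - \<phi> t) (at_right 0)" by (intro tendsto_intros)
      show "((\<lambda>d. b * (d - t)) \<longlongrightarrow> b * (0 - t)) (at_right 0)" by (intro tendsto_intros)
      have "eventually (\<lambda>d. d \<in> {0<..<\<eta> / 2}) (at_right (0::real))"
        using \<eta> by (intro eventually_at_right_real) auto
      then show "eventually (\<lambda>d. \<phi> d - \<phi> t \<le> b * (d - t)) (at_right 0)"
        by eventually_elim (use slope t0 t in auto)
    qed simp
    then show ?thesis using t0 by (simp add: field_simps)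
  qed
  then show ?thesis
    unfolding eventually_at using \<eta> by (intro exI[of _ "\<eta> / 2"]) (auto simp: dist_real_def)
qed

text \<open>Being null on a line is a local property. This permits functions that are monotone only near each point.\<close>

lemma avoidable_line_local:
  fixes E :: "'a::real_normed_vector set"
  assumes E: "E \<in> sets borel"
    and loc: "\<And>x. x \<in> E \<Longrightarrow> \<exists>r>0. \<forall>T. T \<in> lmeasurable \<longrightarrow> T \<subseteq> {- r<..<r} \<longrightarrow> (\<forall>t\<in>T. x + t *\<^sub>R v \<in> E) \<longrightarrow> negligible T"
  shows "avoidable E"
proof (rule avoidable_line[OF E, of v])
  fix x
  let ?T = "{t::real. x + t *\<^sub>R v \<in> E}"
  have "(\<lambda>t. x + t *\<^sub>R v) \<in> borel_measurable borel"
    by (intro borel_measurable_continuous_onI continuous_intros)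
  from measurable_sets[OF this E] have T: "?T \<in> sets borel" by (simp add: vimage_def)
  have "negligible ?T"
  proof (subst locally_negligible_alt, rule ballI)
    fix s assume s: "s \<in> ?T"
    then have sE: "x + s *\<^sub>R v \<in> E" by simp
    obtain r where r: "0 < r" "\<And>T. T \<in> lmeasurable \<Longrightarrow> T \<subseteq> {- r<..<r} \<Longrightarrow>
        (\<forall>t\<in>T. (x + s *\<^sub>R v) + t *\<^sub>R v \<in> E) \<Longrightarrow> negligible T"
      using loc[OF sE] by blast
    let ?U = "?T \<inter> {s - r<..<s + r}"
    let ?U' = "(\<lambda>t. - s + t) ` ?U"
    have "?U \<in> lmeasurable" using T by (intro bounded_set_imp_lmeasurable) (auto intro: bounded_subset[of "{s - r<..<s + r}"])
    then have "?U' \<in> lmeasurable" by (rule measurable_translation)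
    moreover have "?U' \<subseteq> {- r<..<r}" by auto
    moreover have "\<forall>t\<in>?U'. (x + s *\<^sub>R v) + t *\<^sub>R v \<in> E" by (auto simp: algebra_simps)
    ultimately have "negligible ?U'" by (rule r(2))
    then have "negligible ?U" by (rule negligible_translation_rev)
    then show "\<exists>U. openin (top_of_set ?T) U \<and> s \<in> U \<and> negligible U"
      using s r(1) by (intro exI[of _ ?U]) (auto intro: openin_open_Int)
  qed
  then show "?T \<in> null_sets lborel"
    using T by (metis negligible_iff_null_sets null_sets_completion_iff sets_lborel)
qed

text \<open>Points of the closure of \<open>A\<close> near which \<open>A\<close> has proportionally large holes in the directions \<open>u\<close> and \<open>- u\<close>. Expressing holes
by strict inequalities for \<open>infdist\<close> makes this a Borel set for arbitrary \<open>A\<close>.\<close>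

definition porous_in :: "'a::real_normed_vector set \<Rightarrow> 'a \<Rightarrow> real \<Rightarrow> 'a set" where
  "porous_in A u c = {x \<in> closure A. \<forall>j. \<exists>\<tau>. 0 < \<bar>\<tau>\<bar> \<and> \<bar>\<tau>\<bar> < 1 / real (Suc j) \<and> c * \<bar>\<tau>\<bar> < infdist (x + \<tau> *\<^sub>R u) A}"

lemma porous_avoidable:
  assumes c: "0 < c"
  shows "avoidable (porous_in A u c)"
proof (cases "A = {}")
  case True
  then show ?thesis by (simp add: porous_in_def avoidable_empty)
next
  case A: False
  define G where "G = (\<lambda>j::nat. \<Union>\<tau>\<in>{\<tau>. 0 < \<bar>\<tau>\<bar> \<and> \<bar>\<tau>\<bar> < 1 / real (Suc j)}. {x. c * \<bar>\<tau>\<bar> < infdist (x + \<tau> *\<^sub>R u) A})"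
  have "open (G j)" for j
    unfolding G_def by (intro open_UN ballI open_Collect_less continuous_intros)
  then have "closure A \<inter> (\<Inter>j. G j) \<in> sets borel" by (intro sets.Int sets.countable_INT'') auto
  also have "closure A \<inter> (\<Inter>j. G j) = porous_in A u c" by (auto simp: porous_in_def G_def)
  finally have borel: "porous_in A u c \<in> sets borel" .
  show ?thesis
  proof (rule avoidable_line_local[OF borel, of u])
    fix x
    have "negligible T" if T: "T \<in> lmeasurable" "\<And>t. t \<in> T \<Longrightarrow> x + t *\<^sub>R u \<in> porous_in A u c" for T
    proof (rule negligible_porous[OF T(1)])
      show "0 < c / (norm u + 1)" using c by (intro divide_pos_pos add_nonneg_pos) auto
      fix t \<eta> :: real assume t: "t \<in> T" and \<eta>: "0 < \<eta>"
      obtain j where j: "1 / real (Suc j) < \<eta>" using nat_approx_posE[OF \<eta>] by blast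
      obtain \<tau> where \<tau>: "0 < \<bar>\<tau>\<bar>" "\<bar>\<tau>\<bar> < 1 / real (Suc j)" "c * \<bar>\<tau>\<bar> < infdist (x + t *\<^sub>R u + \<tau> *\<^sub>R u) A"
        using T(2)[OF t] by (auto simp: porous_in_def)
      have "s \<notin> T" if s: "s \<in> ball (t + \<tau>) (c / (norm u + 1) * \<bar>\<tau>\<bar>)" for s
      proof
        assume "s \<in> T"
        then have "x + s *\<^sub>R u \<in> closure A" using T(2) by (auto simp: porous_in_def)
        then have "infdist (x + t *\<^sub>R u + \<tau> *\<^sub>R u) A \<le> dist (x + t *\<^sub>R u + \<tau> *\<^sub>R u) (x + s *\<^sub>R u)"
          using infdist_triangle[of "x + t *\<^sub>R u + \<tau> *\<^sub>R u" A "x + s *\<^sub>R u"] in_closure_iff_infdist_zero[OF A, of "x + s *\<^sub>R u"]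
          by simp
        also have "\<dots> = \<bar>t + \<tau> - s\<bar> * norm u"
        proof -
          have "x + t *\<^sub>R u + \<tau> *\<^sub>R u - (x + s *\<^sub>R u) = (t + \<tau> - s) *\<^sub>R u" by (simp add: algebra_simps)
          then show ?thesis by (simp add: dist_norm)
        qed
        also have "\<dots> \<le> (c / (norm u + 1) * \<bar>\<tau>\<bar>) * (norm u + 1)"
          using s by (intro mult_mono) (auto simp: dist_real_def)
        also have "\<dots> = c * \<bar>\<tau>\<bar>"
        proof -
          have "norm u + 1 \<noteq> 0" using norm_ge_zero[of u] by linarith
          then show ?thesis by simp
        qed
        finally show False using \<tau>(3) by simp
      qed
      then show "\<exists>\<tau>. 0 < \<bar>\<tau>\<bar> \<and> \<bar>\<tau>\<bar> < \<eta> \<and> ball (t + \<tau>) (c / (norm u + 1) * \<bar>\<tau>\<bar>) \<inter> T = {}"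
        using \<tau> j by (intro exI[of _ \<tau>]) auto
    qed
    then show "\<exists>r>0. \<forall>T. T \<in> lmeasurable \<longrightarrow> T \<subseteq> {- r<..<r} \<longrightarrow> (\<forall>t\<in>T. x + t *\<^sub>R u \<in> porous_in A u c) \<longrightarrow> negligible T"
      by (intro exI[of _ 1]) auto
  qed
qed

lemma not_porous_inD:
  assumes x: "x \<in> A" "x \<notin> porous_in A u c" and c: "0 < c"
  obtains \<eta> where "0 < \<eta>" "\<And>\<tau>. 0 < \<bar>\<tau>\<bar> \<Longrightarrow> \<bar>\<tau>\<bar> < \<eta> \<Longrightarrow> \<exists>y\<in>A. dist (x + \<tau> *\<^sub>R u) y < 2 * c * \<bar>\<tau>\<bar>"
proof -
  have "x \<in> closure A" using x(1) closure_subset by blast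
  then have "\<exists>j. \<forall>\<tau>. \<not> (0 < \<bar>\<tau>\<bar> \<and> \<bar>\<tau>\<bar> < 1 / real (Suc j) \<and> c * \<bar>\<tau>\<bar> < infdist (x + \<tau> *\<^sub>R u) A)"
    using x(2) unfolding porous_in_def by blast
  then obtain j where j: "\<And>\<tau>. 0 < \<bar>\<tau>\<bar> \<Longrightarrow> \<bar>\<tau>\<bar> < 1 / real (Suc j) \<Longrightarrow> infdist (x + \<tau> *\<^sub>R u) A \<le> c * \<bar>\<tau>\<bar>"
    unfolding not_less[symmetric] by blast
  show ?thesis
  proof (rule that[of "1 / real (Suc j)"])
    fix \<tau> :: real assume \<tau>: "0 < \<bar>\<tau>\<bar>" "\<bar>\<tau>\<bar> < 1 / real (Suc j)"
    have "infdist (x + \<tau> *\<^sub>R u) A < 2 * c * \<bar>\<tau>\<bar>" using j[OF \<tau>] \<tau> c mult_pos_pos[of c "\<bar>\<tau>\<bar>"] by linarith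
    moreover have "A \<noteq> {}" using x(1) by blast
    ultimately have "(INF a\<in>A. dist (x + \<tau> *\<^sub>R u) a) < 2 * c * \<bar>\<tau>\<bar>" by (simp add: infdist_notempty)
    then show "\<exists>y\<in>A. dist (x + \<tau> *\<^sub>R u) y < 2 * c * \<bar>\<tau>\<bar>"
      using \<open>A \<noteq> {}\<close> by (subst (asm) cINF_less_iff) auto
  qed simp
qed

section \<open>Cone-monotone functions: Lipschitz points and directional derivatives\<close>

text \<open>Openness of the cone makes the strict order \<open>z - y \<in> P\<close> stable under small changes of both points; all estimates below
rest on this.\<close>

locale cone_monotone =
  fixes f :: "'a::real_normed_vector \<Rightarrow> real" and P V :: "'a set"
  assumes open_P: "open P" and P_add: "u \<in> P \<Longrightarrow> v \<in> P \<Longrightarrow> u + v \<in> P"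
    and P_scale: "u \<in> P \<Longrightarrow> 0 < t \<Longrightarrow> t *\<^sub>R u \<in> P" and P_nonempty: "P \<noteq> {}"
    and open_V: "open V" and mono: "y \<in> V \<Longrightarrow> z \<in> V \<Longrightarrow> z - y \<in> P \<Longrightarrow> f y \<le> f z"
begin

lemma V_ball:
  assumes "x \<in> V"
  obtains r where "0 < r" "\<And>h. norm h < r \<Longrightarrow> x + h \<in> V"
proof -
  obtain r where r: "0 < r" "ball x r \<subseteq> V" using open_V assms by (meson openE)
  have "x + h \<in> V" if "norm h < r" for h using r(2) that by (intro subsetD[OF r(2)]) (simp add: dist_norm)
  with r(1) that show ?thesis by blast
qed

lemma P_ball:
  assumes "u \<in> P"
  obtains \<rho> where "0 < \<rho>" "\<And>t h. 0 < t \<Longrightarrow> norm h < t * \<rho> \<Longrightarrow> t *\<^sub>R u + h \<in> P"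
proof -
  obtain r where r: "0 < r" "ball u r \<subseteq> P" using open_P assms by (meson openE)
  have "t *\<^sub>R u + h \<in> P" if t: "0 < t" "norm h < t * r" for t h
  proof -
    have "norm (h /\<^sub>R t) < r" using t by (simp add: field_simps)
    then have "u + h /\<^sub>R t \<in> P" by (intro subsetD[OF r(2)]) (simp add: dist_norm)
    from P_scale[OF this t(1)] show ?thesis using t by (simp add: scaleR_add_right)
  qed
  with r(1) that show ?thesis by blast
qed

definition steep :: "real \<Rightarrow> 'a \<Rightarrow> real \<Rightarrow> 'a set" where
  "steep b k \<eta> = {x \<in> V. \<exists>c d. c < 0 \<and> 0 < d \<and> d - c < \<eta> \<and> x + c *\<^sub>R k \<in> V \<and> x + d *\<^sub>R k \<in> V \<and>
     b * (d - c) < f (x + d *\<^sub>R k) - f (x + c *\<^sub>R k)}"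

definition flat :: "real \<Rightarrow> 'a \<Rightarrow> real \<Rightarrow> 'a set" where
  "flat a k \<eta> = {x \<in> V. \<exists>c d. c < 0 \<and> 0 < d \<and> d - c < \<eta> \<and> x + c *\<^sub>R k \<in> V \<and> x + d *\<^sub>R k \<in> V \<and>
     f (x + d *\<^sub>R k) - f (x + c *\<^sub>R k) < a * (d - c)}"

lemma open_shift: "open U \<Longrightarrow> open {y. y + a \<in> U}" "open U \<Longrightarrow> open {y. a - y \<in> U}" for U :: "'a set"
proof -
  assume U: "open U"
  have "open ((\<lambda>y. y + a) -` U)" "open ((\<lambda>y. a - y) -` U)"
    using U by (auto intro!: open_vimage continuous_intros)
  then show "open {y. y + a \<in> U}" "open {y. a - y \<in> U}" by (simp_all add: vimage_def)
qed

lemma eventually_shift_in_V: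
  assumes "x + c *\<^sub>R k \<in> V"
  shows "eventually (\<lambda>\<sigma>. x + (c + \<sigma>) *\<^sub>R k \<in> V) (at_right 0)" "eventually (\<lambda>\<sigma>. x + (c - \<sigma>) *\<^sub>R k \<in> V) (at_right 0)"
proof -
  have "((\<lambda>\<sigma>. x + (c + \<sigma>) *\<^sub>R k) \<longlongrightarrow> x + (c + 0) *\<^sub>R k) (at_right 0)" by (intro tendsto_intros)
  then show "eventually (\<lambda>\<sigma>. x + (c + \<sigma>) *\<^sub>R k \<in> V) (at_right 0)"
    using open_V assms by (intro topological_tendstoD) auto
  have "((\<lambda>\<sigma>. x + (c - \<sigma>) *\<^sub>R k) \<longlongrightarrow> x + (c - 0) *\<^sub>R k) (at_right 0)" by (intro tendsto_intros)
  then show "eventually (\<lambda>\<sigma>. x + (c - \<sigma>) *\<^sub>R k \<in> V) (at_right 0)"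
    using open_V assms by (intro topological_tendstoD) auto
qed

lemma eventually_small: "0 < e \<Longrightarrow> eventually (\<lambda>\<sigma>. b * (2 * \<sigma>) < e) (at_right (0::real))"
proof -
  assume "0 < e"
  moreover have "((\<lambda>\<sigma>. b * (2 * \<sigma>)) \<longlongrightarrow> b * (2 * 0)) (at_right 0)" by (intro tendsto_intros)
  ultimately show ?thesis by (intro order_tendstoD(2)) auto
qed

text \<open>Enlarging the interval slightly absorbs a change of the base point, since the shifted endpoints dominate the old
ones in the cone order. Openness is the reason why the exceptional sets built from these sets are Borel.\<close>

lemma open_steep:
  assumes k: "k \<in> P"
  shows "open (steep b k \<eta>)"
proof (subst open_subopen, rule ballI)
  fix x assume "x \<in> steep b k \<eta>"
  then obtain c d where x: "x \<in> V" and cd: "c < 0" "0 < d" "d - c < \<eta>" "x + c *\<^sub>R k \<in> V" "x + d *\<^sub>R k \<in> V"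
     "b * (d - c) < f (x + d *\<^sub>R k) - f (x + c *\<^sub>R k)" by (auto simp: steep_def)
  let ?g = "f (x + d *\<^sub>R k) - f (x + c *\<^sub>R k) - b * (d - c)"
  have "eventually (\<lambda>\<sigma>. 0 < \<sigma> \<and> b * (2 * \<sigma>) < ?g \<and> 1 * (2 * \<sigma>) < \<eta> - (d - c) \<and>
      x + (d + \<sigma>) *\<^sub>R k \<in> V \<and> x + (c - \<sigma>) *\<^sub>R k \<in> V) (at_right 0)"
    using cd by (intro eventually_conj eventually_small eventually_shift_in_V eventually_at_right_less) auto
  from eventually_happens'[OF trivial_limit_at_right_real this]
  obtain \<sigma> where \<sigma>: "0 < \<sigma>" "b * (2 * \<sigma>) < ?g" "2 * \<sigma> < \<eta> - (d - c)"
      "x + (d + \<sigma>) *\<^sub>R k \<in> V" "x + (c - \<sigma>) *\<^sub>R k \<in> V"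
    unfolding mult_1 by blast
  let ?T = "V \<inter> {y. y + (d + \<sigma>) *\<^sub>R k \<in> V} \<inter> {y. y + (c - \<sigma>) *\<^sub>R k \<in> V} \<inter>
      {y. y + (\<sigma> *\<^sub>R k - x) \<in> P} \<inter> {y. (x + \<sigma> *\<^sub>R k) - y \<in> P}"
  have "open ?T" by (intro open_Int open_V open_P open_shift)
  moreover have "x \<in> ?T" using x \<sigma> P_scale[OF k \<sigma>(1)] by simp
  moreover have "?T \<subseteq> steep b k \<eta>"
  proof
    fix y assume y: "y \<in> ?T"
    have "f (x + d *\<^sub>R k) \<le> f (y + (d + \<sigma>) *\<^sub>R k)"
      using y cd by (intro mono) (auto simp: algebra_simps)
    moreover have "f (y + (c - \<sigma>) *\<^sub>R k) \<le> f (x + c *\<^sub>R k)"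
      using y cd by (intro mono) (auto simp: algebra_simps)
    ultimately have "b * ((d + \<sigma>) - (c - \<sigma>)) < f (y + (d + \<sigma>) *\<^sub>R k) - f (y + (c - \<sigma>) *\<^sub>R k)"
      using \<sigma>(2) by (simp add: algebra_simps)
    then show "y \<in> steep b k \<eta>"
      unfolding steep_def using y cd \<sigma> by (intro CollectI conjI exI[of _ "c - \<sigma>"] exI[of _ "d + \<sigma>"]) auto
  qed
  ultimately show "\<exists>T. open T \<and> x \<in> T \<and> T \<subseteq> steep b k \<eta>" by blast
qed

lemma open_flat:
  assumes k: "k \<in> P"
  shows "open (flat a k \<eta>)"
proof (subst open_subopen, rule ballI)
  fix x assume "x \<in> flat a k \<eta>"
  then obtain c d where x: "x \<in> V" and cd: "c < 0" "0 < d" "d - c < \<eta>" "x + c *\<^sub>R k \<in> V" "x + d *\<^sub>R k \<in> V"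
     "f (x + d *\<^sub>R k) - f (x + c *\<^sub>R k) < a * (d - c)" by (auto simp: flat_def)
  let ?g = "a * (d - c) - (f (x + d *\<^sub>R k) - f (x + c *\<^sub>R k))"
  have "eventually (\<lambda>\<sigma>. 0 < \<sigma> \<and> a * (2 * \<sigma>) < ?g \<and> 1 * (2 * \<sigma>) < d \<and> 1 * (2 * \<sigma>) < - c \<and>
      x + (d - \<sigma>) *\<^sub>R k \<in> V \<and> x + (c + \<sigma>) *\<^sub>R k \<in> V) (at_right 0)"
    using cd by (intro eventually_conj eventually_small eventually_shift_in_V eventually_at_right_less) auto
  from eventually_happens'[OF trivial_limit_at_right_real this]
  obtain \<sigma> where \<sigma>: "0 < \<sigma>" "a * (2 * \<sigma>) < ?g" "2 * \<sigma> < d" "2 * \<sigma> < - c"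
      "x + (d - \<sigma>) *\<^sub>R k \<in> V" "x + (c + \<sigma>) *\<^sub>R k \<in> V"
    unfolding mult_1 by blast
  let ?T = "V \<inter> {y. y + (d - \<sigma>) *\<^sub>R k \<in> V} \<inter> {y. y + (c + \<sigma>) *\<^sub>R k \<in> V} \<inter>
      {y. y + (\<sigma> *\<^sub>R k - x) \<in> P} \<inter> {y. (x + \<sigma> *\<^sub>R k) - y \<in> P}"
  have "open ?T" by (intro open_Int open_V open_P open_shift)
  moreover have "x \<in> ?T" using x \<sigma> P_scale[OF k \<sigma>(1)] by simp
  moreover have "?T \<subseteq> flat a k \<eta>"
  proof
    fix y assume y: "y \<in> ?T"
    have "f (y + (d - \<sigma>) *\<^sub>R k) \<le> f (x + d *\<^sub>R k)"
      using y cd by (intro mono) (auto simp: algebra_simps)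
    moreover have "f (x + c *\<^sub>R k) \<le> f (y + (c + \<sigma>) *\<^sub>R k)"
      using y cd by (intro mono) (auto simp: algebra_simps)
    ultimately have "f (y + (d - \<sigma>) *\<^sub>R k) - f (y + (c + \<sigma>) *\<^sub>R k) < a * ((d - \<sigma>) - (c + \<sigma>))"
      using \<sigma>(2) by (simp add: algebra_simps)
    then show "y \<in> flat a k \<eta>"
      unfolding flat_def using y cd \<sigma> by (intro CollectI conjI exI[of _ "c + \<sigma>"] exI[of _ "d - \<sigma>"]) auto
  qed
  ultimately show "\<exists>T. open T \<and> x \<in> T \<and> T \<subseteq> flat a k \<eta>" by blast
qed

lemma mono_along:
  assumes "k \<in> P" "\<And>s. \<bar>s\<bar> \<le> r \<Longrightarrow> x + s *\<^sub>R k \<in> V"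
  shows "mono_on {- r..r} (\<lambda>s. f (x + s *\<^sub>R k))"
proof (rule mono_onI)
  fix s t assume st: "s \<in> {- r..r}" "t \<in> {- r..r}" "s \<le> t"
  show "f (x + s *\<^sub>R k) \<le> f (x + t *\<^sub>R k)"
  proof (cases "s = t")
    case False
    then have "(t - s) *\<^sub>R k \<in> P" using st by (intro P_scale assms) auto
    moreover have "(x + t *\<^sub>R k) - (x + s *\<^sub>R k) = (t - s) *\<^sub>R k" by (simp add: algebra_simps)
    ultimately show ?thesis using st by (intro mono assms(2)) auto
  qed simp
qed

lemma segment_in_V:
  assumes "x \<in> V"
  obtains r where "0 < r" "\<And>s. \<bar>s\<bar> \<le> r \<Longrightarrow> x + s *\<^sub>R k \<in> V"
proof -
  obtain r where r: "0 < r" "\<And>h. norm h < r \<Longrightarrow> x + h \<in> V" by (rule V_ball[OF assms]) blast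
  have p: "0 < norm k + 1" by (simp add: add_nonneg_pos)
  show ?thesis
  proof (rule that[of "r / (2 * (norm k + 1))"])
    show "0 < r / (2 * (norm k + 1))" using r p by simp
    fix s assume "\<bar>s\<bar> \<le> r / (2 * (norm k + 1))"
    then have "\<bar>s\<bar> * norm k \<le> r / (2 * (norm k + 1)) * (norm k + 1)" using r p by (intro mult_mono) auto
    also have "\<dots> = r / 2"
    proof -
      have "r / (2 * z) * z = r / 2" if "0 < z" for z :: real using that by simp
      from this[OF p] show ?thesis .
    qed
    finally show "x + s *\<^sub>R k \<in> V" using r by (intro r(2)) simp
  qed
qed

definition non_Lipschitz :: "'a \<Rightarrow> 'a set" where
  "non_Lipschitz e = (\<Inter>m::nat. \<Inter>j::nat. steep (real m) e (1 / real (Suc j)))"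

definition oscillating :: "'a \<Rightarrow> real \<Rightarrow> real \<Rightarrow> 'a set" where
  "oscillating k a b = (\<Inter>j::nat. steep b k (1 / real (Suc j)) \<inter> flat a k (1 / real (Suc j)))"

lemma steepD:
  assumes "x + t *\<^sub>R k \<in> steep b k \<eta>"
  obtains c d where "c < t" "t < d" "d - c < \<eta>" "b * (d - c) < f (x + d *\<^sub>R k) - f (x + c *\<^sub>R k)"
proof -
  obtain c d where cd: "c < 0" "0 < d" "d - c < \<eta>"
      "b * (d - c) < f (x + t *\<^sub>R k + d *\<^sub>R k) - f (x + t *\<^sub>R k + c *\<^sub>R k)"
    using assms unfolding steep_def by blast
  then show ?thesis by (intro that[of "t + c" "t + d"]) (auto simp: algebra_simps)
qed

lemma flatD:
  assumes "x + t *\<^sub>R k \<in> flat a k \<eta>"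
  obtains c d where "c < t" "t < d" "d - c < \<eta>" "f (x + d *\<^sub>R k) - f (x + c *\<^sub>R k) < a * (d - c)"
proof -
  obtain c d where cd: "c < 0" "0 < d" "d - c < \<eta>"
      "f (x + t *\<^sub>R k + d *\<^sub>R k) - f (x + t *\<^sub>R k + c *\<^sub>R k) < a * (d - c)"
    using assms unfolding flat_def by blast
  then show ?thesis by (intro that[of "t + c" "t + d"]) (auto simp: algebra_simps)
qed

lemma non_Lipschitz_avoidable:
  assumes e: "e \<in> P"
  shows "avoidable (non_Lipschitz e)"
proof (rule avoidable_line_local[of _ e])
  show "non_Lipschitz e \<in> sets borel"
    unfolding non_Lipschitz_def using open_steep[OF e] by (intro sets.countable_INT'') auto
  fix x assume "x \<in> non_Lipschitz e"
  then have x: "x \<in> V" by (auto simp: non_Lipschitz_def steep_def)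
  obtain r where r: "0 < r" "\<And>s. \<bar>s\<bar> \<le> r \<Longrightarrow> x + s *\<^sub>R e \<in> V"
    by (rule segment_in_V[OF x]) blast
  have "negligible T" if T: "T \<in> lmeasurable" "T \<subseteq> {- r<..<r}" "\<forall>t\<in>T. x + t *\<^sub>R e \<in> non_Lipschitz e" for T
  proof (rule negligible_mono_infinite_slope[OF T(1,2) mono_along[OF e r(2)]])
    fix t b \<eta> :: real assume t: "t \<in> T" "0 < \<eta>"
    obtain m :: nat where m: "b \<le> real m" using real_arch_simple by blast
    obtain j where j: "1 / real (Suc j) < \<eta>" using nat_approx_posE[OF t(2)] by blast
    have "x + t *\<^sub>R e \<in> steep (real m) e (1 / real (Suc j))"
      using T(3) t(1) unfolding non_Lipschitz_def by blast
    then obtain c d where cd: "c < t" "t < d" "d - c < 1 / real (Suc j)" "real m * (d - c) < f (x + d *\<^sub>R e) - f (x + c *\<^sub>R e)"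
      by (rule steepD)
    have "b * (d - c) \<le> real m * (d - c)" using m cd by (intro mult_right_mono) auto
    then have "b * (d - c) < f (x + d *\<^sub>R e) - f (x + c *\<^sub>R e)" using cd(4) by linarith
    then show "\<exists>c d. c < t \<and> t < d \<and> d - c < \<eta> \<and> b * (d - c) < f (x + d *\<^sub>R e) - f (x + c *\<^sub>R e)"
      using cd j by (intro exI[of _ c] exI[of _ d]) auto
  qed
  then show "\<exists>r>0. \<forall>T. T \<in> lmeasurable \<longrightarrow> T \<subseteq> {- r<..<r} \<longrightarrow> (\<forall>t\<in>T. x + t *\<^sub>R e \<in> non_Lipschitz e) \<longrightarrow> negligible T"
    using r(1) by blast
qed

lemma oscillating_avoidable:
  assumes k: "k \<in> P" and ab: "a < b"
  shows "avoidable (oscillating k a b)"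
proof (rule avoidable_line_local[of _ k])
  show "oscillating k a b \<in> sets borel"
    unfolding oscillating_def using open_steep[OF k] open_flat[OF k] by (intro sets.countable_INT'') auto
  fix x assume "x \<in> oscillating k a b"
  then have x: "x \<in> V" by (auto simp: oscillating_def steep_def)
  obtain r where r: "0 < r" "\<And>s. \<bar>s\<bar> \<le> r \<Longrightarrow> x + s *\<^sub>R k \<in> V"
    by (rule segment_in_V[OF x]) blast
  have "negligible T" if T: "T \<in> lmeasurable" "T \<subseteq> {- r<..<r}" "\<forall>t\<in>T. x + t *\<^sub>R k \<in> oscillating k a b" for T
  proof (rule negligible_mono_oscillating_slope[OF T(1,2) mono_along[OF k r(2)] ab])
    fix t \<eta> :: real assume t: "t \<in> T" "0 < \<eta>"
    obtain j where j: "1 / real (Suc j) < \<eta>" using nat_approx_posE[OF t(2)] by blast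
    have "x + t *\<^sub>R k \<in> steep b k (1 / real (Suc j))" "x + t *\<^sub>R k \<in> flat a k (1 / real (Suc j))"
      using T(3) t(1) unfolding oscillating_def by blast+
    then show "\<exists>c d. c < t \<and> t < d \<and> d - c < \<eta> \<and> b * (d - c) < f (x + d *\<^sub>R k) - f (x + c *\<^sub>R k)"
        "\<exists>c d. c < t \<and> t < d \<and> d - c < \<eta> \<and> f (x + d *\<^sub>R k) - f (x + c *\<^sub>R k) < a * (d - c)"
      using j by (meson steepD flatD less_trans)+
  qed
  then show "\<exists>r>0. \<forall>T. T \<in> lmeasurable \<longrightarrow> T \<subseteq> {- r<..<r} \<longrightarrow> (\<forall>t\<in>T. x + t *\<^sub>R k \<in> oscillating k a b) \<longrightarrow> negligible T"
    using r(1) by blast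
qed

text \<open>A vector \<open>h\<close> lies between \<open>- s e\<close> and \<open>s e\<close> in the cone order for \<open>s\<close> proportional to its norm, so increments of \<open>f\<close> in
all directions are controlled by those along \<open>e\<close>.\<close>

lemma pointwise_Lipschitz:
  assumes x: "x \<in> V" and e: "e \<in> P" and nL: "x \<notin> non_Lipschitz e"
  obtains B \<delta> where "0 \<le> B" "0 < \<delta>" "\<And>h. norm h < \<delta> \<Longrightarrow> \<bar>f (x + h) - f x\<bar> \<le> B * norm h"
proof -
  obtain m j :: nat where mj: "x \<notin> steep (real m) e (1 / real (Suc j))"
    using nL unfolding non_Lipschitz_def by blast
  obtain r where r: "0 < r" "\<And>h. norm h < r \<Longrightarrow> x + h \<in> V" by (rule V_ball[OF x]) blast
  obtain \<rho> where \<rho>: "0 < \<rho>" "\<And>t h. 0 < t \<Longrightarrow> norm h < t * \<rho> \<Longrightarrow> t *\<^sub>R e + h \<in> P" by (rule P_ball[OF e]) blast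
  have p: "0 < norm e + 1" by (simp add: add_nonneg_pos)
  define s0 where "s0 = min (r / (norm e + 1)) (1 / (2 * real (Suc j)))"
  have s0: "0 < s0" using r p by (simp add: s0_def)
  have bound: "\<bar>f (x + h) - f x\<bar> \<le> 4 * real m / \<rho> * norm h" if h: "norm h < min r (s0 * \<rho> / 2)" for h
  proof (cases "h = 0")
    case False
    define s where "s = 2 * norm h / \<rho>"
    have s: "0 < s" "s < s0" using False h \<rho>(1) by (auto simp: s_def field_simps)
    have sh: "norm h < s * \<rho>" using False \<rho>(1) by (simp add: s_def)
    have sr: "s * norm e < r"
    proof -
      have "s * norm e \<le> s * (norm e + 1)" using s by simp
      also have "\<dots> < r / (norm e + 1) * (norm e + 1)" using s p by (intro mult_strict_right_mono) (auto simp: s0_def)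
      also have "\<dots> = r" using p by simp
      finally show ?thesis .
    qed
    have V: "x + h \<in> V" "x + s *\<^sub>R e \<in> V" "x + (- s) *\<^sub>R e \<in> V"
      using h sr s by (auto intro!: r(2) simp del: scaleR_minus_left)
    have P: "s *\<^sub>R e + h \<in> P" "s *\<^sub>R e + (- h) \<in> P" "s *\<^sub>R e \<in> P"
      using \<rho>(2)[OF s(1), of h] \<rho>(2)[OF s(1), of "- h"] sh P_scale[OF e s(1)] by auto
    have "f (x + (- s) *\<^sub>R e) \<le> f (x + h)" "f (x + h) \<le> f (x + s *\<^sub>R e)"
      using P V by (auto intro!: mono simp: algebra_simps)
    moreover have "f (x + (- s) *\<^sub>R e) \<le> f x" "f x \<le> f (x + s *\<^sub>R e)"
      using P V x by (auto intro!: mono simp: algebra_simps)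
    moreover have "f (x + s *\<^sub>R e) - f (x + (- s) *\<^sub>R e) \<le> real m * (s - (- s))"
    proof (rule ccontr)
      assume n: "\<not> ?thesis"
      have "x \<in> steep (real m) e (1 / real (Suc j))"
        unfolding steep_def
      proof (rule CollectI, rule conjI[OF x], rule exI[of _ "- s"], rule exI[of _ s], intro conjI)
        have "s < 1 / (2 * real (Suc j))" using s by (simp add: s0_def)
        then have "2 * s < 2 * (1 / (2 * real (Suc j)))" by simp
        moreover have "2 * (1 / (2 * z)) = 1 / z" for z :: real by simp
        ultimately have "2 * s < 1 / real (Suc j)" by metis
        then show "s - (- s) < 1 / real (Suc j)" by simp
      qed (use n x V s in auto)
      then show False using mj by blast
    qed
    ultimately have "\<bar>f (x + h) - f x\<bar> \<le> real m * (s - (- s))" by (auto simp: abs_le_iff)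
    also have "\<dots> = 4 * real m / \<rho> * norm h" by (simp add: s_def)
    finally show ?thesis .
  qed simp
  show ?thesis
    by (rule that[of "4 * real m / \<rho>" "min r (s0 * \<rho> / 2)", OF _ _ bound]) (use r(1) s0 \<rho>(1) in auto)
qed

text \<open>The Lipschitz bound provides bounded quotients and continuity along the line; the absence of oscillation between any
two rationals then forces convergence.\<close>

lemma derivative_along_cone:
  assumes x: "x \<in> V" and k: "k \<in> P"
    and lip: "0 < \<delta>" "\<And>h. norm h < \<delta> \<Longrightarrow> \<bar>f (x + h) - f x\<bar> \<le> B * norm h"
    and osc: "\<And>a b. a \<in> \<rat> \<Longrightarrow> b \<in> \<rat> \<Longrightarrow> a < b \<Longrightarrow> x \<notin> oscillating k a b"
  obtains p where "dir_deriv f x k p"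
proof -
  let ?q = "\<lambda>t. (f (x + t *\<^sub>R k) - f x) / t"
  obtain r where r: "0 < r" "\<And>s. \<bar>s\<bar> \<le> r \<Longrightarrow> x + s *\<^sub>R k \<in> V" by (rule segment_in_V[OF x]) blast
  have p: "0 < norm k + 1" by (simp add: add_nonneg_pos)
  have within: "norm (t *\<^sub>R k) < \<delta>" if "\<bar>t\<bar> < \<delta> / (norm k + 1)" for t
  proof -
    have "norm (t *\<^sub>R k) \<le> \<bar>t\<bar> * (norm k + 1)" by (simp add: mult_left_mono)
    also have "\<dots> < \<delta>" using that p by (simp add: pos_less_divide_eq)
    finally show ?thesis .
  qed
  have ev0: "eventually (\<lambda>t::real. t \<noteq> 0 \<and> \<bar>t\<bar> < \<delta> / (norm k + 1)) (at 0)"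
    unfolding eventually_at using lip(1) p by (intro exI[of _ "\<delta> / (norm k + 1)"]) (auto simp: dist_real_def)
  have qb: "eventually (\<lambda>t. \<bar>?q t\<bar> \<le> B * norm k) (at 0)"
    using ev0
  proof eventually_elim
    case (elim t)
    have "\<bar>f (x + t *\<^sub>R k) - f x\<bar> \<le> B * (\<bar>t\<bar> * norm k)" using lip(2)[OF within] elim by simp
    then show ?case using elim by (simp add: abs_divide divide_le_eq mult.commute mult.left_commute)
  qed
  have cont: "((\<lambda>t. f (x + t *\<^sub>R k)) \<longlongrightarrow> f (x + 0 *\<^sub>R k)) (at 0)"
  proof -
    have "((\<lambda>t. B * norm (t *\<^sub>R k)) \<longlongrightarrow> B * norm (0 *\<^sub>R k)) (at 0)" by (intro tendsto_intros)
    then have "((\<lambda>t. B * norm (t *\<^sub>R k)) \<longlongrightarrow> 0) (at 0)" by simp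
    moreover have "eventually (\<lambda>t. norm (f (x + t *\<^sub>R k) - f x) \<le> B * norm (t *\<^sub>R k)) (at 0)"
      using ev0 by eventually_elim (use lip(2)[OF within] in simp)
    ultimately have "((\<lambda>t. f (x + t *\<^sub>R k) - f x) \<longlongrightarrow> 0) (at 0)" by (rule Lim_null_comparison[rotated])
    then show ?thesis by (simp add: LIM_zero_iff)
  qed
  have "\<exists>p. (?q \<longlongrightarrow> p) (at 0)"
  proof (rule convergent_if_no_gap[OF at_neq_bot qb])
    fix a b :: real assume ab: "a \<in> \<rat>" "b \<in> \<rat>" "a < b"
    obtain j where j: "x \<notin> steep b k (1 / real (Suc j)) \<or> x \<notin> flat a k (1 / real (Suc j))"
      using osc[OF ab] unfolding oscillating_def by blast
    define \<eta> where "\<eta> = min (1 / real (Suc j)) r"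
    have \<eta>: "0 < \<eta>" using r by (simp add: \<eta>_def)
    have V: "x + c *\<^sub>R k \<in> V" "x + d *\<^sub>R k \<in> V" if "c < 0" "0 < d" "d - c < \<eta>" for c d
      using that by (auto intro!: r(2) simp: \<eta>_def)
    show "eventually (\<lambda>t. ?q t \<le> b) (at 0) \<or> eventually (\<lambda>t. a \<le> ?q t) (at 0)"
      using j
    proof
      assume n: "x \<notin> steep b k (1 / real (Suc j))"
      have sl: "f (x + d *\<^sub>R k) - f (x + c *\<^sub>R k) \<le> b * (d - c)" if cd: "c < 0" "0 < d" "d - c < \<eta>" for c d
      proof (rule ccontr)
        assume "\<not> ?thesis"
        then have "x \<in> steep b k (1 / real (Suc j))"
          unfolding steep_def using x cd V[OF cd]
          by (intro CollectI conjI exI[of _ c] exI[of _ d]) (auto simp: \<eta>_def)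
        then show False using n by blast
      qed
      have "eventually (\<lambda>t. (f (x + t *\<^sub>R k) - f (x + 0 *\<^sub>R k)) / t \<le> b) (at 0)"
        by (rule straddling_slope_bound[of "\<lambda>t. f (x + t *\<^sub>R k)", OF cont \<eta> sl])
      then show ?thesis by simp
    next
      assume n: "x \<notin> flat a k (1 / real (Suc j))"
      have sl: "- f (x + d *\<^sub>R k) - - f (x + c *\<^sub>R k) \<le> - a * (d - c)" if cd: "c < 0" "0 < d" "d - c < \<eta>" for c d
      proof (rule ccontr)
        assume c: "\<not> ?thesis"
        have "x \<in> flat a k (1 / real (Suc j))"
          unfolding flat_def using x cd V[OF cd] c
          by (intro CollectI conjI exI[of _ c] exI[of _ d]) (auto simp: \<eta>_def)
        then show False using n by blast
      qed
      have "eventually (\<lambda>t. (- f (x + t *\<^sub>R k) - - f (x + 0 *\<^sub>R k)) / t \<le> - a) (at 0)"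
        by (rule straddling_slope_bound[of "\<lambda>t. - f (x + t *\<^sub>R k)", OF tendsto_minus[OF cont] \<eta> sl])
      then have "eventually (\<lambda>t. a \<le> ?q t) (at 0)"
        by eventually_elim (simp add: minus_divide_left[symmetric] diff_divide_distrib)
      then show ?thesis by simp
    qed
  qed blast
  then show ?thesis using that unfolding dir_deriv_def by blast
qed

text \<open>Points with approximate derivatives \<open>\<alpha>\<close> along \<open>u\<close> and \<open>\<beta>\<close> along \<open>w\<close>, uniformly on the scale \<open>\<delta>\<close>.\<close>

definition good_set :: "'a \<Rightarrow> 'a \<Rightarrow> real \<Rightarrow> real \<Rightarrow> real \<Rightarrow> real \<Rightarrow> 'a set" where
  "good_set u w \<alpha> \<beta> \<epsilon> \<delta> = {y. \<forall>t. \<bar>t\<bar> < \<delta> \<longrightarrow>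
     \<bar>f (y + t *\<^sub>R u) - f y - t * \<alpha>\<bar> \<le> \<epsilon> * \<bar>t\<bar> \<and> \<bar>f (y + t *\<^sub>R w) - f y - t * \<beta>\<bar> \<le> \<epsilon> * \<bar>t\<bar>}"

text \<open>To reach \<open>x + t (w - u)\<close> from \<open>x\<close>, first go to about \<open>x - t u\<close>, then along \<open>t w\<close>. The second step needs a good base point.
If the good set is not porous at \<open>x\<close>, it contains a point \<open>y\<close> that lies in the cone order between \<open>x - t u\<close> and
\<open>x - t u + 2 \<theta> |t| u\<close>, and one on the other side of \<open>x - t u\<close>. Monotonicity transfers the estimates at these points to
upper and lower bounds for \<open>f\<close> at \<open>x + t (w - u)\<close>.\<close>

lemma good_set_nonporous:
  assumes x: "x \<in> V" "x \<in> good_set u w \<alpha> \<beta> \<epsilon> \<delta>" and u: "u \<in> P" and pos: "0 < \<epsilon>" "0 < \<delta>"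
    and np: "\<And>n::nat. x \<notin> porous_in (good_set u w \<alpha> \<beta> \<epsilon> \<delta>) u (1 / real (Suc n))"
  shows "eventually (\<lambda>t. \<bar>(f (x + t *\<^sub>R (w - u)) - f x) / t - (\<beta> - \<alpha>)\<bar> \<le> 4 * \<epsilon>) (at 0)"
proof -
  let ?A = "good_set u w \<alpha> \<beta> \<epsilon> \<delta>"
  obtain \<rho> where \<rho>: "0 < \<rho>" "\<And>t h. 0 < t \<Longrightarrow> norm h < t * \<rho> \<Longrightarrow> t *\<^sub>R u + h \<in> P" by (rule P_ball[OF u]) blast
  obtain r where r: "0 < r" "\<And>h. norm h < r \<Longrightarrow> x + h \<in> V" by (rule V_ball[OF x(1)]) blast
  \<comment> \<open>The constant \<open>\<theta>\<close> is so small that moving by \<open>2 \<theta> |t| u\<close> costs at most \<open>\<epsilon> |t|\<close> in the linear term.\<close>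
  define \<theta> where "\<theta> = min (1/2) (\<epsilon> / (2 * (\<bar>\<alpha>\<bar> + 1)))"
  have \<theta>: "0 < \<theta>" "\<theta> \<le> 1/2" "2 * \<theta> * \<bar>\<alpha>\<bar> \<le> \<epsilon>"
  proof -
    have p: "0 < \<bar>\<alpha>\<bar> + 1" by simp
    show "0 < \<theta>" using pos p by (simp add: \<theta>_def)
    show "\<theta> \<le> 1/2" unfolding \<theta>_def by (rule min.cobounded1)
    have "2 * \<theta> * \<bar>\<alpha>\<bar> \<le> 2 * \<theta> * (\<bar>\<alpha>\<bar> + 1)" using \<open>0 < \<theta>\<close> by simp
    also have "\<dots> \<le> 2 * (\<epsilon> / (2 * (\<bar>\<alpha>\<bar> + 1))) * (\<bar>\<alpha>\<bar> + 1)"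
      using p by (intro mult_right_mono) (auto simp: \<theta>_def)
    also have "\<dots> = \<epsilon>"
    proof -
      have "2 * (e / (2 * s)) * s = e" if "0 < s" for e s :: real using that by simp
      from this[OF p] show ?thesis .
    qed
    finally show "2 * \<theta> * \<bar>\<alpha>\<bar> \<le> \<epsilon>" .
  qed
  obtain n where n: "1 / real (Suc n) < \<theta> * \<rho> / 4" using nat_approx_posE[of "\<theta> * \<rho> / 4"] \<theta> \<rho> by auto
  define c where "c = 1 / real (Suc n)"
  have c: "0 < c" "4 * c < \<theta> * \<rho>" using n by (auto simp: c_def)
  obtain \<eta> where \<eta>: "0 < \<eta>" "\<And>\<tau>. 0 < \<bar>\<tau>\<bar> \<Longrightarrow> \<bar>\<tau>\<bar> < \<eta> \<Longrightarrow> \<exists>y\<in>?A. dist (x + \<tau> *\<^sub>R u) y < 2 * c * \<bar>\<tau>\<bar>"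
    by (rule not_porous_inD[OF x(2) np[of n], folded c_def, OF c(1)]) blast
  define M where "M = 2 * norm u + 4 * c + norm w + 1"
  have M: "1 \<le> M" using c norm_ge_zero[of u] norm_ge_zero[of w] unfolding M_def by linarith
  define t0 where "t0 = min (min (\<eta> / 2) (\<delta> / 2)) (r / M)"
  have t0: "0 < t0" using \<eta> pos r M by (simp add: t0_def)
  have near: "\<exists>y\<in>?A. norm (y - (x + \<tau> *\<^sub>R u)) < 4 * c * \<bar>t\<bar>"
    if t\<tau>: "0 < \<bar>t\<bar>" "\<bar>t\<bar> < t0" "\<bar>\<tau>\<bar> \<le> 2 * \<bar>t\<bar>" "\<tau> \<noteq> 0" for t \<tau>
  proof -
    have "\<bar>\<tau>\<bar> < \<eta>" using t\<tau> by (simp add: t0_def)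
    then obtain y where y: "y \<in> ?A" "dist (x + \<tau> *\<^sub>R u) y < 2 * c * \<bar>\<tau>\<bar>" using \<eta>(2)[of \<tau>] t\<tau>(4) by auto
    have "2 * c * \<bar>\<tau>\<bar> \<le> 2 * c * (2 * \<bar>t\<bar>)" using t\<tau> c by (intro mult_left_mono) auto
    then have "norm (y - (x + \<tau> *\<^sub>R u)) < 4 * c * \<bar>t\<bar>" using y(2) by (simp add: dist_norm norm_minus_commute)
    then show ?thesis using y(1) by blast
  qed
  have inV: "x + h \<in> V" if "\<bar>t\<bar> < t0" "norm h \<le> \<bar>t\<bar> * (2 * norm u + 4 * c + norm w)" for h t
  proof (rule r(2))
    have "norm h \<le> \<bar>t\<bar> * (2 * norm u + 4 * c + norm w)" by (rule that)
    also have "\<dots> \<le> \<bar>t\<bar> * M" by (intro mult_left_mono) (auto simp: M_def)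
    also have "\<dots> < r" using that(1) M by (simp add: t0_def pos_less_divide_eq)
    finally show "norm h < r" .
  qed
  have key: "\<bar>f (x + t *\<^sub>R (w - u)) - f x - t * (\<beta> - \<alpha>)\<bar> \<le> 4 * \<epsilon> * \<bar>t\<bar>" if t: "t \<noteq> 0" "\<bar>t\<bar> < t0" for t
  proof -
    define z where "z = x + t *\<^sub>R (w - u)"
    have td: "\<bar>t\<bar> < \<delta>" "2 * \<bar>t\<bar> < \<delta>" using t(2) pos by (auto simp: t0_def)
    have \<theta>t: "0 < \<theta> * \<bar>t\<bar>" "\<theta> * \<bar>t\<bar> \<le> \<bar>t\<bar> / 2"
      using \<theta> t mult_right_mono[OF \<theta>(2), of "\<bar>t\<bar>"] by auto
    have ct: "4 * c * \<bar>t\<bar> < \<theta> * \<bar>t\<bar> * \<rho>" using c(2) t(1) by (simp add: mult.commute mult.left_commute)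
    have two: "(2 * s) *\<^sub>R u = s *\<^sub>R u + s *\<^sub>R u" for s :: real by (simp add: scaleR_left_distrib[symmetric])
    have Vz: "z \<in> V"
      unfolding z_def
    proof (rule inV[OF t(2)])
      have "norm (t *\<^sub>R (w - u)) \<le> \<bar>t\<bar> * (norm w + norm u)" by (simp add: mult_left_mono norm_triangle_ineq4)
      also have "\<dots> \<le> \<bar>t\<bar> * (2 * norm u + 4 * c + norm w)" using c by (intro mult_left_mono) auto
      finally show "norm (t *\<^sub>R (w - u)) \<le> \<bar>t\<bar> * (2 * norm u + 4 * c + norm w)" .
    qed
    have Vu: "x + s *\<^sub>R u \<in> V" if "\<bar>s\<bar> \<le> 2 * \<bar>t\<bar>" for s
    proof (rule inV[OF t(2)])
      have "norm (s *\<^sub>R u) \<le> (2 * \<bar>t\<bar>) * norm u" using that by (simp add: mult_right_mono)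
      also have "\<dots> \<le> \<bar>t\<bar> * (2 * norm u + 4 * c + norm w)" using c by (simp add: algebra_simps)
      finally show "norm (s *\<^sub>R u) \<le> \<bar>t\<bar> * (2 * norm u + 4 * c + norm w)" .
    qed
    have Vy: "y \<in> V" "y + t *\<^sub>R w \<in> V" if "\<bar>\<tau>\<bar> \<le> 2 * \<bar>t\<bar>" "norm (y - (x + \<tau> *\<^sub>R u)) < 4 * c * \<bar>t\<bar>" for y \<tau>
    proof -
      have "norm (y - x) \<le> norm (\<tau> *\<^sub>R u) + norm (y - (x + \<tau> *\<^sub>R u))"
        using norm_triangle_ineq[of "\<tau> *\<^sub>R u" "y - (x + \<tau> *\<^sub>R u)"] by simp
      moreover have "norm (\<tau> *\<^sub>R u) \<le> (2 * \<bar>t\<bar>) * norm u" using that(1) by (simp add: mult_right_mono)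
      ultimately have yx: "norm (y - x) \<le> \<bar>t\<bar> * (2 * norm u + 4 * c)" using that(2) by (simp add: algebra_simps)
      have "norm (y - x) \<le> \<bar>t\<bar> * (2 * norm u + 4 * c + norm w)"
        using yx by (rule order_trans) (simp add: mult_left_mono)
      from inV[OF t(2) this] show "y \<in> V" by simp
      have "norm (y - x + t *\<^sub>R w) \<le> \<bar>t\<bar> * (2 * norm u + 4 * c + norm w)"
        using norm_triangle_ineq[of "y - x" "t *\<^sub>R w"] yx by (simp add: algebra_simps)
      from inV[OF t(2) this] show "y + t *\<^sub>R w \<in> V" by (simp add: algebra_simps)
    qed
    have fu: "\<bar>f (x + s *\<^sub>R u) - f x - s * \<alpha>\<bar> \<le> 2 * \<epsilon> * \<bar>t\<bar>" if "\<bar>s\<bar> \<le> 2 * \<bar>t\<bar>" for s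
    proof -
      have "\<bar>f (x + s *\<^sub>R u) - f x - s * \<alpha>\<bar> \<le> \<epsilon> * \<bar>s\<bar>"
        using x(2) that td unfolding good_set_def by auto
      also have "\<dots> \<le> \<epsilon> * (2 * \<bar>t\<bar>)" using that pos by (intro mult_left_mono) auto
      finally show ?thesis by simp
    qed
    have fw: "\<bar>f (y + t *\<^sub>R w) - f y - t * \<beta>\<bar> \<le> \<epsilon> * \<bar>t\<bar>" if "y \<in> ?A" for y
      using that td unfolding good_set_def by auto
    have \<alpha>t: "\<bar>2 * (\<theta> * \<bar>t\<bar>) * \<alpha>\<bar> \<le> \<epsilon> * \<bar>t\<bar>"
    proof -
      have "\<bar>2 * (\<theta> * \<bar>t\<bar>) * \<alpha>\<bar> = (2 * \<theta> * \<bar>\<alpha>\<bar>) * \<bar>t\<bar>" using \<theta>(1) by (simp add: abs_mult)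
      also have "\<dots> \<le> \<epsilon> * \<bar>t\<bar>" using \<theta>(3) by (intro mult_right_mono) auto
      finally show ?thesis .
    qed
    have upper: "f z \<le> f x + t * (\<beta> - \<alpha>) + 4 * \<epsilon> * \<bar>t\<bar>"
    proof -
      let ?\<tau> = "- t + \<theta> * \<bar>t\<bar>"
      have \<tau>: "\<bar>?\<tau>\<bar> \<le> 2 * \<bar>t\<bar>" "?\<tau> \<noteq> 0" "\<bar>- t + 2 * (\<theta> * \<bar>t\<bar>)\<bar> \<le> 2 * \<bar>t\<bar>" using \<theta>t t(1) by linarith+
      obtain y where y: "y \<in> ?A" "norm (y - (x + ?\<tau> *\<^sub>R u)) < 4 * c * \<bar>t\<bar>"
        using near[of t ?\<tau>] t \<tau> by auto
      define h where "h = y - (x + ?\<tau> *\<^sub>R u)"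
      have h: "norm h < \<theta> * \<bar>t\<bar> * \<rho>" "norm (- h) < \<theta> * \<bar>t\<bar> * \<rho>"
        using y(2) ct unfolding norm_minus_cancel h_def[symmetric] by linarith+
      have "(\<theta> * \<bar>t\<bar>) *\<^sub>R u + h \<in> P" by (rule \<rho>(2)[OF \<theta>t(1) h(1)])
      also have "(\<theta> * \<bar>t\<bar>) *\<^sub>R u + h = (y + t *\<^sub>R w) - z" by (simp add: h_def z_def algebra_simps)
      finally have "f z \<le> f (y + t *\<^sub>R w)" using Vz Vy[OF \<tau>(1) y(2)] by (intro mono) auto
      also have "\<dots> \<le> f y + t * \<beta> + \<epsilon> * \<bar>t\<bar>" using fw[OF y(1)] by linarith
      also have "f y \<le> f (x + (- t + 2 * (\<theta> * \<bar>t\<bar>)) *\<^sub>R u)"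
      proof (rule mono[OF Vy(1)[OF \<tau>(1) y(2)] Vu[OF \<tau>(3)]])
        have "(\<theta> * \<bar>t\<bar>) *\<^sub>R u + - h \<in> P" by (rule \<rho>(2)[OF \<theta>t(1) h(2)])
        also have "(\<theta> * \<bar>t\<bar>) *\<^sub>R u + - h = x + (- t + 2 * (\<theta> * \<bar>t\<bar>)) *\<^sub>R u - y"
          by (simp only: h_def scaleR_left_distrib scaleR_left_diff_distrib two) simp
        finally show "x + (- t + 2 * (\<theta> * \<bar>t\<bar>)) *\<^sub>R u - y \<in> P" .
      qed
      also have "\<dots> \<le> f x + (- t + 2 * (\<theta> * \<bar>t\<bar>)) * \<alpha> + 2 * \<epsilon> * \<bar>t\<bar>" using fu[OF \<tau>(3)] by linarith
      also have "(- t + 2 * (\<theta> * \<bar>t\<bar>)) * \<alpha> = - (t * \<alpha>) + 2 * (\<theta> * \<bar>t\<bar>) * \<alpha>" by (simp add: algebra_simps)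
      also have "2 * (\<theta> * \<bar>t\<bar>) * \<alpha> \<le> \<epsilon> * \<bar>t\<bar>" using \<alpha>t by linarith
      finally show ?thesis by (simp add: right_diff_distrib)
    qed
    have lower: "f x + t * (\<beta> - \<alpha>) - 4 * \<epsilon> * \<bar>t\<bar> \<le> f z"
    proof -
      let ?\<tau> = "- t - \<theta> * \<bar>t\<bar>"
      have \<tau>: "\<bar>?\<tau>\<bar> \<le> 2 * \<bar>t\<bar>" "?\<tau> \<noteq> 0" "\<bar>- t - 2 * (\<theta> * \<bar>t\<bar>)\<bar> \<le> 2 * \<bar>t\<bar>" using \<theta>t t(1) by linarith+
      obtain y where y: "y \<in> ?A" "norm (y - (x + ?\<tau> *\<^sub>R u)) < 4 * c * \<bar>t\<bar>"
        using near[of t ?\<tau>] t \<tau> by auto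
      define h where "h = y - (x + ?\<tau> *\<^sub>R u)"
      have h: "norm h < \<theta> * \<bar>t\<bar> * \<rho>" "norm (- h) < \<theta> * \<bar>t\<bar> * \<rho>"
        using y(2) ct unfolding norm_minus_cancel h_def[symmetric] by linarith+
      have "(\<theta> * \<bar>t\<bar>) *\<^sub>R u + - h \<in> P" by (rule \<rho>(2)[OF \<theta>t(1) h(2)])
      also have "(\<theta> * \<bar>t\<bar>) *\<^sub>R u + - h = z - (y + t *\<^sub>R w)" by (simp add: h_def z_def algebra_simps)
      finally have 1: "f (y + t *\<^sub>R w) \<le> f z" using Vz Vy[OF \<tau>(1) y(2)] by (intro mono) auto
      have 2: "f y + t * \<beta> - \<epsilon> * \<bar>t\<bar> \<le> f (y + t *\<^sub>R w)" using fw[OF y(1)] by linarith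
      have 3: "f (x + (- t - 2 * (\<theta> * \<bar>t\<bar>)) *\<^sub>R u) \<le> f y"
      proof (rule mono[OF Vu[OF \<tau>(3)] Vy(1)[OF \<tau>(1) y(2)]])
        have "(\<theta> * \<bar>t\<bar>) *\<^sub>R u + h \<in> P" by (rule \<rho>(2)[OF \<theta>t(1) h(1)])
        also have "(\<theta> * \<bar>t\<bar>) *\<^sub>R u + h = y - (x + (- t - 2 * (\<theta> * \<bar>t\<bar>)) *\<^sub>R u)"
          by (simp only: h_def scaleR_left_distrib scaleR_left_diff_distrib two) simp
        finally show "y - (x + (- t - 2 * (\<theta> * \<bar>t\<bar>)) *\<^sub>R u) \<in> P" .
      qed
      have 4: "f x + (- t - 2 * (\<theta> * \<bar>t\<bar>)) * \<alpha> - 2 * \<epsilon> * \<bar>t\<bar> \<le> f (x + (- t - 2 * (\<theta> * \<bar>t\<bar>)) *\<^sub>R u)"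
        using fu[OF \<tau>(3)] by linarith
      have 5: "(- t - 2 * (\<theta> * \<bar>t\<bar>)) * \<alpha> = - (t * \<alpha>) - 2 * (\<theta> * \<bar>t\<bar>) * \<alpha>" by (simp add: algebra_simps)
      have 6: "2 * (\<theta> * \<bar>t\<bar>) * \<alpha> \<le> \<epsilon> * \<bar>t\<bar>" using \<alpha>t by linarith
      show ?thesis using 1 2 3 4 6 unfolding 5 right_diff_distrib by linarith
    qed
    show ?thesis using upper lower unfolding z_def[symmetric] abs_le_iff by linarith
  qed
  have "\<bar>(f (x + t *\<^sub>R (w - u)) - f x) / t - (\<beta> - \<alpha>)\<bar> \<le> 4 * \<epsilon>" if t: "t \<noteq> 0" "\<bar>t\<bar> < t0" for t
  proof -
    have "(f (x + t *\<^sub>R (w - u)) - f x) / t - (\<beta> - \<alpha>) = (f (x + t *\<^sub>R (w - u)) - f x - t * (\<beta> - \<alpha>)) / t"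
      using t(1) by (simp add: diff_divide_distrib)
    then show ?thesis using key[OF t] t(1) by (simp add: abs_divide divide_le_eq)
  qed
  then show ?thesis
    unfolding eventually_at using t0 by (intro exI[of _ t0]) (auto simp: dist_real_def)
qed

text \<open>Rational approximations of the two derivatives put \<open>x\<close> into one of countably many good sets.\<close>

lemma dir_deriv_diff:
  assumes x: "x \<in> V" and u: "u \<in> P" and p: "dir_deriv f x u p" and q: "dir_deriv f x w q"
    and np: "\<And>\<alpha> \<beta> i j n. \<alpha> \<in> \<rat> \<Longrightarrow> \<beta> \<in> \<rat> \<Longrightarrow>
      x \<notin> porous_in (good_set u w \<alpha> \<beta> (1 / real (Suc i)) (1 / real (Suc j))) u (1 / real (Suc n))"
  shows "dir_deriv f x (w - u) (q - p)"
  unfolding dir_deriv_def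
proof (rule tendstoI)
  fix e :: real assume e: "0 < e"
  obtain i where i: "1 / real (Suc i) < e / 6" using nat_approx_posE[of "e / 6"] e by auto
  define \<epsilon> where "\<epsilon> = 1 / real (Suc i)"
  have \<epsilon>: "0 < \<epsilon>" "6 * \<epsilon> < e" using i by (auto simp: \<epsilon>_def)
  obtain \<alpha> where \<alpha>: "\<alpha> \<in> \<rat>" "p - \<epsilon> / 2 < \<alpha>" "\<alpha> < p" using Rats_dense_in_real[of "p - \<epsilon> / 2" p] \<epsilon> by auto
  obtain \<beta> where \<beta>: "\<beta> \<in> \<rat>" "q - \<epsilon> / 2 < \<beta>" "\<beta> < q" using Rats_dense_in_real[of "q - \<epsilon> / 2" q] \<epsilon> by auto
  have ev: "eventually (\<lambda>t. dist ((f (x + t *\<^sub>R u) - f x) / t) p < \<epsilon> / 2) (at 0)"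
    "eventually (\<lambda>t. dist ((f (x + t *\<^sub>R w) - f x) / t) q < \<epsilon> / 2) (at 0)"
    using tendstoD[OF p[unfolded dir_deriv_def], of "\<epsilon> / 2"] tendstoD[OF q[unfolded dir_deriv_def], of "\<epsilon> / 2"] \<epsilon>
    by (simp_all only: half_gt_zero)
  obtain d where d: "0 < d" "\<And>t. t \<noteq> 0 \<Longrightarrow> \<bar>t\<bar> < d \<Longrightarrow> dist ((f (x + t *\<^sub>R u) - f x) / t) p < \<epsilon> / 2 \<and>
      dist ((f (x + t *\<^sub>R w) - f x) / t) q < \<epsilon> / 2"
    using eventually_conj[OF ev] unfolding eventually_at by (auto simp: dist_real_def)
  obtain j where j: "1 / real (Suc j) < d" using nat_approx_posE[OF d(1)] by blast
  have lin: "\<bar>D - t * a\<bar> \<le> \<epsilon> * \<bar>t\<bar>" if "t \<noteq> 0" "dist (D / t) l < \<epsilon> / 2" "l - \<epsilon> / 2 < a" "a < l" for D t a l :: real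
  proof -
    have "\<bar>D / t - l\<bar> < \<epsilon> / 2" using that(2) by (simp only: dist_real_def)
    then have "\<bar>D / t - a\<bar> \<le> \<epsilon>" using that(3,4) by linarith
    then have "\<bar>D / t - a\<bar> * \<bar>t\<bar> \<le> \<epsilon> * \<bar>t\<bar>" by (rule mult_right_mono) simp
    moreover have "\<bar>D / t - a\<bar> * \<bar>t\<bar> = \<bar>D - t * a\<bar>"
      using that(1) by (simp add: abs_mult[symmetric] algebra_simps)
    ultimately show ?thesis by simp
  qed
  have "x \<in> good_set u w \<alpha> \<beta> \<epsilon> (1 / real (Suc j))"
    unfolding good_set_def
  proof (intro CollectI allI impI)
    fix t :: real assume t: "\<bar>t\<bar> < 1 / real (Suc j)"
    show "\<bar>f (x + t *\<^sub>R u) - f x - t * \<alpha>\<bar> \<le> \<epsilon> * \<bar>t\<bar> \<and> \<bar>f (x + t *\<^sub>R w) - f x - t * \<beta>\<bar> \<le> \<epsilon> * \<bar>t\<bar>"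
    proof (cases "t = 0")
      case False
      have "\<bar>t\<bar> < d" using t j by linarith
      then show ?thesis using lin[OF False] d(2)[OF False] \<alpha> \<beta> by blast
    qed simp
  qed
  then have "eventually (\<lambda>t. \<bar>(f (x + t *\<^sub>R (w - u)) - f x) / t - (\<beta> - \<alpha>)\<bar> \<le> 4 * \<epsilon>) (at 0)"
    by (rule good_set_nonporous[OF x _ u]) (use \<epsilon> np[OF \<alpha>(1) \<beta>(1)] in \<open>auto simp: \<epsilon>_def\<close>)
  then show "eventually (\<lambda>t. dist ((f (x + t *\<^sub>R (w - u)) - f x) / t) (q - p) < e) (at 0)"
    by eventually_elim (use \<alpha> \<beta> \<epsilon> in \<open>auto simp: dist_real_def\<close>)
qed

end

section \<open>Gateaux differentiability of cone-monotone functions\<close>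

lemma countable_dense_subgroup:
  assumes sep: "separable_space (euclidean :: 'a::real_normed_vector topology)"
  obtains D :: "'a::real_normed_vector set" where "countable D" "closure D = UNIV" "\<And>a b. a \<in> D \<Longrightarrow> b \<in> D \<Longrightarrow> a + b \<in> D"
    "\<And>a. a \<in> D \<Longrightarrow> - a \<in> D"
proof -
  obtain D0 :: "'a set" where D0: "countable D0" "closure D0 = UNIV" using separable_countable_dense[OF sep] .
  \<comment> \<open>The group generated by \<open>D0\<close> consists of the sums of finite lists over \<open>S\<close>.\<close>
  define S where "S = D0 \<union> uminus ` D0"
  define D where "D = sum_list ` lists S"
  have S_minus: "- s \<in> S" if "s \<in> S" for s using that by (auto simp: S_def)
  show ?thesis
  proof (rule that[of D])
    show "countable D" unfolding D_def S_def using D0(1) by auto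
    have "D0 \<subseteq> D"
    proof
      fix d assume "d \<in> D0"
      then have "[d] \<in> lists S" by (simp add: S_def)
      then show "d \<in> D" unfolding D_def by (force intro: image_eqI[of _ _ "[d]"])
    qed
    then show "closure D = UNIV" using D0(2) closure_mono by blast
    show "a + b \<in> D" if ab: "a \<in> D" "b \<in> D" for a b
    proof -
      obtain xs ys where xs: "xs \<in> lists S" "a = sum_list xs" "ys \<in> lists S" "b = sum_list ys"
        using ab unfolding D_def by blast
      then have "a + b = sum_list (xs @ ys)" "xs @ ys \<in> lists S" by auto
      then show ?thesis unfolding D_def by blast
    qed
    show "- a \<in> D" if a: "a \<in> D" for a
    proof -
      obtain xs where xs: "xs \<in> lists S" "a = sum_list xs" using a unfolding D_def by blast
      have "- sum_list zs = sum_list (map uminus zs)" for zs :: "'a list" by (induction zs) auto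
      then have "- a = sum_list (map uminus xs)" using xs by simp
      moreover have "map uminus xs \<in> lists S" using xs(1) S_minus by auto
      ultimately show ?thesis unfolding D_def by blast
    qed
  qed
qed

context cone_monotone
begin

text \<open>Each direction \<open>h\<close> lies in the cone order between two members of \<open>D\<close> that are close to it, and hence so do the difference
quotients. The Lipschitz bound makes the derivatives at these two members close to each other.\<close>

lemma Gateaux_of_dense_directions:
  assumes x: "x \<in> V"
    and lip: "0 \<le> B" "0 < \<delta>" "\<And>h. norm h < \<delta> \<Longrightarrow> \<bar>f (x + h) - f x\<bar> \<le> B * norm h"
    and D: "closure D = UNIV" "\<And>a b. a \<in> D \<Longrightarrow> b \<in> D \<Longrightarrow> a + b \<in> D" "\<And>a. a \<in> D \<Longrightarrow> - a \<in> D"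
    and p: "\<And>d. d \<in> D \<Longrightarrow> dir_deriv f x d (p d)"
    and p_add: "\<And>a b. a \<in> D \<Longrightarrow> b \<in> D \<Longrightarrow> p (a + b) = p a + p b"
  shows "\<exists>l :: 'a \<Rightarrow>\<^sub>L real. \<forall>h. dir_deriv f x h (l h)"
proof -
  obtain r where r: "0 < r" "\<And>h. norm h < r \<Longrightarrow> x + h \<in> V" by (rule V_ball[OF x]) blast
  have ev_small: "eventually (\<lambda>t. t \<noteq> 0 \<and> norm (t *\<^sub>R h) < e) (at (0::real))" if "0 < e" for h :: 'a and e
  proof -
    have "((\<lambda>t. norm (t *\<^sub>R h)) \<longlongrightarrow> norm (0 *\<^sub>R h)) (at (0::real))" by (intro tendsto_intros)
    then have "eventually (\<lambda>t. norm (t *\<^sub>R h) < e) (at (0::real))" using that by (intro order_tendstoD(2)) auto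
    moreover have "eventually (\<lambda>t. t \<noteq> 0) (at (0::real))" by (simp add: eventually_at_filter)
    ultimately show ?thesis by eventually_elim simp
  qed
  have bound: "eventually (\<lambda>t. \<bar>(f (x + t *\<^sub>R h) - f x) / t\<bar> \<le> B * norm h) (at 0)" for h
    using ev_small[OF lip(2), of h]
  proof eventually_elim
    case (elim t)
    then have "\<bar>f (x + t *\<^sub>R h) - f x\<bar> \<le> B * (\<bar>t\<bar> * norm h)" using lip(3)[of "t *\<^sub>R h"] by simp
    then show ?case using elim by (simp add: abs_divide divide_le_eq mult.commute mult.left_commute)
  qed
  have dd_bound: "\<bar>q\<bar> \<le> B * norm h" if "dir_deriv f x h q" for h q
    using tendsto_upperbound[OF tendsto_rabs[OF that[unfolded dir_deriv_def]] bound[of h]] by simp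
  have p_minus: "p (- a) = - p a" if "a \<in> D" for a
    using dir_deriv_scale[OF p[OF that], of "- 1"] p[OF D(3)[OF that]] dir_deriv_unique by fastforce
  have p_diff: "\<bar>p a - p b\<bar> \<le> B * norm (a - b)" if "a \<in> D" "b \<in> D" for a b
  proof -
    have "p (a + - b) = p a - p b" using p_add[OF that(1) D(3)[OF that(2)]] p_minus[OF that(2)] by simp
    moreover have "dir_deriv f x (a + - b) (p (a + - b))" by (intro p D that)
    ultimately show ?thesis using dd_bound by fastforce
  qed
  have squeeze: "eventually (\<lambda>t. (f (x + t *\<^sub>R a) - f x) / t \<le> (f (x + t *\<^sub>R b) - f x) / t) (at 0)"
    if ab: "b - a \<in> P" for a b
    using ev_small[OF r(1), of a] ev_small[OF r(1), of b]
  proof eventually_elim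
    case (elim t)
    have V: "x + t *\<^sub>R a \<in> V" "x + t *\<^sub>R b \<in> V" using elim r(2) by auto
    show ?case
    proof (cases "0 < t")
      case True
      have "(x + t *\<^sub>R b) - (x + t *\<^sub>R a) = t *\<^sub>R (b - a)" by (simp add: algebra_simps)
      then have "f (x + t *\<^sub>R a) \<le> f (x + t *\<^sub>R b)" using P_scale[OF ab True] V by (intro mono) auto
      then show ?thesis using True by (intro divide_right_mono) auto
    next
      case False
      then have t: "0 < - t" using elim by simp
      have "(x + t *\<^sub>R a) - (x + t *\<^sub>R b) = (- t) *\<^sub>R (b - a)" by (simp add: algebra_simps)
      then have "f (x + t *\<^sub>R b) \<le> f (x + t *\<^sub>R a)" using P_scale[OF ab t] V by (intro mono) auto
      then show ?thesis using t by (intro divide_right_mono_neg) auto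
    qed
  qed
  have approx: "\<exists>d1\<in>D. \<exists>d2\<in>D. norm (h - d1) < e \<and> norm (h - d2) < e \<and> h - d1 \<in> P \<and> d2 - h \<in> P" if e: "0 < e" for h e
  proof -
    obtain v where v: "v \<in> P" "norm v < e"
    proof -
      obtain u where u: "u \<in> P" using P_nonempty by blast
      have p: "0 < norm u + 1" by (simp add: add_nonneg_pos)
      have "norm ((e / (norm u + 1)) *\<^sub>R u) = e / (norm u + 1) * norm u" using e p by simp
      also have "\<dots> < e / (norm u + 1) * (norm u + 1)" using e p by (intro mult_strict_left_mono) auto
      also have "\<dots> = e" using p by simp
      finally show ?thesis using that P_scale[OF u, of "e / (norm u + 1)"] e p by simp
    qed
    have o: "open ({d. h - d \<in> P} \<inter> ball h e)" "open ({d. d + - h \<in> P} \<inter> ball h e)"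
      by (intro open_Int open_shift open_P open_ball)+
    have ne: "h - v \<in> {d. h - d \<in> P} \<inter> ball h e" "h + v \<in> {d. d + - h \<in> P} \<inter> ball h e"
      using v by (auto simp: dist_norm)
    have "\<exists>d\<in>D. d \<in> U" if "open U" "z \<in> U" for U z
      using that D(1) by (metis UNIV_I closure_iff_nhds_not_empty disjoint_iff subset_refl)
    then obtain d1 d2 where "d1 \<in> D" "d1 \<in> {d. h - d \<in> P} \<inter> ball h e" "d2 \<in> D" "d2 \<in> {d. d + - h \<in> P} \<inter> ball h e"
      using o ne by meson
    moreover from this have "norm (h - d1) < e \<and> norm (h - d2) < e \<and> h - d1 \<in> P \<and> d2 - h \<in> P"
      by (simp add: dist_norm)
    ultimately show ?thesis by blast
  qed
  have "\<exists>l. dir_deriv f x h l" for h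
    unfolding dir_deriv_def
  proof (rule convergent_if_no_gap[OF at_neq_bot bound[of h]])
    fix a b :: real assume ab: "a < b"
    obtain e where e: "0 < e" "B * (2 * e) < b - a"
    proof (rule that[of "(b - a) / (2 * B + 2)"])
      show "0 < (b - a) / (2 * B + 2)" using ab lip(1) by simp
      have "2 * B + 2 > 0" using lip(1) by simp
      have "B * (2 * ((b - a) / (2 * B + 2))) = (2 * B) * ((b - a) / (2 * B + 2))" by simp
      also have "\<dots> < (2 * B + 2) * ((b - a) / (2 * B + 2))"
        using \<open>0 < (b - a) / (2 * B + 2)\<close> by (intro mult_strict_right_mono) auto
      also have "\<dots> = b - a" using \<open>2 * B + 2 > 0\<close> by simp
      finally show "B * (2 * ((b - a) / (2 * B + 2))) < b - a" .
    qed
    obtain d1 d2 where d: "d1 \<in> D" "d2 \<in> D" "norm (h - d1) < e" "norm (h - d2) < e" "h - d1 \<in> P" "d2 - h \<in> P"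
      using approx[OF e(1)] by blast
    have "norm (d2 - d1) \<le> norm (h - d1) + norm (h - d2)"
      using norm_triangle_ineq4[of "h - d1" "h - d2"] by (simp add: norm_minus_commute)
    then have "B * norm (d2 - d1) \<le> B * (2 * e)" using d lip(1) by (intro mult_left_mono) auto
    then have gap: "p d2 - p d1 < b - a" using p_diff[OF d(2,1)] e(2) by linarith
    show "eventually (\<lambda>t. (f (x + t *\<^sub>R h) - f x) / t \<le> b) (at 0) \<or> eventually (\<lambda>t. a \<le> (f (x + t *\<^sub>R h) - f x) / t) (at 0)"
    proof (cases "p d2 < b")
      case True
      then have "eventually (\<lambda>t. (f (x + t *\<^sub>R d2) - f x) / t < b) (at 0)"
        using p[OF d(2)] unfolding dir_deriv_def by (intro order_tendstoD(2))
      then have "eventually (\<lambda>t. (f (x + t *\<^sub>R h) - f x) / t \<le> b) (at 0)"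
        using squeeze[OF d(6)] by eventually_elim linarith
      then show ?thesis ..
    next
      case False
      then have "a < p d1" using gap by linarith
      then have "eventually (\<lambda>t. a < (f (x + t *\<^sub>R d1) - f x) / t) (at 0)"
        using p[OF d(1)] unfolding dir_deriv_def by (intro order_tendstoD(1))
      then have "eventually (\<lambda>t. a \<le> (f (x + t *\<^sub>R h) - f x) / t) (at 0)"
        using squeeze[OF d(5)] by eventually_elim linarith
      then show ?thesis ..
    qed
  qed blast
  then obtain l where l: "\<And>h. dir_deriv f x h (l h)" by metis
  have l_approx: "\<exists>d\<in>D. norm (h - d) < e \<and> \<bar>l h - p d\<bar> \<le> B * (2 * e)" if e: "0 < e" for h e
  proof -
    obtain d1 d2 where d: "d1 \<in> D" "d2 \<in> D" "norm (h - d1) < e" "norm (h - d2) < e" "h - d1 \<in> P" "d2 - h \<in> P"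
      using approx[OF e] by blast
    have "norm (d2 - d1) \<le> norm (h - d1) + norm (h - d2)"
      using norm_triangle_ineq4[of "h - d1" "h - d2"] by (simp add: norm_minus_commute)
    then have "B * norm (d2 - d1) \<le> B * (2 * e)" using d lip(1) by (intro mult_left_mono) auto
    then have gap: "p d2 - p d1 \<le> B * (2 * e)" using p_diff[OF d(2,1)] by linarith
    have "p d1 \<le> l h"
      using tendsto_le[OF at_neq_bot l[of h, unfolded dir_deriv_def] p[OF d(1), unfolded dir_deriv_def] squeeze[OF d(5)]] .
    moreover have "l h \<le> p d2"
      using tendsto_le[OF at_neq_bot p[OF d(2), unfolded dir_deriv_def] l[of h, unfolded dir_deriv_def] squeeze[OF d(6)]] .
    ultimately show ?thesis using gap d by (intro bexI[of _ d1]) auto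
  qed
  have l_add: "l (g + h) = l g + l h" for g h
  proof -
    have "\<bar>l (g + h) - (l g + l h)\<bar> \<le> 0 + e" if e: "0 < e" for e
    proof -
      \<comment> \<open>Three approximations of \<open>l\<close> cost \<open>2 B e'\<close> each, and comparing the approximants costs \<open>3 B e'\<close>.\<close>
      define e' where "e' = e / (9 * B + 9)"
      have e': "0 < e'" "9 * B * e' \<le> e"
      proof -
        show "0 < e'" using e lip(1) by (simp add: e'_def)
        have "9 * B * e' \<le> (9 * B + 9) * e'" using \<open>0 < e'\<close> by (intro mult_right_mono) auto
        also have "\<dots> = e"
        proof -
          have "9 * B + 9 \<noteq> 0" using lip(1) by linarith
          then show ?thesis unfolding e'_def by simp
        qed
        finally show "9 * B * e' \<le> e" .
      qed
      obtain d where d: "d \<in> D" "norm (g - d) < e'" "\<bar>l g - p d\<bar> \<le> B * (2 * e')" using l_approx[OF e'(1)] by blast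
      obtain d' where d': "d' \<in> D" "norm (h - d') < e'" "\<bar>l h - p d'\<bar> \<le> B * (2 * e')" using l_approx[OF e'(1)] by blast
      obtain d'' where d'': "d'' \<in> D" "norm (g + h - d'') < e'" "\<bar>l (g + h) - p d''\<bar> \<le> B * (2 * e')"
        using l_approx[OF e'(1)] by blast
      have "norm (d'' - (d + d')) \<le> 3 * e'"
      proof -
        have "d'' - (d + d') = (g - d) + (h - d') - (g + h - d'')" by simp
        then have "norm (d'' - (d + d')) = norm ((g - d) + (h - d') - (g + h - d''))" by (rule arg_cong)
        then show ?thesis
          using norm_triangle_ineq4[of "(g - d) + (h - d')" "g + h - d''"] norm_triangle_ineq[of "g - d" "h - d'"]
            d(2) d'(2) d''(2) by linarith
      qed
      then have "B * norm (d'' - (d + d')) \<le> B * (3 * e')" using lip(1) by (rule mult_left_mono)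
      then have "\<bar>p d'' - (p d + p d')\<bar> \<le> B * (3 * e')"
        using p_diff[OF d''(1) D(2)[OF d(1) d'(1)]] p_add[OF d(1) d'(1)] by linarith
      then have "\<bar>l (g + h) - (l g + l h)\<bar> \<le> 9 * B * e'" using d(3) d'(3) d''(3) by linarith
      then show ?thesis using e'(2) by linarith
    qed
    then have "\<bar>l (g + h) - (l g + l h)\<bar> \<le> 0" by (rule field_le_epsilon)
    then show ?thesis by simp
  qed
  have "bounded_linear l"
  proof (rule bounded_linear_intro[OF l_add])
    show "l (s *\<^sub>R h) = s *\<^sub>R l h" for s h
      using dir_deriv_unique[OF l[of "s *\<^sub>R h"] dir_deriv_scale[OF l[of h], of s]] by simp
    show "norm (l h) \<le> norm h * B" for h using dd_bound[OF l[of h]] by (simp add: mult.commute)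
  qed
  from bounded_linear_Blinfun_apply[OF this] have "dir_deriv f x h (Blinfun l h)" for h using l by simp
  then show ?thesis by blast
qed

text \<open>The exceptional set collects, for all directions in the countable set \<open>D \<inter> P\<close> and all rational parameters, the points
without Lipschitz bound, the oscillation sets and the porous sets. Every element of the group \<open>D\<close> is a difference of two elements of \<open>D \<inter> P\<close>,
so its directional derivative comes from \<open>dir_deriv_diff\<close>.\<close>

theorem Gateaux_differentiable_off_sigma_avoidable:
  assumes sep: "separable_space (euclidean :: 'a topology)"
  obtains N where "sigma_avoidable N" "\<And>x. x \<in> V - N \<Longrightarrow> isCont f x \<and> (\<exists>l :: 'a \<Rightarrow>\<^sub>L real. \<forall>h. dir_deriv f x h (l h))"
proof -
  obtain D :: "'a set" where D: "countable D" "closure D = UNIV" "\<And>a b. a \<in> D \<Longrightarrow> b \<in> D \<Longrightarrow> a + b \<in> D"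
    "\<And>a. a \<in> D \<Longrightarrow> - a \<in> D"
    by (rule countable_dense_subgroup[OF sep]) blast
  have DU: "\<exists>d\<in>D. d \<in> U" if "open U" "z \<in> U" for U z
    using that D(2) by (metis UNIV_I closure_iff_nhds_not_empty disjoint_iff subset_refl)
  obtain e where e: "e \<in> D" "e \<in> P" using DU[OF open_P] P_nonempty by blast
  define K where "K = D \<inter> P"
  have K: "countable K" "e \<in> K" using D(1) e by (auto simp: K_def)
  define N1 where "N1 = non_Lipschitz e"
  define N2 where "N2 = (\<Union>(k, a, b)\<in>{(k, a, b). k \<in> K \<and> a \<in> \<rat> \<and> b \<in> \<rat> \<and> a < b}. oscillating k a b)"
  define N3 where "N3 = (\<Union>(u, w, \<alpha>, \<beta>, i, j, n)\<in>K \<times> K \<times> \<rat> \<times> \<rat> \<times> UNIV \<times> UNIV \<times> UNIV.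
      porous_in (good_set u w \<alpha> \<beta> (1 / real (Suc i)) (1 / real (Suc j))) u (1 / real (Suc n)))"
  have "sigma_avoidable N1" unfolding N1_def using non_Lipschitz_avoidable[OF e(2)] by (rule avoidable_imp_sigma_avoidable)
  moreover have "sigma_avoidable N2"
    unfolding N2_def
  proof (rule sigma_avoidable_UN)
    show "countable {(k, a, b). k \<in> K \<and> a \<in> \<rat> \<and> b \<in> \<rat> \<and> (a::real) < b}"
      by (rule countable_subset[of _ "K \<times> \<rat> \<times> \<rat>"]) (use K countable_rat in auto)
    show "sigma_avoidable (case z of (k, a, b) \<Rightarrow> oscillating k a b)" if "z \<in> {(k, a, b). k \<in> K \<and> a \<in> \<rat> \<and> b \<in> \<rat> \<and> a < b}" for z
      using that by (auto simp: K_def intro!: avoidable_imp_sigma_avoidable oscillating_avoidable)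
  qed
  moreover have "sigma_avoidable N3"
    unfolding N3_def
  proof (rule sigma_avoidable_UN)
    show "countable (K \<times> K \<times> (\<rat> :: real set) \<times> (\<rat> :: real set) \<times> (UNIV :: nat set) \<times> (UNIV :: nat set) \<times> (UNIV :: nat set))"
      using K(1) countable_rat by (intro countable_SIGMA) auto
  qed (auto intro!: avoidable_imp_sigma_avoidable porous_avoidable)
  ultimately have null: "sigma_avoidable (N1 \<union> N2 \<union> N3)" by (intro sigma_avoidable_Un)
  have good: "isCont f x \<and> (\<exists>l :: 'a \<Rightarrow>\<^sub>L real. \<forall>h. dir_deriv f x h (l h))" if xN: "x \<in> V - (N1 \<union> N2 \<union> N3)" for x
  proof -
    have x: "x \<in> V" and x1: "x \<notin> non_Lipschitz e" using xN by (auto simp: N1_def)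
    have x2: "x \<notin> oscillating k a b" if "k \<in> K" "a \<in> \<rat>" "b \<in> \<rat>" "a < b" for k a b
    proof
      assume "x \<in> oscillating k a b"
      then have "x \<in> N2" unfolding N2_def using that by (intro UN_I[of "(k, a, b)"]) auto
      with xN show False by blast
    qed
    have x3: "x \<notin> porous_in (good_set u w \<alpha> \<beta> (1 / real (Suc i)) (1 / real (Suc j))) u (1 / real (Suc n))"
      if "u \<in> K" "w \<in> K" "\<alpha> \<in> \<rat>" "\<beta> \<in> \<rat>" for u w \<alpha> \<beta> i j n
    proof
      assume "x \<in> porous_in (good_set u w \<alpha> \<beta> (1 / real (Suc i)) (1 / real (Suc j))) u (1 / real (Suc n))"
      then have "x \<in> N3" unfolding N3_def using that by (intro UN_I[of "(u, w, \<alpha>, \<beta>, i, j, n)"]) auto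
      with xN show False by blast
    qed
    obtain B \<delta> where lip: "0 \<le> B" "0 < \<delta>" "\<And>h. norm h < \<delta> \<Longrightarrow> \<bar>f (x + h) - f x\<bar> \<le> B * norm h"
      by (rule pointwise_Lipschitz[OF x e(2) x1]) blast
    have "isCont f x"
      unfolding isCont_def
    proof -
      have "((\<lambda>y. B * norm (y - x)) \<longlongrightarrow> B * norm (x - x)) (at x)" by (intro tendsto_intros)
      then have "((\<lambda>y. B * norm (y - x)) \<longlongrightarrow> 0) (at x)" by simp
      moreover have "eventually (\<lambda>y. norm (f y - f x) \<le> B * norm (y - x)) (at x)"
        unfolding eventually_at using lip(2) lip(3)[of "_ - x"] by (intro exI[of _ \<delta>]) (auto simp: dist_norm)
      ultimately have "((\<lambda>y. f y - f x) \<longlongrightarrow> 0) (at x)" by (rule Lim_null_comparison[rotated])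
      then show "f \<midarrow>x\<rightarrow> f x" by (simp add: LIM_zero_iff)
    qed
    have "\<exists>q. dir_deriv f x k q" if "k \<in> K" for k
    proof -
      have "k \<in> P" using that by (simp add: K_def)
      from derivative_along_cone[OF x this lip(2,3) x2[OF that]] show ?thesis by blast
    qed
    then obtain q where q: "\<And>k. k \<in> K \<Longrightarrow> dir_deriv f x k (q k)" by metis
    have diff: "dir_deriv f x (w - u) (q w - q u)" if "u \<in> K" "w \<in> K" for u w
      by (rule dir_deriv_diff[OF x _ q[OF that(1)] q[OF that(2)] x3[OF that]]) (use that in \<open>auto simp: K_def\<close>)
    have K_add: "u + w \<in> K" if "u \<in> K" "w \<in> K" for u w using that D(3) P_add by (auto simp: K_def)
    have q_add: "q (u + w) = q u + q w" if "u \<in> K" "w \<in> K" for u w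
    proof -
      have "dir_deriv f x (u + w - u) (q (u + w) - q u)" by (rule diff[OF that(1) K_add[OF that]])
      then have "q (u + w) - q u = q w" using dir_deriv_unique[OF _ q[OF that(2)]] by simp
      then show ?thesis by simp
    qed
    have decomp: "\<exists>u\<in>K. \<exists>w\<in>K. d = w - u" if d: "d \<in> D" for d
    proof -
      obtain \<rho> where \<rho>: "0 < \<rho>" "\<And>t h. 0 < t \<Longrightarrow> norm h < t * \<rho> \<Longrightarrow> t *\<^sub>R e + h \<in> P" by (rule P_ball[OF e(2)]) blast
      obtain n :: nat where n: "norm d / \<rho> < real n" using reals_Archimedean2 by blast
      have "0 \<le> norm d / \<rho>" using \<rho>(1) by simp
      then have n0: "0 < n" using n by (cases n) auto
      have "real n *\<^sub>R e + d \<in> P" using n n0 \<rho>(1) by (intro \<rho>(2)) (auto simp: pos_divide_less_eq)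
      moreover have "real (Suc m) *\<^sub>R e \<in> D" for m
      proof (induction m)
        case (Suc m)
        have "real (Suc (Suc m)) *\<^sub>R e = real (Suc m) *\<^sub>R e + e"
          by (simp only: of_nat_Suc[of "Suc m"] scaleR_left_distrib scaleR_one add.commute)
        then show ?case using D(3)[OF Suc e(1)] by (simp only:)
      qed (use e(1) in simp)
      then have nD: "real n *\<^sub>R e \<in> D" using n0 by (metis Suc_pred)
      moreover have "real n *\<^sub>R e \<in> P" using P_scale[OF e(2), of "real n"] n0 by simp
      ultimately have "real n *\<^sub>R e \<in> K" "real n *\<^sub>R e + d \<in> K" using D(3)[OF nD d] by (auto simp: K_def)
      moreover have "d = (real n *\<^sub>R e + d) - real n *\<^sub>R e" by simp
      ultimately show ?thesis by blast
    qed
    then have "\<forall>d\<in>D. \<exists>s. dir_deriv f x d s" using diff by blast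
    then obtain p where p: "\<And>d. d \<in> D \<Longrightarrow> dir_deriv f x d (p d)" by metis
    have p_add: "p (a + b) = p a + p b" if ab: "a \<in> D" "b \<in> D" for a b
    proof -
      obtain u w where uw: "u \<in> K" "w \<in> K" "a = w - u" using decomp[OF ab(1)] by blast
      obtain u' w' where uw': "u' \<in> K" "w' \<in> K" "b = w' - u'" using decomp[OF ab(2)] by blast
      have a: "p a = q w - q u" using dir_deriv_unique[OF p[OF ab(1)]] diff[OF uw(1,2)] uw(3) by blast
      have b: "p b = q w' - q u'" using dir_deriv_unique[OF p[OF ab(2)]] diff[OF uw'(1,2)] uw'(3) by blast
      have "a + b = (w + w') - (u + u')" using uw(3) uw'(3) by simp
      then have "p (a + b) = q (w + w') - q (u + u')"
        using dir_deriv_unique[OF p[OF D(3)[OF ab]]] diff[OF K_add[OF uw(1) uw'(1)] K_add[OF uw(2) uw'(2)]] by metis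
      then show ?thesis using a b q_add[OF uw(1) uw'(1)] q_add[OF uw(2) uw'(2)] by simp
    qed
    from Gateaux_of_dense_directions[OF x lip D(2,3,4) p p_add]
    have "\<exists>l :: 'a \<Rightarrow>\<^sub>L real. \<forall>h. dir_deriv f x h (l h)" .
    with \<open>isCont f x\<close> show ?thesis by blast
  qed
  show ?thesis by (rule that[OF null good])
qed

end

section \<open>Quasiconvex functions\<close>

lemma quasiconvexD:
  "quasiconvex f \<Longrightarrow> 0 \<le> c \<Longrightarrow> c \<le> 1 \<Longrightarrow> f (c *\<^sub>R x + (1 - c) *\<^sub>R y) \<le> max (f x) (f y)"
  unfolding quasiconvex_def by simp

lemma quasiconvex_sublevel_convex:
  assumes "quasiconvex f"
  shows "convex {x. f x < a}"
proof (rule convexI)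
  fix x y and u v :: real assume "x \<in> {x. f x < a}" "y \<in> {x. f x < a}" "0 \<le> u" "0 \<le> v" "u + v = 1"
  moreover from this have "v = 1 - u" "u \<le> 1" by auto
  ultimately show "u *\<^sub>R x + v *\<^sub>R y \<in> {x. f x < a}"
    using quasiconvexD[OF assms, of u x y] by auto
qed

text \<open>If \<open>y' - y = t v\<close> with \<open>v\<close> close to \<open>x - z\<close>, then \<open>w = y - v\<close> is in the ball around \<open>z\<close>, and \<open>y\<close> lies on the segment from \<open>w\<close> to
\<open>y'\<close>. Since \<open>f w \<le> f y'\<close>, quasiconvexity gives \<open>f y \<le> f y'\<close>.\<close>

lemma quasiconvex_cone_monotone:
  fixes f :: "'a::real_normed_vector \<Rightarrow> real"
  assumes f: "quasiconvex f" and r: "0 < r" and s: "0 < s"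
    and le: "\<And>w y. w \<in> ball z r \<Longrightarrow> y \<in> ball x s \<Longrightarrow> f w \<le> f y"
  obtains P where "cone_monotone f P (ball x (min s (r / 2)))"
proof -
  define P where "P = (\<Union>t\<in>{0<..}. (\<lambda>v. t *\<^sub>R v) ` ball (x - z) (r / 2))"
  have PI: "t *\<^sub>R v \<in> P" if "0 < t" "v \<in> ball (x - z) (r / 2)" for t v
    unfolding P_def using that by (intro UN_I[of t] imageI) auto
  have PE: "\<exists>t v. 0 < t \<and> v \<in> ball (x - z) (r / 2) \<and> u = t *\<^sub>R v" if "u \<in> P" for u
    using that unfolding P_def by auto
  have "cone_monotone f P (ball x (min s (r / 2)))"
  proof
    show "open P" unfolding P_def by (intro open_UN ballI open_scaling) auto
    show "P \<noteq> {}" using PI[of 1 "x - z"] r by auto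
    show "t *\<^sub>R u \<in> P" if u: "u \<in> P" "0 < t" for u t
    proof -
      obtain t' v where "0 < t'" "v \<in> ball (x - z) (r / 2)" "u = t' *\<^sub>R v" using PE[OF u(1)] by blast
      then show ?thesis using PI[of "t * t'" v] u(2) by simp
    qed
    show "u + u' \<in> P" if u: "u \<in> P" "u' \<in> P" for u u'
    proof -
      obtain t v where t: "0 < t" "v \<in> ball (x - z) (r / 2)" "u = t *\<^sub>R v" using PE[OF u(1)] by blast
      obtain t' v' where t': "0 < t'" "v' \<in> ball (x - z) (r / 2)" "u' = t' *\<^sub>R v'" using PE[OF u(2)] by blast
      let ?v = "(t / (t + t')) *\<^sub>R v + (t' / (t + t')) *\<^sub>R v'"
      have "?v \<in> ball (x - z) (r / 2)"
        using t t' by (intro convexD[OF convex_ball]) (auto simp: add_divide_distrib[symmetric])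
      then have "(t + t') *\<^sub>R ?v \<in> P" using t t' by (intro PI) auto
      also have "(t + t') *\<^sub>R ?v = u + u'" using t t' by (simp add: scaleR_add_right)
      finally show ?thesis .
    qed
    show "f y \<le> f y'" if y: "y \<in> ball x (min s (r / 2))" "y' \<in> ball x (min s (r / 2))" "y' - y \<in> P" for y y'
    proof -
      obtain t v where t: "0 < t" "v \<in> ball (x - z) (r / 2)" "y' - y = t *\<^sub>R v" using PE[OF y(3)] by blast
      define w where "w = y - v"
      have "dist z w < r"
      proof -
        have "z - w = (v - (x - z)) + (x - y)" by (simp add: w_def)
        then have "norm (z - w) \<le> norm (v - (x - z)) + norm (x - y)" by (metis norm_triangle_ineq)
        then show ?thesis using t(2) y(1) by (simp add: dist_norm norm_minus_commute)
      qed
      then have wy: "f w \<le> f y'" using y(2) by (intro le) auto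
      have "y = (1 / (1 + t)) *\<^sub>R y' + (1 - 1 / (1 + t)) *\<^sub>R w"
      proof -
        have "(1 + t) *\<^sub>R y = y' + t *\<^sub>R w" using t(3) by (simp add: w_def algebra_simps)
        then have "(1 / (1 + t)) *\<^sub>R ((1 + t) *\<^sub>R y) = (1 / (1 + t)) *\<^sub>R (y' + t *\<^sub>R w)" by simp
        moreover have "1 - 1 / (1 + t) = (1 / (1 + t)) * t" using t(1) by (simp add: field_simps)
        ultimately show ?thesis using t(1) by (simp add: scaleR_add_right)
      qed
      then have "f y \<le> max (f y') (f w)"
        using quasiconvexD[OF f, of "1 / (1 + t)" y' w] t(1) by simp
      then show ?thesis using wy by simp
    qed
  qed simp
  then show ?thesis by (rule that)
qed

lemma cone_monotone_subset:
  assumes "cone_monotone f P V" "open W" "W \<subseteq> V"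
  shows "cone_monotone f P W"
proof -
  interpret cone_monotone f P V by (rule assms)
  show ?thesis
  proof
    show "f y \<le> f z" if "y \<in> W" "z \<in> W" "z - y \<in> P" for y z
      using that assms(3) by (intro mono) auto
  qed (use assms(2) open_P P_add P_scale P_nonempty in auto)
qed

definition dominating_region :: "('a::metric_space \<Rightarrow> real) \<Rightarrow> 'a set" where
  "dominating_region f = {x. \<exists>z r s. 0 < r \<and> 0 < s \<and> (\<forall>w\<in>ball z r. \<forall>y\<in>ball x s. f w \<le> f y)}"

text \<open>The neighbourhoods on which \<open>f\<close> is cone-monotone shrink to countably many balls with centres in a dense set.\<close>

lemma Gateaux_on_dominating_region:
  fixes f :: "'a::real_normed_vector \<Rightarrow> real"
  assumes sep: "separable_space (euclidean :: 'a topology)" and f: "quasiconvex f"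
  shows "sigma_avoidable {x \<in> dominating_region f. \<not> (isCont f x \<and> (\<exists>l :: 'a \<Rightarrow>\<^sub>L real. \<forall>h. dir_deriv f x h (l h)))}"
proof -
  let ?good = "\<lambda>x. isCont f x \<and> (\<exists>l :: 'a \<Rightarrow>\<^sub>L real. \<forall>h. dir_deriv f x h (l h))"
  obtain D :: "'a set" where D: "countable D" "closure D = UNIV" using separable_countable_dense[OF sep] .
  define I where "I = {(d, n). d \<in> D \<and> (\<exists>P. cone_monotone f P (ball d (1 / real (Suc n))))}"
  have "\<exists>N. sigma_avoidable N \<and> (\<forall>x\<in>ball (fst i) (1 / real (Suc (snd i))) - N. ?good x)" if i: "i \<in> I" for i
  proof -
    obtain P where "cone_monotone f P (ball (fst i) (1 / real (Suc (snd i))))" using i unfolding I_def by auto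
    then interpret cone_monotone f P "ball (fst i) (1 / real (Suc (snd i)))" .
    obtain N where "sigma_avoidable N" "\<And>x. x \<in> ball (fst i) (1 / real (Suc (snd i))) - N \<Longrightarrow> ?good x"
      by (rule Gateaux_differentiable_off_sigma_avoidable[OF sep]) blast
    then show ?thesis by blast
  qed
  then obtain N where N: "\<And>i. i \<in> I \<Longrightarrow> sigma_avoidable (N i)"
      "\<And>i x. i \<in> I \<Longrightarrow> x \<in> ball (fst i) (1 / real (Suc (snd i))) - N i \<Longrightarrow> ?good x" by metis
  have "countable I" by (rule countable_subset[of _ "D \<times> UNIV"]) (use D in \<open>auto simp: I_def\<close>)
  then have "sigma_avoidable (\<Union>i\<in>I. N i)" using N(1) by (rule sigma_avoidable_UN)
  moreover have "{x \<in> dominating_region f. \<not> ?good x} \<subseteq> (\<Union>i\<in>I. N i)"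
  proof clarify
    fix x assume x: "x \<in> dominating_region f" and bad: "\<not> ?good x"
    obtain z r s where rs: "0 < r" "0 < s" "\<And>w y. w \<in> ball z r \<Longrightarrow> y \<in> ball x s \<Longrightarrow> f w \<le> f y"
      using x unfolding dominating_region_def by blast
    define \<rho> where "\<rho> = min s (r / 2)"
    obtain P where P: "cone_monotone f P (ball x \<rho>)"
      unfolding \<rho>_def by (rule quasiconvex_cone_monotone[OF f rs]) blast
    have "0 < \<rho> / 2" using rs by (simp add: \<rho>_def)
    then obtain n where n: "1 / real (Suc n) < \<rho> / 2" using nat_approx_posE by blast
    obtain d where d: "d \<in> D" "dist d x < 1 / real (Suc n)"
      using dense_ball[OF D(2), of "1 / real (Suc n)" x] by auto
    have "ball d (1 / real (Suc n)) \<subseteq> ball x \<rho>"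
    proof
      fix y assume "y \<in> ball d (1 / real (Suc n))"
      then have "dist d y < 1 / real (Suc n)" by simp
      then have "dist x y < \<rho>" using dist_triangle[of x y d] d n by (simp add: dist_commute)
      then show "y \<in> ball x \<rho>" by simp
    qed
    then have "(d, n) \<in> I" using cone_monotone_subset[OF P open_ball] d(1) by (auto simp: I_def)
    moreover have "x \<in> ball d (1 / real (Suc n))" using d by simp
    ultimately show "x \<in> (\<Union>i\<in>I. N i)" using N(2)[of "(d, n)" x] bad by auto
  qed
  ultimately show ?thesis by (rule sigma_avoidable_subset)
qed

text \<open>The indicator \<open>g\<close> of the complement is quasiconvex and attains its minimum on a ball, so its dominating region is the whole
space; it is discontinuous precisely on the frontier.\<close>

lemma frontier_convex_sigma_avoidable:
  fixes F :: "'a::real_normed_vector set"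
  assumes sep: "separable_space (euclidean :: 'a topology)" and F: "convex F" "interior F \<noteq> {}"
  shows "sigma_avoidable (frontier F)"
proof -
  define g where "g = (\<lambda>x. if x \<in> F then 0 else 1 :: real)"
  have g: "quasiconvex g"
    unfolding quasiconvex_def
  proof (intro allI ballI)
    fix x y and c :: real assume c: "c \<in> {0..1}"
    show "g (c *\<^sub>R x + (1 - c) *\<^sub>R y) \<le> max (g x) (g y)"
    proof (cases "x \<in> F \<and> y \<in> F")
      case True
      then have "c *\<^sub>R x + (1 - c) *\<^sub>R y \<in> F" using c by (intro convexD[OF F(1)]) auto
      then show ?thesis by (simp add: g_def)
    qed (auto simp: g_def)
  qed
  obtain z r where zr: "0 < r" "ball z r \<subseteq> F" using F(2) by (meson all_not_in_conv mem_interior)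
  have "g w \<le> g y" if "w \<in> ball z r" for w y using zr that by (auto simp: g_def)
  then have "dominating_region g = UNIV" unfolding dominating_region_def using zr(1) zero_less_one by blast
  moreover have "\<not> isCont g x" if x: "x \<in> frontier F" for x
  proof
    assume "isCont g x"
    then have "eventually (\<lambda>y. dist (g y) (g x) < 1) (nhds x)"
      unfolding isCont_def using tendsto_at_iff_tendsto_nhds[of g x] zero_less_one tendstoD by blast
    then obtain U where U: "open U" "x \<in> U" "\<And>y. y \<in> U \<Longrightarrow> dist (g y) (g x) < 1"
      unfolding eventually_nhds by blast
    have same: "y \<in> F \<longleftrightarrow> x \<in> F" if "y \<in> U" for y
    proof (rule ccontr)
      assume "\<not> ?thesis"
      then have "dist (g y) (g x) = 1" by (auto simp: g_def dist_real_def)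
      then show False using U(3)[OF that] by simp
    qed
    show False
    proof (cases "x \<in> F")
      case True
      then have "U \<subseteq> F" using same by blast
      then have "x \<in> interior F" using U(1,2) by (intro interiorI)
      then show False using x by (simp add: frontier_def)
    next
      case False
      then have "U \<inter> F = {}" using same by blast
      then have "x \<notin> closure F" using U by (meson closure_iff_nhds_not_empty subset_refl disjoint_iff)
      then show False using x by (simp add: frontier_def)
    qed
  qed
  ultimately show ?thesis
    using Gateaux_on_dominating_region[OF sep g] by (elim sigma_avoidable_subset) auto
qed

text \<open>An interior point of the closure lies strictly between a point of the set and a point of an inner ball.\<close>

lemma convex_interior_closure_subset:
  fixes L :: "'a::real_normed_vector set"
  assumes L: "convex L" "interior L \<noteq> {}"
  shows "interior (closure L) \<subseteq> L"
proof
  fix x assume x: "x \<in> interior (closure L)"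
  obtain z r where zr: "0 < r" "ball z r \<subseteq> L" using L(2) by (meson all_not_in_conv mem_interior)
  have "((\<lambda>\<tau>. x + \<tau> *\<^sub>R (x - z)) \<longlongrightarrow> x + 0 *\<^sub>R (x - z)) (at_right 0)" by (intro tendsto_intros)
  then have "eventually (\<lambda>\<tau>. x + \<tau> *\<^sub>R (x - z) \<in> interior (closure L)) (at_right 0)"
    using x by (intro topological_tendstoD) auto
  then have "eventually (\<lambda>\<tau>. 0 < \<tau> \<and> x + \<tau> *\<^sub>R (x - z) \<in> interior (closure L)) (at_right (0::real))"
    by (intro eventually_conj eventually_at_right_less)
  from eventually_happens'[OF trivial_limit_at_right_real this]
  obtain \<tau> :: real where \<tau>: "0 < \<tau>" "x + \<tau> *\<^sub>R (x - z) \<in> closure L" using interior_subset by blast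
  have "0 < \<tau> * r" using \<tau> zr by simp
  then obtain x' where x': "x' \<in> L" "dist x' (x + \<tau> *\<^sub>R (x - z)) < \<tau> * r"
    using \<tau>(2) unfolding closure_approachable by blast
  define z' where "z' = z + (1 / \<tau>) *\<^sub>R (x + \<tau> *\<^sub>R (x - z) - x')"
  have "norm (z' - z) < r"
    using x'(2) \<tau>(1) by (simp add: z'_def dist_norm norm_minus_commute divide_less_eq mult.commute)
  then have "z' \<in> L" using zr(2) by (intro subsetD[OF zr(2)]) (simp add: dist_norm norm_minus_commute)
  then have "(1 / (1 + \<tau>)) *\<^sub>R x' + (\<tau> / (1 + \<tau>)) *\<^sub>R z' \<in> L"
    using x'(1) \<tau>(1) by (intro convexD[OF L(1)]) (auto simp: add_divide_distrib[symmetric])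
  also have "(1 / (1 + \<tau>)) *\<^sub>R x' + (\<tau> / (1 + \<tau>)) *\<^sub>R z' = x"
  proof -
    have "x' + \<tau> *\<^sub>R z' = (1 + \<tau>) *\<^sub>R x" using \<tau>(1) by (simp add: z'_def algebra_simps)
    then have "(1 / (1 + \<tau>)) *\<^sub>R (x' + \<tau> *\<^sub>R z') = x" using \<tau>(1) by simp
    then show ?thesis by (simp add: scaleR_add_right)
  qed
  finally show "x \<in> L" .
qed

lemma isCont_sublevel_interior:
  fixes f :: "'a::t2_space \<Rightarrow> real"
  assumes "isCont f x" "f x < a"
  shows "x \<in> interior {y. f y < a}"
proof -
  have "eventually (\<lambda>y. f y < a) (nhds x)"
    using assms unfolding isCont_def tendsto_at_iff_tendsto_nhds by (rule order_tendstoD(2))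
  then show ?thesis unfolding eventually_nhds by (auto intro: interiorI)
qed

lemma isCont_closure_sublevel:
  fixes f :: "'a::t2_space \<Rightarrow> real"
  assumes "isCont f x" "x \<in> closure {y. f y < a}"
  shows "f x \<le> a"
proof (rule ccontr)
  assume "\<not> ?thesis"
  then have "eventually (\<lambda>y. a < f y) (nhds x)"
    using assms(1) unfolding isCont_def tendsto_at_iff_tendsto_nhds by (intro order_tendstoD(1)) auto
  then obtain U where "open U" "x \<in> U" "\<And>y. y \<in> U \<Longrightarrow> a < f y" unfolding eventually_nhds by blast
  then have "{y. f y < a} \<subseteq> - U" by force
  then have "closure {y. f y < a} \<subseteq> - U" using \<open>open U\<close> by (intro closure_minimal) auto
  then show False using assms(2) \<open>x \<in> U\<close> by blast
qed

lemma Gateaux_imp_essentially_Gateaux: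
  assumes "\<And>h. dir_deriv f x h (blinfun_apply l h)"
  shows "essentially_Gateaux_differentiable_at f x"
  unfolding essentially_Gateaux_differentiable_at_def
proof (intro exI conjI ballI)
  show "residual_in (top_of_set (sphere 0 1)) (sphere 0 1)"
    unfolding residual_in_def by (intro conjI exI[of _ "{}"]) auto
  show "((\<lambda>t. (f (x + t *\<^sub>R h) - f x) / t) \<longlongrightarrow> blinfun_apply l h) (at 0)" if "h \<in> sphere 0 1" for h
    using assms[of h] by (simp add: dir_deriv_def)
qed

text \<open>If the directions filled a relatively open part of the sphere, the segments along them would fill an open part of
the closed set \<open>A\<close>.\<close>

lemma sphere_cone_nowhere_dense:
  fixes A :: "'a::real_normed_vector set"
  assumes A: "closed A" "interior A = {}" and s: "0 < s" and \<sigma>: "\<bar>\<sigma>\<bar> = (1::real)"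
    and E: "E \<subseteq> {h \<in> sphere 0 1. \<forall>t\<in>{1/2..1}. x + (\<sigma> * (t * s)) *\<^sub>R h \<in> A}"
  shows "nowhere_dense_in (top_of_set (sphere 0 1)) E"
proof -
  let ?S = "sphere 0 1 :: 'a set"
  let ?B = "{h \<in> ?S. \<forall>t\<in>{1/2..1}. x + (\<sigma> * (t * s)) *\<^sub>R h \<in> A}"
  have "closed (\<Inter>t\<in>{1/2..1}. (\<lambda>h. x + (\<sigma> * (t * s)) *\<^sub>R h) -` A)"
    using A(1) by (intro closed_INT ballI closed_vimage) (auto intro!: continuous_intros)
  then have "closedin (top_of_set ?S) (?S \<inter> (\<Inter>t\<in>{1/2..1}. (\<lambda>h. x + (\<sigma> * (t * s)) *\<^sub>R h) -` A))"
    by (rule closedin_closed_Int)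
  also have "?S \<inter> (\<Inter>t\<in>{1/2..1}. (\<lambda>h. x + (\<sigma> * (t * s)) *\<^sub>R h) -` A) = ?B" by auto
  finally have cl: "closedin (top_of_set ?S) ?B" .
  have empty: "(top_of_set ?S) interior_of ?B = {}"
  proof (rule ccontr)
    assume "\<not> ?thesis"
    then obtain h0 where h0: "h0 \<in> (top_of_set ?S) interior_of ?B" by blast
    obtain W where W: "open W" "(top_of_set ?S) interior_of ?B = ?S \<inter> W"
      using openin_interior_of[of "top_of_set ?S" ?B] unfolding openin_open by blast
    have WB: "?S \<inter> W \<subseteq> ?B" using interior_of_subset[of "top_of_set ?S" ?B] W(2) by blast
    have h0': "norm h0 = 1" "h0 \<in> W" using h0 W(2) by auto
    define y0 where "y0 = x + (\<sigma> * (3/4 * s)) *\<^sub>R h0"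
    have ny0: "norm (y0 - x) = 3/4 * s" using \<sigma> s h0' by (simp add: y0_def abs_mult)
    have \<sigma>2: "\<sigma> * \<sigma> = 1" using \<sigma> by (metis abs_mult_self_eq mult_1)
    have tn: "((\<lambda>y. norm (y - x)) \<longlongrightarrow> norm (y0 - x)) (nhds y0)"
      by (intro tendsto_intros filterlim_ident)
    have ev: "eventually (\<lambda>y. 1/2 * s < norm (y - x)) (nhds y0)" "eventually (\<lambda>y. norm (y - x) < s) (nhds y0)"
      using order_tendstoD(1)[OF tn[unfolded ny0], of "1/2 * s"] order_tendstoD(2)[OF tn[unfolded ny0], of s] s
      by simp_all
    have "((\<lambda>y. (\<sigma> / norm (y - x)) *\<^sub>R (y - x)) \<longlongrightarrow> (\<sigma> / norm (y0 - x)) *\<^sub>R (y0 - x)) (nhds y0)"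
      using ny0 s by (intro tendsto_intros filterlim_ident) auto
    moreover have "(\<sigma> / norm (y0 - x)) *\<^sub>R (y0 - x) = h0"
    proof -
      have "\<sigma> / (3/4 * s) * (\<sigma> * (3/4 * s)) = \<sigma> * \<sigma>" using s by (simp add: field_simps)
      then show ?thesis unfolding ny0 by (simp add: y0_def \<sigma>2)
    qed
    ultimately have "((\<lambda>y. (\<sigma> / norm (y - x)) *\<^sub>R (y - x)) \<longlongrightarrow> h0) (nhds y0)" by (simp only:)
    then have "eventually (\<lambda>y. (\<sigma> / norm (y - x)) *\<^sub>R (y - x) \<in> W) (nhds y0)"
      using W(1) h0'(2) by (rule topological_tendstoD)
    then have "eventually (\<lambda>y. y \<in> A) (nhds y0)"
      using ev
    proof eventually_elim
      case (elim y)
      have "0 < 1/2 * s" using s by simp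
      then have n0: "0 < norm (y - x)" using elim(2) by linarith
      let ?h = "(\<sigma> / norm (y - x)) *\<^sub>R (y - x)"
      have "norm ?h = 1" using n0 \<sigma> by (simp add: abs_divide)
      then have "?h \<in> ?S" by (simp only: mem_sphere_0)
      then have "?h \<in> ?B" using elim(1) by (intro subsetD[OF WB] IntI)
      then have all: "\<forall>t\<in>{1/2..1}. x + (\<sigma> * (t * s)) *\<^sub>R ?h \<in> A" unfolding mem_Collect_eq by (rule conjunct2)
      have "norm (y - x) / s \<in> {1/2..1}" using elim(2,3) s by (simp add: field_simps)
      with all have "x + (\<sigma> * (norm (y - x) / s * s)) *\<^sub>R ?h \<in> A" by (rule bspec)
      moreover have "(\<sigma> * (norm (y - x) / s * s)) *\<^sub>R ?h = y - x"
      proof -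
        have "\<sigma> * (norm (y - x) / s * s) * (\<sigma> / norm (y - x)) = \<sigma> * \<sigma>" using s n0 by simp
        then show ?thesis by (simp only: scaleR_scaleR \<sigma>2 scaleR_one)
      qed
      ultimately show ?case by simp
    qed
    then have "y0 \<in> interior A" unfolding eventually_nhds by (auto intro: interiorI)
    then show False using A(2) by blast
  qed
  show ?thesis
    unfolding nowhere_dense_in_def
  proof (intro conjI)
    show "E \<subseteq> topspace (top_of_set ?S)" using E by auto
    have "(top_of_set ?S) closure_of E \<subseteq> ?B" by (rule closure_of_minimal[OF E cl])
    then have "(top_of_set ?S) interior_of ((top_of_set ?S) closure_of E) \<subseteq> (top_of_set ?S) interior_of ?B"
      by (rule interior_of_mono)
    then show "(top_of_set ?S) interior_of ((top_of_set ?S) closure_of E) = {}" using empty by blast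
  qed
qed

text \<open>Suppose that \<open>f\<close> takes values below \<open>m\<close> at points \<open>x + t h\<close> with \<open>t\<close> arbitrarily close to 0. By convexity of the
sublevel sets there is a sign \<open>\<sigma>\<close> such that a whole segment \<open>x + \<sigma> t h\<close> with \<open>s / 2 \<le> t \<le> s\<close> lies in one of the sets \<open>A n\<close>. Such directions
form a countable union of nowhere dense sets; along all others \<open>f\<close> equals \<open>m\<close> near \<open>x\<close>.\<close>

lemma plateau_essentially_Gateaux:
  fixes f :: "'a::real_normed_vector \<Rightarrow> real"
  assumes f: "quasiconvex f" and G: "open G" "x \<in> G" "\<And>y. y \<in> G \<Longrightarrow> f y \<le> m"
    and x: "\<And>n::nat. x \<notin> closure {y. f y < m - 1 / real (Suc n)}"
    and thin: "\<And>n::nat. interior (closure {y. f y < m - 1 / real (Suc n)}) = {}"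
  shows "isCont f x" "essentially_Gateaux_differentiable_at f x"
proof -
  define A where "A = (\<lambda>n::nat. closure {y. f y < m - 1 / real (Suc n)})"
  have lower: "m - 1 / real (Suc n) \<le> f y" if "y \<notin> A n" for n y
  proof (rule ccontr)
    assume "\<not> ?thesis"
    then have "y \<in> {y. f y < m - 1 / real (Suc n)}" by simp
    then have "y \<in> A n" unfolding A_def by (rule subsetD[OF closure_subset])
    with that show False by blast
  qed
  have fx: "f x = m"
  proof (rule order_antisym)
    show "f x \<le> m" by (rule G(3)[OF G(2)])
    have "m \<le> f x + e" if e: "0 < e" for e
    proof -
      obtain n where "1 / real (Suc n) < e" using nat_approx_posE[OF e] by blast
      then show ?thesis using lower[of x n] x[of n] unfolding A_def by linarith
    qed
    then show "m \<le> f x" by (rule field_le_epsilon)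
  qed
  show "isCont f x"
    unfolding isCont_def tendsto_at_iff_tendsto_nhds
  proof (rule tendstoI)
    fix e :: real assume "0 < e"
    then obtain n where n: "1 / real (Suc n) < e" using nat_approx_posE by blast
    have "open (G \<inter> - A n)" "x \<in> G \<inter> - A n" using G x by (auto simp: A_def)
    then have "eventually (\<lambda>y. y \<in> G \<inter> - A n) (nhds x)" by (rule eventually_nhds_in_open)
    then show "eventually (\<lambda>y. dist (f y) (f x) < e) (nhds x)"
    proof eventually_elim
      case (elim y)
      then show ?case using lower[of y n] G(3)[of y] n fx by (auto simp: dist_real_def)
    qed
  qed
  define \<Omega> where "\<Omega> = {h \<in> sphere 0 1. eventually (\<lambda>t. f (x + t *\<^sub>R h) = m) (at 0)}"
  define B where "B = (\<lambda>(\<sigma>, n, k). {h \<in> sphere 0 1. \<forall>t\<in>{1/2..1}. x + (\<sigma> * (t * (1 / real (Suc k)))) *\<^sub>R h \<in> A n})"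
  have cover: "\<exists>p\<in>{1, -1} \<times> UNIV. h \<in> B p" if h: "h \<in> sphere 0 1 - \<Omega>" for h
  proof -
    obtain \<rho> where \<rho>: "0 < \<rho>" "ball x \<rho> \<subseteq> G" using G by (meson openE)
    have inG: "f (x + t *\<^sub>R h) \<le> m" if "\<bar>t\<bar> < \<rho>" for t
      using h that by (intro G(3) subsetD[OF \<rho>(2)]) (auto simp: dist_norm)
    have hit: "\<exists>t. 0 < \<bar>t\<bar> \<and> \<bar>t\<bar> < e \<and> f (x + t *\<^sub>R h) < m" if e: "0 < e" for e
    proof (rule ccontr)
      assume n: "\<not> ?thesis"
      have "f (x + t *\<^sub>R h) = m" if "t \<noteq> 0" "\<bar>t\<bar> < min e \<rho>" for t
      proof -
        have "0 < \<bar>t\<bar>" "\<bar>t\<bar> < e" using that by simp_all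
        then have "\<not> f (x + t *\<^sub>R h) < m" using n by blast
        then show ?thesis using inG[of t] that by linarith
      qed
      then have "eventually (\<lambda>t. f (x + t *\<^sub>R h) = m) (at 0)"
        unfolding eventually_at using e \<rho>(1) by (intro exI[of _ "min e \<rho>"]) (auto simp: dist_real_def)
      then show False using h by (simp add: \<Omega>_def)
    qed
    have "\<exists>\<sigma>\<in>{1, -1::real}. \<forall>e>0. \<exists>t>0. t < e \<and> f (x + (\<sigma> * t) *\<^sub>R h) < m"
    proof (rule ccontr)
      assume "\<not> ?thesis"
      then have no: "\<forall>\<sigma>\<in>{1, -1::real}. \<exists>e>0. \<forall>t. 0 < t \<longrightarrow> t < e \<longrightarrow> \<not> f (x + (\<sigma> * t) *\<^sub>R h) < m" by blast
      obtain e1 e2 where e: "0 < e1" "\<And>t. 0 < t \<Longrightarrow> t < e1 \<Longrightarrow> \<not> f (x + (1 * t) *\<^sub>R h) < m"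
          "0 < e2" "\<And>t. 0 < t \<Longrightarrow> t < e2 \<Longrightarrow> \<not> f (x + (-1 * t) *\<^sub>R h) < m"
        using bspec[OF no, of 1] bspec[OF no, of "-1"] by (auto simp only: insert_iff simp_thms)
      obtain t where t: "0 < \<bar>t\<bar>" "\<bar>t\<bar> < min e1 e2" "f (x + t *\<^sub>R h) < m" using hit[of "min e1 e2"] e by auto
      show False
      proof (cases "0 < t")
        case True
        then show False using e(2)[of t] t by simp
      next
        case False
        then show False using e(4)[of "- t"] t by simp
      qed
    qed
    then obtain \<sigma> where \<sigma>: "\<sigma> \<in> {1, -1}" and fq: "\<And>e. 0 < e \<Longrightarrow> \<exists>t>0. t < e \<and> f (x + (\<sigma> * t) *\<^sub>R h) < m" by blast
    obtain t0 where t0: "0 < t0" "f (x + (\<sigma> * t0) *\<^sub>R h) < m" using fq[OF zero_less_one] by blast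
    have seg: "f (x + (\<sigma> * t) *\<^sub>R h) < a" if "t1 \<le> t" "t \<le> t2" "f (x + (\<sigma> * t1) *\<^sub>R h) < a" "f (x + (\<sigma> * t2) *\<^sub>R h) < a" for t t1 t2 a
    proof (cases "t1 = t2")
      case False
      define c where "c = (t2 - t) / (t2 - t1)"
      have c: "0 \<le> c" "c \<le> 1" using that False by (auto simp: c_def divide_le_eq_1)
      have "c * (t2 - t1) = t2 - t" using that False by (simp add: c_def)
      then have tc: "t = c * t1 + (1 - c) * t2" by (simp add: algebra_simps)
      have "c *\<^sub>R (x + (\<sigma> * t1) *\<^sub>R h) + (1 - c) *\<^sub>R (x + (\<sigma> * t2) *\<^sub>R h) = x + (\<sigma> * t) *\<^sub>R h"
        unfolding tc by (simp add: algebra_simps)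
      then have "f (x + (\<sigma> * t) *\<^sub>R h) \<le> max (f (x + (\<sigma> * t1) *\<^sub>R h)) (f (x + (\<sigma> * t2) *\<^sub>R h))"
        using quasiconvexD[OF f c, of "x + (\<sigma> * t1) *\<^sub>R h" "x + (\<sigma> * t2) *\<^sub>R h"] by simp
      then show ?thesis using that by simp
    qed (use that in auto)
    have below: "f (x + (\<sigma> * t) *\<^sub>R h) < m" if t: "0 < t" "t \<le> t0" for t
    proof -
      obtain t1 where "0 < t1" "t1 < t" "f (x + (\<sigma> * t1) *\<^sub>R h) < m" using fq[OF t(1)] by blast
      then show ?thesis using seg[of t1 t t0 m] t t0 by simp
    qed
    obtain k where k: "1 / real (Suc k) < t0" using nat_approx_posE[OF t0(1)] by blast
    define s where "s = 1 / real (Suc k)"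
    have s: "0 < s" "s < t0" using k by (auto simp: s_def)
    let ?M = "max (f (x + (\<sigma> * (s / 2)) *\<^sub>R h)) (f (x + (\<sigma> * s) *\<^sub>R h))"
    have "0 < m - ?M" using below[of "s / 2"] below[of s] s by simp
    then obtain n where n: "1 / real (Suc n) < m - ?M" using nat_approx_posE by blast
    have "x + (\<sigma> * (t * s)) *\<^sub>R h \<in> A n" if t: "t \<in> {1/2..1}" for t
    proof -
      have "s / 2 \<le> t * s" "t * s \<le> s" using t s by auto
      moreover have "f (x + (\<sigma> * (s / 2)) *\<^sub>R h) < m - 1 / real (Suc n)" "f (x + (\<sigma> * s) *\<^sub>R h) < m - 1 / real (Suc n)"
        using n by linarith+
      ultimately have "f (x + (\<sigma> * (t * s)) *\<^sub>R h) < m - 1 / real (Suc n)" by (rule seg)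
      then have "x + (\<sigma> * (t * s)) *\<^sub>R h \<in> {y. f y < m - 1 / real (Suc n)}" by simp
      then show ?thesis unfolding A_def by (rule subsetD[OF closure_subset])
    qed
    then have "h \<in> B (\<sigma>, n, k)" using h unfolding B_def s_def by auto
    then show ?thesis using \<sigma> by blast
  qed
  have "residual_in (top_of_set (sphere 0 1)) \<Omega>"
    unfolding residual_in_def
  proof (intro conjI exI[of _ "(\<lambda>p. B p \<inter> (sphere 0 1 - \<Omega>)) ` ({1, -1} \<times> UNIV)"] ballI)
    show "\<Omega> \<subseteq> topspace (top_of_set (sphere 0 1))" by (auto simp: \<Omega>_def)
    show "countable ((\<lambda>p. B p \<inter> (sphere 0 1 - \<Omega>)) ` ({1, -1} \<times> UNIV))"
      by (intro countable_image countable_SIGMA) auto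
    show "topspace (top_of_set (sphere 0 1)) - \<Omega> = \<Union> ((\<lambda>p. B p \<inter> (sphere 0 1 - \<Omega>)) ` ({1, -1} \<times> UNIV))"
      using cover by auto
    fix E assume "E \<in> (\<lambda>p. B p \<inter> (sphere 0 1 - \<Omega>)) ` ({1, -1} \<times> UNIV)"
    then obtain \<sigma> n k where E: "\<sigma> \<in> {1, -1}" "E = B (\<sigma>, n, k) \<inter> (sphere 0 1 - \<Omega>)" by auto
    show "nowhere_dense_in (top_of_set (sphere 0 1)) E"
    proof (rule sphere_cone_nowhere_dense)
      show "closed (A n)" "interior (A n) = {}" using thin by (simp_all add: A_def)
      show "\<bar>\<sigma>\<bar> = 1" using E(1) by auto
      show "E \<subseteq> {h \<in> sphere 0 1. \<forall>t\<in>{1/2..1}. x + (\<sigma> * (t * (1 / real (Suc k)))) *\<^sub>R h \<in> A n}"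
        unfolding E(2) B_def by auto
    qed simp
  qed
  moreover have "((\<lambda>t. (f (x + t *\<^sub>R h) - f x) / t) \<longlongrightarrow> blinfun_apply 0 h) (at 0)" if "h \<in> \<Omega>" for h
  proof -
    have "eventually (\<lambda>t. f (x + t *\<^sub>R h) = m) (at 0)" using that by (simp add: \<Omega>_def)
    then have "eventually (\<lambda>t. (f (x + t *\<^sub>R h) - f x) / t = blinfun_apply 0 h) (at 0)"
      by eventually_elim (simp add: fx)
    then show ?thesis by (rule tendsto_eventually)
  qed
  ultimately show "essentially_Gateaux_differentiable_at f x"
    unfolding essentially_Gateaux_differentiable_at_def by blast
qed

theorem theorem9p2:
  fixes f :: "'a::banach \<Rightarrow> real"
  assumes "separable_space (euclidean :: 'a topology)"
    and "quasiconvex f"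
    and "densely_continuous f"
  shows "(\<exists>D. closure D = UNIV \<and>
            (\<forall>x\<in>D. isCont f x \<and> essentially_Gateaux_differentiable_at f x)) \<and>
         (reflexive_space TYPE('a) \<longrightarrow>
            (\<exists>N. Haar_null N \<and>
               (\<forall>x. x \<notin> N \<longrightarrow> isCont f x \<and> essentially_Gateaux_differentiable_at f x)))"
proof -
  note sep = assms(1) and f = assms(2)
  let ?good = "\<lambda>x. isCont f x \<and> essentially_Gateaux_differentiable_at f x"
  have cont: "\<exists>x\<in>W. isCont f x" if "open W" "W \<noteq> {}" for W
  proof -
    have "W \<inter> closure {x. isCont f x} \<noteq> {}" using that assms(3) by (simp add: densely_continuous_def)
    then show ?thesis using open_Int_closure_eq_empty[OF that(1)] by blast
  qed
  define high where "high = (\<lambda>a. interior {x. f x < a} \<noteq> {})"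
  define F where "F = (\<Inter>a\<in>Collect high. closure {x. f x < a})"
  define G where "G = interior F"
  have F: "closed F" "convex F"
    unfolding F_def using quasiconvex_sublevel_convex[OF f] by (auto intro!: convex_INT convex_closure simp del: Collect_mem_eq)
  have "- F \<subseteq> dominating_region f"
  proof
    fix x assume "x \<in> - F"
    then obtain a where a: "high a" "x \<in> - closure {x. f x < a}" by (auto simp: F_def)
    obtain z r where zr: "0 < r" "ball z r \<subseteq> {x. f x < a}"
      using a(1) unfolding high_def by (meson all_not_in_conv mem_interior)
    obtain s where s: "0 < s" "ball x s \<subseteq> - closure {x. f x < a}"
      using a(2) by (meson closed_closure open_Compl openE)
    have "f w \<le> f y" if "w \<in> ball z r" "y \<in> ball x s" for w y
    proof -
      have "f w < a" using zr(2) that(1) by blast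
      moreover have "\<not> f y < a" using s(2) that(2) closure_subset[of "{x. f x < a}"] by blast
      ultimately show ?thesis by simp
    qed
    then show "x \<in> dominating_region f" unfolding dominating_region_def using zr(1) s(1) by blast
  qed
  then have nullU: "sigma_avoidable {x \<in> - F. \<not> ?good x}"
    using Gateaux_imp_essentially_Gateaux by (intro sigma_avoidable_subset[OF Gateaux_on_dominating_region[OF sep f]]) blast
  have plateau: "\<exists>m. (\<forall>x\<in>G. f x \<le> m) \<and> (\<forall>a<m. interior (closure {x. f x < a}) = {})" if ne: "G \<noteq> {}"
  proof -
    obtain y0 where y0: "y0 \<in> G" "isCont f y0" using cont[of G] ne unfolding G_def by auto
    have high_ge: "f y0 \<le> a" if "high a" for a
    proof -
      have "y0 \<in> closure {x. f x < a}" using y0(1) that interior_subset unfolding G_def F_def by blast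
      then show ?thesis by (rule isCont_closure_sublevel[OF y0(2)])
    qed
    have "f x \<le> f y0" if x: "x \<in> G" for x
    proof (rule dense_ge)
      fix a assume "f y0 < a"
      then have ne: "interior {y. f y < a} \<noteq> {}" using isCont_sublevel_interior[OF y0(2)] by blast
      then have "F \<subseteq> closure {y. f y < a}" unfolding F_def high_def by blast
      then have "x \<in> interior (closure {y. f y < a})" using x interior_mono unfolding G_def by blast
      then show "f x \<le> a" using convex_interior_closure_subset[OF quasiconvex_sublevel_convex[OF f] ne] by auto
    qed
    moreover have "interior (closure {x. f x < a}) = {}" if a: "a < f y0" for a
    proof (rule ccontr)
      assume "\<not> ?thesis"
      then obtain y where y: "y \<in> interior (closure {x. f x < a})" "isCont f y"
        using cont[of "interior (closure {x. f x < a})"] by auto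
      then have "f y \<le> a" using interior_subset by (intro isCont_closure_sublevel) blast+
      then have "f y < (a + f y0) / 2" using a by simp
      then have "high ((a + f y0) / 2)" unfolding high_def using isCont_sublevel_interior[OF y(2)] by blast
      then show False using high_ge a by fastforce
    qed
    ultimately show ?thesis by blast
  qed
  have "open G" by (simp add: G_def)
  have "closure {x. ?good x} = UNIV"
  proof (rule ccontr)
    assume not_dense: "closure {x. ?good x} \<noteq> UNIV"
    define W where "W = - closure {x. ?good x}"
    have W: "open W" "W \<noteq> {}" "\<And>x. x \<in> W \<Longrightarrow> \<not> ?good x"
      using not_dense closure_subset[of "{x. ?good x}"] by (auto simp: W_def)
    show False
    proof (cases "W \<subseteq> F")
      case False
      obtain N where N: "Haar_null N" "{x \<in> - F. \<not> ?good x} \<subseteq> N" using sigma_avoidable_imp_Haar_null[OF sep nullU] .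
      have "open (W \<inter> - F)" using W(1) F(1) by auto
      moreover have "W \<inter> - F \<subseteq> N" using N(2) W(3) by blast
      ultimately have "W \<inter> - F \<subseteq> interior N" by (rule interior_maximal[rotated])
      then show False using Haar_null_no_interior[OF sep N(1)] False by blast
    next
      case True
      then have WG: "W \<subseteq> G" unfolding G_def using W(1) by (rule interior_maximal)
      then obtain m where m: "\<And>x. x \<in> G \<Longrightarrow> f x \<le> m" "\<And>a. a < m \<Longrightarrow> interior (closure {x. f x < a}) = {}"
        using plateau W(2) by (metis subset_empty)
      obtain x where x: "x \<in> W" "isCont f x" using cont[OF W(1,2)] by blast
      have "m \<le> f x"
      proof (rule ccontr)
        assume "\<not> m \<le> f x"
        then obtain a where a: "f x < a" "a < m" using dense by (meson not_le)
        have "x \<in> interior (closure {x. f x < a})"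
          using isCont_sublevel_interior[OF x(2) a(1)] interior_mono[OF closure_subset] by blast
        then show False using m(2)[OF a(2)] by blast
      qed
      have "x \<notin> closure {y. f y < m - 1 / real (Suc n)}" for n
      proof
        assume "x \<in> closure {y. f y < m - 1 / real (Suc n)}"
        then have "f x \<le> m - 1 / real (Suc n)" by (rule isCont_closure_sublevel[OF x(2)])
        moreover have "0 < 1 / real (Suc n)" by simp
        ultimately show False using \<open>m \<le> f x\<close> by linarith
      qed
      moreover have "interior (closure {y. f y < m - 1 / real (Suc n)}) = {}" for n by (rule m(2)) simp
      ultimately have "?good x"
        using plateau_essentially_Gateaux[OF f \<open>open G\<close> subsetD[OF WG x(1)] m(1)] by blast
      then show False using W(3)[OF x(1)] by blast
    qed
  qed
  moreover have "\<exists>N. Haar_null N \<and> (\<forall>x. x \<notin> N \<longrightarrow> ?good x)" if refl: "reflexive_space TYPE('a)"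
  proof -
    have "sigma_avoidable {x \<in> F. \<not> ?good x}"
    proof (cases "G = {}")
      case True
      then have "sigma_avoidable F" using reflexive_convex_sigma_avoidable[OF sep refl F(2,1)] by (simp add: G_def)
      then show ?thesis by (rule sigma_avoidable_subset) auto
    next
      case False
      then obtain m where m: "\<And>x. x \<in> G \<Longrightarrow> f x \<le> m" "\<And>a. a < m \<Longrightarrow> interior (closure {x. f x < a}) = {}"
        using plateau by blast
      let ?A = "\<lambda>n::nat. closure {y. f y < m - 1 / real (Suc n)}"
      have thin: "interior (?A n) = {}" for n by (rule m(2)) simp
      have "sigma_avoidable (?A n)" for n
        by (rule reflexive_convex_sigma_avoidable[OF sep refl _ _ thin])
          (use quasiconvex_sublevel_convex[OF f] in \<open>auto intro: convex_closure\<close>)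
      then have "sigma_avoidable (\<Union>n. ?A n)" by (intro sigma_avoidable_UN) auto
      moreover have "sigma_avoidable (frontier F)" using frontier_convex_sigma_avoidable[OF sep F(2)] False by (simp add: G_def)
      ultimately have "sigma_avoidable ((\<Union>n. ?A n) \<union> frontier F)" by (rule sigma_avoidable_Un)
      moreover have "{x \<in> F. \<not> ?good x} \<subseteq> (\<Union>n. ?A n) \<union> frontier F"
      proof
        fix x assume x: "x \<in> {x \<in> F. \<not> ?good x}"
        show "x \<in> (\<Union>n. ?A n) \<union> frontier F"
        proof (rule ccontr)
          assume n: "x \<notin> (\<Union>n. ?A n) \<union> frontier F"
          have "x \<in> G" using n x closure_subset[of F] by (auto simp: frontier_def G_def)
          then have "?good x"
            using plateau_essentially_Gateaux[OF f \<open>open G\<close> _ m(1) _ thin] n by blast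
          then show False using x by blast
        qed
      qed
      ultimately show ?thesis by (rule sigma_avoidable_subset)
    qed
    then have "sigma_avoidable ({x \<in> F. \<not> ?good x} \<union> {x \<in> - F. \<not> ?good x})" using nullU by (rule sigma_avoidable_Un)
    then obtain N where "Haar_null N" "{x \<in> F. \<not> ?good x} \<union> {x \<in> - F. \<not> ?good x} \<subseteq> N"
      by (rule sigma_avoidable_imp_Haar_null[OF sep])
    then show ?thesis by blast
  qed
  ultimately show ?thesis by blast
qed

end
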